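(* For any integer $p \geq 1$, any $p$-pass streaming algorithm that, with constant probability, outputs the lexicographically-first maximal independent set of an undirected graph $G(V,E)$ on $n$ vertices, given as a stream of its edges, requires $\Omega(n^2/p^5)$ bits of space.
   Context: The vertices of $G$ are totally ordered (lexicographically). The lexicographically-first maximal independent set is the one produced by the sequential greedy algorithm that visits the vertices in this order and adds a vertex to the set whenever none of its neighbors has already been added. In the graph streaming model the edges arrive one by one in an arbitrary order; a $p$-pass algorithm reads the stream sequentially $p$ times, and its space is the number of bits of memory it uses. *)

theory Defs
  imports "HOL-Probability.Probability_Mass_Function"
begin

text \<open>An \<open>n\<close>-vertex graph has vertex set \<open>{..<n}\<close>, ordered as natural numbers, and is given by its
  set of edges, each edge being an unordered pair of distinct vertices.\<close>

definition vertex_pairs :: "nat \<Rightarrow> nat set set" where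
  "vertex_pairs n = {e. e \<subseteq> {..<n} \<and> card e = 2}"

definition lfmis :: "nat \<Rightarrow> nat set set \<Rightarrow> nat set" where
  "lfmis n E = fold (\<lambda>v I. if \<exists>u\<in>I. {u, v} \<in> E then I else insert v I) [0..<n] {}"

definition edge_stream :: "nat set set \<Rightarrow> nat set list \<Rightarrow> bool" where
  "edge_stream E es \<longleftrightarrow> distinct es \<and> set es = E"

text \<open>The first argument of \<open>on_edge\<close> and \<open>on_end\<close> is the number of the current pass (from 0).
  Both replace the memory contents, possibly using fresh random bits, and emit a set of vertices to a
  write-only output tape, which is not charged as memory. An algorithm that produces its
  whole output from the final memory contents emits only in the last \<open>on_end\<close>. The algorithm may be
  non-uniform and computation is unbounded; only the memory is restricted.\<close>

record stream_alg =
  init :: "bool list"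
  on_edge :: "nat \<Rightarrow> nat set \<Rightarrow> bool list \<Rightarrow> (bool list \<times> nat set) pmf"
  on_end :: "nat \<Rightarrow> bool list \<Rightarrow> (bool list \<times> nat set) pmf"

definition uses_space :: "nat \<Rightarrow> nat \<Rightarrow> nat \<Rightarrow> stream_alg \<Rightarrow> bool" where
  "uses_space n p s a \<longleftrightarrow>
     length (init a) = s \<and>
     (\<forall>i<p. \<forall>mem. length mem = s \<longrightarrow>
        (\<forall>e\<in>vertex_pairs n. \<forall>(mem', W)\<in>set_pmf (on_edge a i e mem). length mem' = s) \<and>
        (\<forall>(mem', W)\<in>set_pmf (on_end a i mem). length mem' = s))"

text \<open>A configuration consists of the memory contents and the set of vertices emitted so far.\<close>

definition apply_action ::
    "(bool list \<Rightarrow> (bool list \<times> nat set) pmf) \<Rightarrow> bool list \<times> nat set \<Rightarrow> (bool list \<times> nat set) pmf"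
  where
  "apply_action f c = map_pmf (\<lambda>(mem', W). (mem', snd c \<union> W)) (f (fst c))"

primrec read_edges ::
    "stream_alg \<Rightarrow> nat \<Rightarrow> nat set list \<Rightarrow> bool list \<times> nat set \<Rightarrow> (bool list \<times> nat set) pmf" where
  "read_edges a i [] c = return_pmf c"
| "read_edges a i (e # es) c = bind_pmf (apply_action (on_edge a i e) c) (read_edges a i es)"

primrec run_passes :: "stream_alg \<Rightarrow> nat set list \<Rightarrow> nat \<Rightarrow> (bool list \<times> nat set) pmf" where
  "run_passes a es 0 = return_pmf (init a, {})"
| "run_passes a es (Suc i) =
     bind_pmf (bind_pmf (run_passes a es i) (read_edges a i es)) (apply_action (on_end a i))"

text \<open>A randomized algorithm is a distribution over \<open>stream_alg\<close>: in addition to the fresh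
  random bits of each step, it has a random string that stays accessible throughout the run without
  being stored in memory.\<close>

definition output_dist :: "stream_alg pmf \<Rightarrow> nat \<Rightarrow> nat set list \<Rightarrow> nat set pmf" where
  "output_dist A p es = map_pmf snd (bind_pmf A (\<lambda>a. run_passes a es p))"

definition streaming_algorithm :: "nat \<Rightarrow> nat \<Rightarrow> nat \<Rightarrow> stream_alg pmf \<Rightarrow> bool" where
  "streaming_algorithm n p s A \<longleftrightarrow> (\<forall>a\<in>set_pmf A. uses_space n p s a)"

definition outputs_lfmis :: "nat \<Rightarrow> nat \<Rightarrow> real \<Rightarrow> stream_alg pmf \<Rightarrow> bool" where
  "outputs_lfmis n p \<delta> A \<longleftrightarrow>
     (\<forall>E es. E \<subseteq> vertex_pairs n \<longrightarrow> edge_stream E es \<longrightarrow>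
        measure_pmf.prob (output_dist A p es) {lfmis n E} \<ge> \<delta>)"

end

theory Submission
  imports Defs
begin

text \<open>
  The proof reduces hidden pointer chasing to the independent set problem. Level \<open>j\<close> of the inputs of
  Alice and Bob consists of one set \<open>a j u\<close>, respectively \<open>b j u\<close>, for every pointer \<open>u\<close>, and the
  next pointer is the syndrome of \<open>a j u \<inter> b j u\<close> with respect to a linear code of linear
  minimum distance. As the greedy algorithm evaluates circuits of NOR gates, a chase of \<open>2 * p + 1\<close> levels
  with \<open>K\<close> pointers and sets of size \<open>O(K)\<close> is computed by a graph on \<open>O(p * K)\<close> vertices, in which
  each bit of the inputs is one edge.

  A \<open>p\<close>-pass algorithm becomes a protocol of \<open>2 * p\<close> messages, and each message advances the chase by
  at most one level. Call a row of the input heavy if its value has become much likelier, given the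
  messages and the levels passed so far, than it was initially. If both rows at the current pointer
  are light, then by the leftover hash lemma the next pointer is almost uniform even for a player
  who knows the whole own input; and by counting transcripts, a uniformly random row of the
  next level is heavy with probability only \<open>O(p * s / K\<^sup>2)\<close>. The errors of the levels add up, so
  \<open>s\<close> must be of order \<open>K\<^sup>2 / p\<^sup>2\<close>, that is \<open>n\<^sup>2 / p\<^sup>4\<close>. When this is less than one bit it remains to see
  that some memory is needed at all.
\<close>

section \<open>Two-source extraction by hashing\<close>

text \<open>The bound must not lose a logarithm, and this dictates the gadget. Computing
  \<open>2 * c\<close> parities of about \<open>K = 4 ^ c\<close> bits takes some
  \<open>c * K\<close> gates in general. Here each coordinate of a code of length
  \<open>2 * 2 ^ c\<close> is repeated \<open>2 ^ c\<close> times: the copies are summed once for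
  all, after which the \<open>2 * c\<close> parities range over only \<open>2 * 2 ^ c\<close> bits.
  So \<open>O(K)\<close> vertices per level carry of the order of \<open>K\<^sup>2\<close> input
  bits.

  Whether Alice's next row is heavy is a function of the history and of her own input. It is
  therefore not enough that the next pointer is nearly uniform on average; it must be so for a
  player who knows one of the two sources completely, which is what a strong extractor provides.

  The output is written during the whole run and is not part of the memory, so at the end neither
  player knows all of it. But the result of the chase shows in one decisive vertex, and the player
  in whose part of the stream it is emitted can name the last pointer. Hence the lower bound has to
  allow two independent answers, one of which is right.\<close>

lemma sum_card_fibres:
  assumes "finite A" "finite B" "f ` A \<subseteq> B"
  shows "(\<Sum>y\<in>B. card {x \<in> A. f x = y}) = card A"
  using assms by (subst card_eq_sum, subst sum.group[OF assms(1,2,3), symmetric]) simp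

text \<open>The last assumption is almost universality: for a uniform seed \<open>x\<close>, all but
  \<open>\<zeta>\<close> values \<open>y'\<close> collide with a given \<open>y\<close> with
  probability at most \<open>1 / card P\<close>. Symmetry of \<open>g\<close> lets either player
  hold the seed.\<close>

locale gadget =
  fixes P :: "'r set" and X :: "'x set" and g :: "'x \<Rightarrow> 'x \<Rightarrow> 'r" and \<zeta> :: real
  assumes finite_P: "finite P" and P_nonempty: "P \<noteq> {}"
    and finite_X: "finite X" and X_nonempty: "X \<noteq> {}"
    and g_in: "x \<in> X \<Longrightarrow> y \<in> X \<Longrightarrow> g x y \<in> P"
    and g_commute: "g x y = g y x"
    and collisions: "y \<in> X \<Longrightarrow>
      real (card {y' \<in> X. card X < card P * card {x \<in> X. g x y = g x y'}}) \<le> \<zeta>"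
begin

lemma card_P_pos: "card P > 0" and card_X_pos: "card X > 0"
  using finite_P P_nonempty finite_X X_nonempty by (auto simp: card_gt_0_iff)

lemma zeta_nonneg: "\<zeta> \<ge> 0"
proof -
  obtain y where "y \<in> X" using X_nonempty by auto
  from collisions[OF this] show ?thesis by (meson of_nat_0_le_iff order_trans)
qed

text \<open>The leftover hash lemma: \<open>x\<close> is the seed of the almost universal hash function \<open>g x\<close>.\<close>

lemma extractor:
  fixes fa :: "'a \<Rightarrow> 'x" and fb :: "'b \<Rightarrow> 'x"
  assumes finA: "finite A" and finB: "finite B" and fa: "fa ` A \<subseteq> X" and fb: "fb ` B \<subseteq> X"
    and lA: "\<And>x. x \<in> X \<Longrightarrow> real (card {a \<in> A. fa a = x}) \<le> lA"
    and lB: "\<And>x. x \<in> X \<Longrightarrow> real (card {b \<in> B. fb b = x}) \<le> lB"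
  shows "(\<Sum>a\<in>A. \<Sum>v\<in>P. \<bar>real (card {b \<in> B. g (fa a) (fb b) = v}) - card B / card P\<bar>)
    \<le> sqrt (card A * card P * (lA * (card B * card X * (\<zeta> * lB))))"
proof -
  define K where "K = real (card P)"
  define M where "M = real (card X)"
  define nb where "nb = real (card B)"
  define N where "N x v = real (card {b \<in> B. g x (fb b) = v})" for x v
  \<comment> \<open>Squared distance from uniformity under the seed \<open>x\<close>; by
    \<open>D_eq\<close> it is the number of colliding pairs minus its ideal value.\<close>
  define D where "D x = (\<Sum>v\<in>P. (N x v - nb / K)\<^sup>2)" for x
  have K: "K > 0" and M: "M > 0" using card_P_pos card_X_pos by (auto simp: K_def M_def)
  have nb0: "nb \<ge> 0" by (simp add: nb_def)
  have lA0: "lA \<ge> 0" and lB0: "lB \<ge> 0"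
    using X_nonempty lA lB by (meson all_not_in_conv of_nat_0_le_iff order_trans)+
  have sumN: "(\<Sum>v\<in>P. N x v) = nb" if "x \<in> X" for x
  proof -
    have "(\<Sum>v\<in>P. card {b \<in> B. g x (fb b) = v}) = card B"
      by (rule sum_card_fibres[OF finB finite_P]) (use that fb g_in in blast)
    then show ?thesis unfolding N_def nb_def by (metis of_nat_sum)
  qed
  have sumN2: "(\<Sum>v\<in>P. (N x v)\<^sup>2) = (\<Sum>b\<in>B. \<Sum>b'\<in>B. of_bool (g x (fb b) = g x (fb b')))"
    if x: "x \<in> X" for x
  proof -
    have N': "N x v = (\<Sum>b\<in>B. of_bool (g x (fb b) = v))" for v
      unfolding N_def using finB by (simp add: of_bool_def sum.If_cases Int_def)
    have "(\<Sum>v\<in>P. (N x v)\<^sup>2)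
        = (\<Sum>v\<in>P. \<Sum>b\<in>B. \<Sum>b'\<in>B. of_bool (g x (fb b) = v) * of_bool (g x (fb b') = v))"
      unfolding N' power2_eq_square sum_product ..
    also have "\<dots> = (\<Sum>b\<in>B. \<Sum>b'\<in>B. \<Sum>v\<in>P. of_bool (g x (fb b) = v) * of_bool (g x (fb b') = v))"
      by (subst sum.swap, rule sum.cong[OF refl], rule sum.swap)
    also have "\<dots> = (\<Sum>b\<in>B. \<Sum>b'\<in>B. of_bool (g x (fb b) = g x (fb b')))"
    proof (intro sum.cong refl)
      fix b b' assume b: "b \<in> B" "b' \<in> B"
      then have "g x (fb b) \<in> P" using x fb g_in by auto
      have "(\<Sum>v\<in>P. of_bool (g x (fb b) = v) * of_bool (g x (fb b') = v))
          = (\<Sum>v\<in>P. if v = g x (fb b) then of_bool (g x (fb b') = v) else (0::real))"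
        by (intro sum.cong) auto
      also have "\<dots> = of_bool (g x (fb b) = g x (fb b'))"
        using \<open>g x (fb b) \<in> P\<close> finite_P by (auto simp: sum.delta)
      finally show "(\<Sum>v\<in>P. of_bool (g x (fb b) = v) * of_bool (g x (fb b') = v))
          = (of_bool (g x (fb b) = g x (fb b')) :: real)" .
    qed
    finally show ?thesis .
  qed
  have D_eq: "D x = (\<Sum>b\<in>B. \<Sum>b'\<in>B. of_bool (g x (fb b) = g x (fb b')) - 1 / K)"
    if x: "x \<in> X" for x
  proof -
    have "D x = (\<Sum>v\<in>P. (N x v)\<^sup>2 - 2 * (nb / K) * N x v + (nb / K)\<^sup>2)"
      unfolding D_def by (intro sum.cong) (auto simp: power2_diff algebra_simps)
    also have "\<dots> = (\<Sum>v\<in>P. (N x v)\<^sup>2) - 2 * (nb / K) * nb + K * (nb / K)\<^sup>2"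
      unfolding sum.distrib sum_subtractf sum_distrib_left[symmetric] sumN[OF x] by (simp add: K_def)
    also have "\<dots> = (\<Sum>v\<in>P. (N x v)\<^sup>2) - nb * nb / K"
      using K by (simp add: field_simps power2_eq_square)
    also have "\<dots> = (\<Sum>b\<in>B. \<Sum>b'\<in>B. of_bool (g x (fb b) = g x (fb b')) - 1 / K)"
      by (simp add: sumN2[OF x] sum_subtractf nb_def)
    finally show ?thesis .
  qed
  have D_nonneg: "D x \<ge> 0" for x unfolding D_def by (intro sum_nonneg) auto
  define Bad where "Bad y = {y' \<in> X. card X < card P * card {x \<in> X. g x y = g x y'}}" for y
  have "(\<Sum>x\<in>X. D x) = (\<Sum>x\<in>X. \<Sum>b\<in>B. \<Sum>b'\<in>B. of_bool (g x (fb b) = g x (fb b')) - 1 / K)"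
    by (intro sum.cong D_eq) auto
  also have "\<dots> = (\<Sum>b\<in>B. \<Sum>b'\<in>B. \<Sum>x\<in>X. of_bool (g x (fb b) = g x (fb b')) - 1 / K)"
    by (subst sum.swap, rule sum.cong[OF refl], rule sum.swap)
  \<comment> \<open>A pair that is not exceptional collides with probability at most
    \<open>1 / K\<close>, so its term is not positive. Each \<open>b\<close> has at most
    \<open>\<zeta> * lB\<close> exceptional partners.\<close>
  also have "\<dots> \<le> (\<Sum>b\<in>B. \<Sum>b'\<in>B. M * of_bool (fb b' \<in> Bad (fb b)))"
  proof (intro sum_mono)
    fix b b' assume b: "b \<in> B" "b' \<in> B"
    let ?c = "card {x \<in> X. g x (fb b) = g x (fb b')}"
    have eq: "(\<Sum>x\<in>X. of_bool (g x (fb b) = g x (fb b')) - 1 / K) = real ?c - M / K"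
      using finite_X by (simp add: sum_subtractf M_def of_bool_def sum.If_cases Int_def)
    have le: "real ?c \<le> M" unfolding M_def using finite_X by (auto intro!: card_mono)
    show "(\<Sum>x\<in>X. of_bool (g x (fb b) = g x (fb b')) - 1 / K) \<le> M * of_bool (fb b' \<in> Bad (fb b))"
    proof (cases "fb b' \<in> Bad (fb b)")
      case True
      have "M / K \<ge> 0" using M K by simp
      then show ?thesis unfolding eq using True le by simp
    next
      case False
      then have "\<not> card X < card P * ?c" using b fb by (auto simp: Bad_def)
      then have "real (card P * ?c) \<le> real (card X)" by linarith
      then have "K * real ?c \<le> M" by (simp add: K_def M_def)
      then show ?thesis unfolding eq using False K by (simp add: field_simps)
    qed
  qed
  also have "\<dots> \<le> (\<Sum>b\<in>B. M * (\<zeta> * lB))"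
  proof (intro sum_mono)
    fix b assume b: "b \<in> B"
    have finBad: "finite (Bad (fb b))" unfolding Bad_def using finite_X by auto
    have "(\<Sum>b'\<in>B. of_bool (fb b' \<in> Bad (fb b))) = real (card {b' \<in> B. fb b' \<in> Bad (fb b)})"
      using finB by (simp add: of_bool_def sum.If_cases Int_def)
    also have "{b' \<in> B. fb b' \<in> Bad (fb b)} = (\<Union>y\<in>Bad (fb b). {b' \<in> B. fb b' = y})" by auto
    also have "real (card \<dots>) \<le> real (\<Sum>y\<in>Bad (fb b). card {b' \<in> B. fb b' = y})"
      by (intro of_nat_mono card_UN_le finBad)
    also have "\<dots> \<le> (\<Sum>y\<in>Bad (fb b). lB)"
      unfolding of_nat_sum by (intro sum_mono lB) (auto simp: Bad_def)
    also have "\<dots> = real (card (Bad (fb b))) * lB" by simp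
    also have "\<dots> \<le> \<zeta> * lB"
      using collisions[of "fb b"] b fb lB0 by (intro mult_right_mono) (auto simp: Bad_def)
    finally show "(\<Sum>b'\<in>B. M * of_bool (fb b' \<in> Bad (fb b))) \<le> M * (\<zeta> * lB)"
      unfolding sum_distrib_left[symmetric] using M by simp
  qed
  finally have sumD: "(\<Sum>x\<in>X. D x) \<le> nb * M * (\<zeta> * lB)" by (simp add: nb_def)
  \<comment> \<open>The seed is not uniform either, but as each of its values occurs at most
    \<open>lA\<close> times, the sum over uniform seeds grows by no more than this factor.\<close>
  have "(\<Sum>a\<in>A. D (fa a)) = (\<Sum>x\<in>X. \<Sum>a\<in>{a \<in> A. fa a = x}. D (fa a))"
    by (rule sum.group[OF finA finite_X fa, symmetric])
  also have "\<dots> = (\<Sum>x\<in>X. real (card {a \<in> A. fa a = x}) * D x)" by (intro sum.cong) auto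
  also have "\<dots> \<le> (\<Sum>x\<in>X. lA * D x)" by (intro sum_mono mult_right_mono lA D_nonneg)
  also have "\<dots> \<le> lA * (nb * M * (\<zeta> * lB))"
    unfolding sum_distrib_left[symmetric] using sumD lA0 by (intro mult_left_mono)
  finally have sumDA: "(\<Sum>a\<in>A. D (fa a)) \<le> lA * (nb * M * (\<zeta> * lB))" .
  let ?S = "\<Sum>a\<in>A. \<Sum>v\<in>P. \<bar>N (fa a) v - nb / K\<bar>"
  have S0: "?S \<ge> 0" by (intro sum_nonneg) auto
  have "?S = (\<Sum>z\<in>A \<times> P. \<bar>N (fa (fst z)) (snd z) - nb / K\<bar>)"
    by (subst sum.cartesian_product) (simp add: case_prod_beta)
  then have "?S\<^sup>2 = (\<Sum>z\<in>A \<times> P. \<bar>N (fa (fst z)) (snd z) - nb / K\<bar>)\<^sup>2" by simp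
  also have "\<dots> \<le> (\<Sum>z\<in>A \<times> P. \<bar>N (fa (fst z)) (snd z) - nb / K\<bar>\<^sup>2) * (\<Sum>z\<in>A \<times> P. 1\<^sup>2)"
    using Cauchy_Schwarz_ineq_sum[of "\<lambda>z. \<bar>N (fa (fst z)) (snd z) - nb / K\<bar>" "\<lambda>_. 1" "A \<times> P"]
    by simp
  also have "(\<Sum>z\<in>A \<times> P. \<bar>N (fa (fst z)) (snd z) - nb / K\<bar>\<^sup>2) = (\<Sum>a\<in>A. D (fa a))"
    unfolding D_def by (subst sum.cartesian_product) (simp add: case_prod_beta)
  also have "(\<Sum>z\<in>A \<times> P. 1\<^sup>2) = real (card A) * K" by (simp add: K_def card_cartesian_product)
  also have "(\<Sum>a\<in>A. D (fa a)) * (card A * K) \<le> lA * (nb * M * (\<zeta> * lB)) * (card A * K)"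
    using sumDA K by (intro mult_right_mono) auto
  finally have "?S \<le> sqrt (lA * (nb * M * (\<zeta> * lB)) * (card A * K))"
    by (rule real_le_rsqrt)
  then show ?thesis by (simp add: N_def nb_def K_def M_def mult_ac)
qed

text \<open>The values more than \<open>\<kappa>\<close> times as likely for a uniform element of
  \<open>S\<close> as under the uniform distribution on \<open>X\<close>, with denominators
  cleared.\<close>

definition heavy :: "real \<Rightarrow> 'a set \<Rightarrow> ('a \<Rightarrow> 'x) \<Rightarrow> 'x set" where
  "heavy \<kappa> S f = {x \<in> X. \<kappa> * card S < card {a \<in> S. f a = x} * card X}"

lemma heavy_subset: "heavy \<kappa> S f \<subseteq> X"
  by (auto simp: heavy_def)

text \<open>Each heavy value has probability above \<open>\<kappa> / card X\<close>, and the
  probabilities sum to at most one.\<close>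

lemma card_heavy:
  fixes \<kappa> :: real
  assumes "finite S" "f ` S \<subseteq> X" "\<kappa> > 0"
  shows "card (heavy \<kappa> S f) * \<kappa> \<le> card X"
proof (cases "S = {}")
  case True
  then show ?thesis by (simp add: heavy_def)
next
  case False
  then have S: "card S > 0" using assms by (simp add: card_gt_0_iff)
  have "card (heavy \<kappa> S f) * \<kappa> * card S = (\<Sum>x\<in>heavy \<kappa> S f. \<kappa> * card S)" by simp
  also have "\<dots> \<le> (\<Sum>x\<in>heavy \<kappa> S f. real (card {a \<in> S. f a = x} * card X))"
    by (intro sum_mono) (auto simp: heavy_def)
  also have "\<dots> \<le> (\<Sum>x\<in>X. real (card {a \<in> S. f a = x} * card X))"
    by (intro sum_mono2 finite_X heavy_subset) auto
  also have "\<dots> = real (\<Sum>x\<in>X. card {a \<in> S. f a = x}) * card X"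
    by (simp add: sum_distrib_right)
  also have "\<dots> = card X * real (card S)"
    by (subst sum_card_fibres[OF assms(1) finite_X assms(2)]) simp
  finally show ?thesis using S by (simp add: mult_le_cancel_right)
qed

text \<open>The bound of \<open>extractor\<close> as a fraction of all pairs, for sources whose
  values occur at most \<open>\<kappa>\<close> times as often as uniform ones.\<close>

definition ext_error :: "real \<Rightarrow> real" where
  "ext_error \<kappa> = \<kappa> * sqrt (card P * \<zeta> / card X)"

text \<open>Discarding heavy values bounds the multiplicities by
  \<open>\<kappa> * card A / card X\<close> and its analogue for \<open>B\<close>, as
  \<open>extractor\<close> requires. The test \<open>q\<close> may use all of \<open>a\<close> and
  not just the seed \<open>fa a\<close>: the deviation summed over all values bounds the bias of
  every test that the holder of the seed can apply.\<close>

lemma rectangle_step: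
  fixes fa :: "'a \<Rightarrow> 'x" and fb :: "'b \<Rightarrow> 'x"
  assumes finA: "finite A" and finB: "finite B" and fa: "fa ` A \<subseteq> X" and fb: "fb ` B \<subseteq> X"
    and \<kappa>: "\<kappa> > 0"
  shows "real (card {(a, b) \<in> A \<times> B. fa a \<notin> heavy \<kappa> A fa \<and> fb b \<notin> heavy \<kappa> B fb
             \<and> q a (g (fa a) (fb b))})
    \<le> (\<Sum>(a, b)\<in>A \<times> B. card {v \<in> P. q a v} / card P + ext_error \<kappa>)"
proof -
  define A' where "A' = {a \<in> A. fa a \<notin> heavy \<kappa> A fa}"
  define B' where "B' = {b \<in> B. fb b \<notin> heavy \<kappa> B fb}"
  define K where "K = real (card P)"
  define M where "M = real (card X)"
  define N where "N a v = real (card {b \<in> B'. g (fa a) (fb b) = v})" for a v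
  have K: "K > 0" and M: "M > 0" using card_P_pos card_X_pos by (auto simp: K_def M_def)
  have fin': "finite A'" "finite B'" using finA finB by (auto simp: A'_def B'_def)
  have sub': "A' \<subseteq> A" "B' \<subseteq> B" by (auto simp: A'_def B'_def)
  have light: "real (card {c \<in> {c \<in> C. f c \<notin> heavy \<kappa> C f}. f c = x}) \<le> \<kappa> * card C / M"
    if "finite C" "x \<in> X" for C :: "'c set" and f x
  proof (cases "x \<in> heavy \<kappa> C f")
    case True
    then have e: "{c \<in> {c \<in> C. f c \<notin> heavy \<kappa> C f}. f c = x} = {}" by auto
    show ?thesis unfolding e using \<kappa> M by simp
  next
    case False
    then have "card {c \<in> C. f c = x} * M \<le> \<kappa> * card C"
      using that by (auto simp: heavy_def M_def)
    moreover have "card {c \<in> {c \<in> C. f c \<notin> heavy \<kappa> C f}. f c = x} \<le> card {c \<in> C. f c = x}"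
      using that by (intro card_mono) auto
    ultimately show ?thesis using M
      by (smt (verit) mult_right_mono of_nat_mono pos_le_divide_eq)
  qed
  have "card {(a, b) \<in> A \<times> B. fa a \<notin> heavy \<kappa> A fa \<and> fb b \<notin> heavy \<kappa> B fb \<and> q a (g (fa a) (fb b))}
      = card (SIGMA a:A'. {b \<in> B'. q a (g (fa a) (fb b))})"
    by (rule arg_cong[of _ _ card]) (auto simp: A'_def B'_def)
  also have "\<dots> = (\<Sum>a\<in>A'. card {b \<in> B'. q a (g (fa a) (fb b))})"
    using fin' by (subst card_SigmaI) auto
  also have "real \<dots> = (\<Sum>a\<in>A'. \<Sum>v\<in>{v \<in> P. q a v}. N a v)"
    unfolding of_nat_sum
  proof (intro sum.cong refl)
    fix a assume a: "a \<in> A'"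
    have "card {b \<in> B'. q a (g (fa a) (fb b))}
        = (\<Sum>v\<in>{v \<in> P. q a v}. card {b \<in> {b \<in> B'. q a (g (fa a) (fb b))}. g (fa a) (fb b) = v})"
      by (rule sum_card_fibres[symmetric])
        (use a fa fb sub' g_in finite_P fin' in \<open>auto simp: image_subset_iff subset_iff\<close>)
    also have "\<dots> = (\<Sum>v\<in>{v \<in> P. q a v}. card {b \<in> B'. g (fa a) (fb b) = v})"
      by (intro sum.cong refl arg_cong[of _ _ card]) auto
    finally show "real (card {b \<in> B'. q a (g (fa a) (fb b))}) = (\<Sum>v\<in>{v \<in> P. q a v}. N a v)"
      by (simp add: N_def)
  qed
  also have "\<dots> \<le> (\<Sum>a\<in>A'. \<Sum>v\<in>{v \<in> P. q a v}. card B' / K + \<bar>N a v - card B' / K\<bar>)"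
    by (intro sum_mono) auto
  also have "\<dots> = (\<Sum>a\<in>A'. card {v \<in> P. q a v} * (card B' / K))
      + (\<Sum>a\<in>A'. \<Sum>v\<in>{v \<in> P. q a v}. \<bar>N a v - card B' / K\<bar>)"
    by (simp add: sum.distrib)
  also have "(\<Sum>a\<in>A'. card {v \<in> P. q a v} * (card B' / K))
      \<le> (\<Sum>a\<in>A. card {v \<in> P. q a v} * (card B / K))"
  proof -
    have "real (card B') / K \<le> card B / K" using K card_mono[OF finB sub'(2)]
      by (simp add: divide_right_mono)
    then have "(\<Sum>a\<in>A'. card {v \<in> P. q a v} * (card B' / K))
        \<le> (\<Sum>a\<in>A'. card {v \<in> P. q a v} * (card B / K))"
      by (intro sum_mono mult_left_mono) auto
    also have "\<dots> \<le> (\<Sum>a\<in>A. card {v \<in> P. q a v} * (card B / K))"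
      using K by (intro sum_mono2 finA sub') auto
    finally show ?thesis .
  qed
  also have "(\<Sum>a\<in>A'. \<Sum>v\<in>{v \<in> P. q a v}. \<bar>N a v - card B' / K\<bar>)
      \<le> (\<Sum>a\<in>A'. \<Sum>v\<in>P. \<bar>N a v - card B' / K\<bar>)"
    using finite_P by (intro sum_mono sum_mono2) auto
  also have "\<dots> \<le> sqrt (card A' * K * (\<kappa> * card A / M * (card B' * M * (\<zeta> * (\<kappa> * card B / M)))))"
    unfolding N_def K_def M_def
  proof (rule extractor[OF fin', where lA = "\<kappa> * card A / real (card X)" and lB = "\<kappa> * card B / real (card X)", unfolded of_nat_mult])
    show "fa ` A' \<subseteq> X" "fb ` B' \<subseteq> X" using fa fb sub' by blast+
  qed (use light[OF finA, of _ fa] light[OF finB, of _ fb] in \<open>auto simp: A'_def B'_def M_def\<close>)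
  also have "\<dots> \<le> sqrt (card A * K * (\<kappa> * card A / M * (card B * M * (\<zeta> * (\<kappa> * card B / M)))))"
    using card_mono[OF finA sub'(1)] card_mono[OF finB sub'(2)] K M \<kappa> zeta_nonneg
    by (intro real_sqrt_le_mono mult_mono) auto
  also have "\<dots> = sqrt ((\<kappa> * card A * card B)\<^sup>2 * (K * \<zeta> / M))"
    using M by (intro arg_cong[of _ _ sqrt]) (simp add: field_simps power2_eq_square)
  also have "\<dots> = ext_error \<kappa> * card A * card B"
    using \<kappa> by (subst real_sqrt_mult) (simp add: ext_error_def K_def M_def abs_mult)
  finally have "real (card {(a, b) \<in> A \<times> B. fa a \<notin> heavy \<kappa> A fa \<and> fb b \<notin> heavy \<kappa> B fb
             \<and> q a (g (fa a) (fb b))})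
     \<le> (\<Sum>a\<in>A. card {v \<in> P. q a v} * (card B / K)) + ext_error \<kappa> * card A * card B" by simp
  also have "\<dots> = (\<Sum>(a, b)\<in>A \<times> B. card {v \<in> P. q a v} / card P + ext_error \<kappa>)"
  proof -
    have "(\<Sum>(a, b)\<in>A \<times> B. card {v \<in> P. q a v} / card P + ext_error \<kappa>)
        = (\<Sum>a\<in>A. card B * (card {v \<in> P. q a v} / card P + ext_error \<kappa>))"
      by (subst sum.cartesian_product[symmetric]) simp
    also have "\<dots> = (\<Sum>a\<in>A. card {v \<in> P. q a v} * (card B / K) + ext_error \<kappa> * card B)"
      by (intro sum.cong refl) (simp add: K_def algebra_simps)
    also have "\<dots> = (\<Sum>a\<in>A. card {v \<in> P. q a v} * (card B / K)) + ext_error \<kappa> * card A * card B"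
      by (simp add: sum.distrib)
    finally show ?thesis ..
  qed
  finally show ?thesis .
qed

section \<open>Independent random levels against sets of small density\<close>

abbreviation rows :: "('r \<Rightarrow> 'x) set" where "rows \<equiv> PiE P (\<lambda>_. X)"

text \<open>Union bound over the set of pointers that are hit: there are at most
  \<open>2 ^ card P\<close> such sets, and as the entries of a level are independent, each pointer
  in the set costs a factor \<open>\<kappa>\<close>.\<close>

lemma card_rows_hitting:
  fixes \<kappa> :: real
  assumes H: "\<And>v. v \<in> P \<Longrightarrow> H v \<subseteq> X" "\<And>v. v \<in> P \<Longrightarrow> card (H v) * \<kappa> \<le> card X" and \<kappa>: "\<kappa> \<ge> 1"
  shows "card {l \<in> rows. r \<le> card {v \<in> P. l v \<in> H v}} * \<kappa> ^ r \<le> 2 ^ card P * real (card rows)"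
proof -
  define VV where "VV = {V. V \<subseteq> P \<and> r \<le> card V}"
  define F where "F V = PiE P (\<lambda>v. if v \<in> V then H v else X)" for V
  have finVV: "finite VV" using finite_P by (simp add: VV_def)
  have finH: "finite (H v)" if "v \<in> P" for v using H(1)[OF that] finite_X by (rule finite_subset)
  have "{l \<in> rows. r \<le> card {v \<in> P. l v \<in> H v}} \<subseteq> (\<Union>V\<in>VV. F V)"
  proof
    fix l assume l: "l \<in> {l \<in> rows. r \<le> card {v \<in> P. l v \<in> H v}}"
    then have "{v \<in> P. l v \<in> H v} \<in> VV" "l \<in> F {v \<in> P. l v \<in> H v}"
      by (auto simp: VV_def F_def PiE_def Pi_def)
    then show "l \<in> (\<Union>V\<in>VV. F V)" by blast
  qed
  moreover have "finite (F V)" for V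
    unfolding F_def using finite_P finite_X finH by (intro finite_PiE) auto
  ultimately have "card {l \<in> rows. r \<le> card {v \<in> P. l v \<in> H v}} \<le> card (\<Union>V\<in>VV. F V)"
    using finVV by (intro card_mono) auto
  also have "\<dots> \<le> (\<Sum>V\<in>VV. card (F V))" by (rule card_UN_le[OF finVV])
  finally have "card {l \<in> rows. r \<le> card {v \<in> P. l v \<in> H v}} * \<kappa> ^ r
      \<le> (\<Sum>V\<in>VV. card (F V)) * \<kappa> ^ r"
    using \<kappa> by (intro mult_right_mono of_nat_mono) auto
  also have "\<dots> = (\<Sum>V\<in>VV. card (F V) * \<kappa> ^ r)" by (simp add: sum_distrib_right)
  also have "\<dots> \<le> (\<Sum>V\<in>VV. real (card rows))"
  proof (intro sum_mono)
    fix V assume V: "V \<in> VV"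
    have "card (F V) * \<kappa> ^ r \<le> card (F V) * \<kappa> ^ card V"
      using V \<kappa> by (intro mult_left_mono power_increasing) (auto simp: VV_def)
    also have "\<kappa> ^ card V = (\<Prod>v\<in>P. if v \<in> V then \<kappa> else 1)"
      using V finite_P by (subst prod.If_cases) (auto simp: VV_def Int_absorb1 Collect_mem_eq)
    also have "card (F V) * \<dots> = (\<Prod>v\<in>P. card (if v \<in> V then H v else X) * (if v \<in> V then \<kappa> else 1))"
      unfolding F_def by (simp add: card_PiE[OF finite_P] prod.distrib)
    also have "\<dots> \<le> (\<Prod>v\<in>P. real (card X))"
      using H(2) \<kappa> by (intro prod_mono) auto
    also have "\<dots> = card rows" by (simp add: card_PiE[OF finite_P])
    finally show "card (F V) * \<kappa> ^ r \<le> card rows" .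
  qed
  also have "\<dots> = card VV * real (card rows)" by simp
  also have "card VV \<le> card (Pow P)" unfolding VV_def using finite_P by (intro card_mono) auto
  then have "card VV * real (card rows) \<le> 2 ^ card P * real (card rows)"
    by (intro mult_right_mono) (auto simp: card_Pow finite_P simp flip: of_nat_power)
  finally show ?thesis by simp
qed

definition inputs :: "nat \<Rightarrow> (nat \<Rightarrow> 'r \<Rightarrow> 'x) set" where
  "inputs L = PiE {..<L} (\<lambda>_. rows)"

lemma finite_rows: "finite rows" and rows_nonempty: "rows \<noteq> {}"
  using finite_P finite_X X_nonempty by (auto intro!: finite_PiE simp: PiE_eq_empty_iff)

lemma finite_inputs: "finite (inputs L)" and inputs_nonempty: "inputs L \<noteq> {}"
  unfolding inputs_def using finite_rows rows_nonempty
  by (auto intro!: finite_PiE simp: PiE_eq_empty_iff)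

lemma inputs_in: "a \<in> inputs L \<Longrightarrow> j < L \<Longrightarrow> v \<in> P \<Longrightarrow> a j v \<in> X"
  unfolding inputs_def by (meson PiE_mem lessThan_iff)

text \<open>The levels are independent, so a bound on the fraction of bad choices of level
  \<open>j\<close>, with all others frozen, bounds the overall fraction. The factor \<open>c\<close>
  will be a power of \<open>\<kappa>\<close>; keeping it on the left avoids division.\<close>

lemma card_inputs_split:
  fixes c C :: real
  assumes j: "j < L" and bound: "\<And>a. card {l \<in> rows. Q (a(j := l))} * c \<le> C * card rows"
    and c: "c \<ge> (0::real)"
  shows "card {a \<in> inputs L. Q a} * c \<le> C * card (inputs L)"
proof -
  define J where "J = {..<L} - {j}"
  define R where "R = PiE J (\<lambda>_. rows)"
  have fR: "finite R" unfolding R_def J_def by (rule finite_PiE) (auto intro: finite_rows)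
  have LJ: "{..<L} = insert j J" and jJ: "j \<notin> J" using j by (auto simp: J_def)
  have inj: "inj_on (\<lambda>(l, a). a(j := l)) (rows \<times> R)"
    unfolding R_def using inj_combinator[OF jJ, of "\<lambda>_. rows"] by simp
  have im: "inputs L = (\<lambda>(l, a). a(j := l)) ` (rows \<times> R)"
    unfolding inputs_def LJ R_def by (rule PiE_insert_eq)
  have "card (inputs L) = card rows * card R"
    unfolding im card_image[OF inj] by (simp add: card_cartesian_product)
  have "{a \<in> inputs L. Q a} = (\<lambda>(l, a). a(j := l)) ` {(l, a) \<in> rows \<times> R. Q (a(j := l))}"
    unfolding im by auto
  also have "card \<dots> = card {(l, a) \<in> rows \<times> R. Q (a(j := l))}"
    by (intro card_image inj_on_subset[OF inj]) auto
  also have "\<dots> = card (SIGMA a:R. {l \<in> rows. Q (a(j := l))})"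
    by (rule bij_betw_same_card[of prod.swap]) (auto simp: bij_betw_def inj_on_def image_def)
  also have "\<dots> = (\<Sum>a\<in>R. card {l \<in> rows. Q (a(j := l))})"
    using fR finite_rows by (subst card_SigmaI) auto
  finally have "card {a \<in> inputs L. Q a} * c = (\<Sum>a\<in>R. card {l \<in> rows. Q (a(j := l))} * c)"
    by (simp add: sum_distrib_right)
  also have "\<dots> \<le> (\<Sum>a\<in>R. C * card rows)" by (intro sum_mono bound)
  also have "\<dots> = C * card (inputs L)"
    using \<open>card (inputs L) = card rows * card R\<close> by simp
  finally show ?thesis .
qed

end

section \<open>Hidden pointer chasing\<close>

lemma card_pairs_le_snd:
  fixes c C :: real
  assumes "finite A" "finite B" "\<And>b. b \<in> B \<Longrightarrow> card {a \<in> A. Q a b} * c \<le> C"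
  shows "card {(a, b) \<in> A \<times> B. Q a b} * c \<le> C * card B"
proof -
  have "card {(a, b) \<in> A \<times> B. Q a b} = card (SIGMA b:B. {a \<in> A. Q a b})"
    by (rule bij_betw_same_card[of prod.swap]) (auto simp: bij_betw_def inj_on_def image_def)
  also have "\<dots> = (\<Sum>b\<in>B. card {a \<in> A. Q a b})" using assms by (subst card_SigmaI) auto
  finally have "card {(a, b) \<in> A \<times> B. Q a b} * c = (\<Sum>b\<in>B. card {a \<in> A. Q a b} * c)"
    by (simp add: sum_distrib_right)
  also have "\<dots> \<le> (\<Sum>b\<in>B. C)" using assms by (intro sum_mono)
  finally show ?thesis by (simp add: mult.commute)
qed

lemma card_pairs_swap: "card {(a, b) \<in> A \<times> B. Q a b} = card {(b, a) \<in> B \<times> A. Q a b}"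
  by (rule bij_betw_same_card[of prod.swap]) (auto simp: bij_betw_def inj_on_def image_def)

lemma card_pairs_sum:
  assumes "finite (A \<times> B)"
  shows "real (card {(a, b) \<in> A \<times> B. Q a b}) = (\<Sum>z\<in>A \<times> B. of_bool (Q (fst z) (snd z)))"
proof -
  have "{(a, b) \<in> A \<times> B. Q a b} = {z \<in> A \<times> B. Q (fst z) (snd z)}" by auto
  then show ?thesis using assms by (simp add: of_bool_def sum.If_cases Int_def)
qed

text \<open>Each round of the protocol consists of one message from each player and, as a bonus, reveals
  the current level of both inputs. Conditioned on the history, the inputs are uniform on a
  rectangle.\<close>

locale protocol = gadget P X g \<zeta>
  for P :: "'r set" and X :: "'x set" and g \<zeta> +
  fixes u0 :: 'r and L :: nat and \<kappa> :: real and Msg :: "'m set"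
    and fA fB :: "(('m \<times> ('r \<Rightarrow> 'x)) \<times> ('m \<times> ('r \<Rightarrow> 'x))) list \<Rightarrow> (nat \<Rightarrow> 'r \<Rightarrow> 'x) \<Rightarrow> 'm"
  assumes u0: "u0 \<in> P" and \<kappa>: "\<kappa> \<ge> 1" and finite_Msg: "finite Msg"
    and fA_in: "a \<in> inputs L \<Longrightarrow> fA h a \<in> Msg" and fB_in: "a \<in> inputs L \<Longrightarrow> fB h a \<in> Msg"
begin

abbreviation "\<Omega> \<equiv> inputs L"

text \<open>The newest round stands at the head, so that the length of the tail is the number of the
  level revealed by it.\<close>

primrec hist where
  "hist 0 a b = []"
| "hist (Suc j) a b = ((fA (hist j a b) a, a j), (fB (hist j a b) b, b j)) # hist j a b"

primrec SA where
  "SA [] = \<Omega>"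
| "SA (e # h) = {a \<in> SA h. (fA h a, a (length h)) = fst e}"

primrec SB where
  "SB [] = \<Omega>"
| "SB (e # h) = {b \<in> SB h. (fB h b, b (length h)) = snd e}"

primrec pt where
  "pt [] = u0"
| "pt (e # h) = g (snd (fst e) (pt h)) (snd (snd e) (pt h))"

text \<open>Separates the messages of a history, which are few, from the revealed levels, which are
  many but can be read off the inputs. This permits union bounds over messages alone.\<close>

primrec with_levels where
  "with_levels [] a b = []"
| "with_levels (m # \<tau>) a b = ((fst m, a (length \<tau>)), (snd m, b (length \<tau>))) # with_levels \<tau> a b"

lemma finite_pairs: "finite {(a, b) \<in> \<Omega> \<times> \<Omega>. Q a b}"
  by (rule finite_subset[of _ "\<Omega> \<times> \<Omega>"]) (auto simp: finite_inputs)

lemma SA_subset: "SA h \<subseteq> \<Omega>" and SB_subset: "SB h \<subseteq> \<Omega>"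
  by (induction h; simp add: subset_iff)+

lemma finite_SA: "finite (SA h)" and finite_SB: "finite (SB h)"
  by (rule finite_subset[OF SA_subset finite_inputs], rule finite_subset[OF SB_subset finite_inputs])

lemma SA_in_X: "a \<in> SA h \<Longrightarrow> j < L \<Longrightarrow> v \<in> P \<Longrightarrow> a j v \<in> X"
  and SB_in_X: "b \<in> SB h \<Longrightarrow> j < L \<Longrightarrow> v \<in> P \<Longrightarrow> b j v \<in> X"
  by (rule inputs_in[OF subsetD[OF SA_subset]] inputs_in[OF subsetD[OF SB_subset]]; assumption)+

lemma length_hist: "length (hist j a b) = j"
  by (induction j) auto

text \<open>Given the earlier rounds, each half of a new entry is computed from one input only; this
  is why the inputs compatible with a history form a rectangle.\<close>

lemma hist_eq_iff:
  assumes "a \<in> \<Omega>" "b \<in> \<Omega>"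
  shows "hist j a b = h \<longleftrightarrow> length h = j \<and> a \<in> SA h \<and> b \<in> SB h"
proof (induction h arbitrary: j)
  case Nil
  then show ?case using assms by (cases j) auto
next
  case (Cons e h)
  show ?case
  proof (cases j)
    case (Suc i)
    have "hist j a b = e # h \<longleftrightarrow> fst e = (fA h a, a i) \<and> snd e = (fB h b, b i) \<and> hist i a b = h"
      unfolding Suc hist.simps list.inject prod_eq_iff fst_conv snd_conv
      by (cases "hist i a b = h") (simp_all add: eq_commute conj_ac)
    also have "\<dots> \<longleftrightarrow> length (e # h) = j \<and> a \<in> SA (e # h) \<and> b \<in> SB (e # h)"
      unfolding Cons[of i] Suc SA.simps SB.simps by auto
    finally show ?thesis .
  qed simp
qed

lemma pt_in:
  assumes "a \<in> \<Omega>" "b \<in> \<Omega>" "j \<le> L"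
  shows "pt (hist j a b) \<in> P"
  using \<open>j \<le> L\<close> by (induction j) (use assms u0 g_in inputs_in in \<open>auto simp: Suc_le_eq\<close>)

lemma pt_rectangle:
  assumes "SA h \<times> SB h \<noteq> {}" "length h \<le> L"
  shows "pt h \<in> P"
proof -
  obtain a b where ab: "a \<in> SA h" "b \<in> SB h" using assms by auto
  then have \<Omega>: "a \<in> \<Omega>" "b \<in> \<Omega>" using SA_subset SB_subset by blast+
  from \<Omega> ab have "hist (length h) a b = h" by (simp add: hist_eq_iff)
  with pt_in[OF \<Omega> assms(2)] show ?thesis by simp
qed

text \<open>The rectangles of the histories of length \<open>j\<close> partition all pairs of
  inputs, so estimates on single rectangles add up.\<close>

lemma card_hist_le:
  assumes "\<And>h. length h = j \<Longrightarrow> SA h \<times> SB h \<noteq> {} \<Longrightarrow>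
    real (card {(a, b) \<in> SA h \<times> SB h. Q h a b}) \<le> (\<Sum>(a, b)\<in>SA h \<times> SB h. R h a b)"
  shows "real (card {(a, b) \<in> \<Omega> \<times> \<Omega>. Q (hist j a b) a b})
    \<le> (\<Sum>(a, b)\<in>\<Omega> \<times> \<Omega>. R (hist j a b) a b)"
proof -
  define f where "f = (\<lambda>(a, b). hist j a b)"
  have fin: "finite (\<Omega> \<times> \<Omega>)" using finite_inputs by simp
  have fibre: "{z \<in> \<Omega> \<times> \<Omega>. f z = h} = SA h \<times> SB h" "length h = j" "SA h \<times> SB h \<noteq> {}"
    if h: "h \<in> f ` (\<Omega> \<times> \<Omega>)" for h
  proof -
    show len: "length h = j" using h by (auto simp: f_def length_hist)
    show eq: "{z \<in> \<Omega> \<times> \<Omega>. f z = h} = SA h \<times> SB h"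
    proof (rule set_eqI)
      fix z show "z \<in> {z \<in> \<Omega> \<times> \<Omega>. f z = h} \<longleftrightarrow> z \<in> SA h \<times> SB h"
        using hist_eq_iff[of "fst z" "snd z" j h] SA_subset[of h] SB_subset[of h] len
        by (cases z) (auto simp: f_def)
    qed
    show "SA h \<times> SB h \<noteq> {}" using h unfolding eq[symmetric] by auto
  qed
  have "real (card {(a, b) \<in> \<Omega> \<times> \<Omega>. Q (hist j a b) a b})
      = (\<Sum>z\<in>\<Omega> \<times> \<Omega>. of_bool (Q (f z) (fst z) (snd z)))"
    by (simp only: card_pairs_sum[OF fin] f_def case_prod_beta)
  also have "\<dots> = (\<Sum>h\<in>f ` (\<Omega> \<times> \<Omega>). \<Sum>z\<in>{z \<in> \<Omega> \<times> \<Omega>. f z = h}. of_bool (Q (f z) (fst z) (snd z)))"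
    by (rule sum.image_gen[OF fin])
  also have "\<dots> = (\<Sum>h\<in>f ` (\<Omega> \<times> \<Omega>). real (card {(a, b) \<in> SA h \<times> SB h. Q h a b}))"
  proof (intro sum.cong refl)
    fix h assume h: "h \<in> f ` (\<Omega> \<times> \<Omega>)"
    have "(\<Sum>z\<in>{z \<in> \<Omega> \<times> \<Omega>. f z = h}. of_bool (Q (f z) (fst z) (snd z)))
        = (\<Sum>z\<in>{z \<in> \<Omega> \<times> \<Omega>. f z = h}. of_bool (Q h (fst z) (snd z)))"
      by (intro sum.cong) auto
    also have "\<dots> = (\<Sum>z\<in>SA h \<times> SB h. of_bool (Q h (fst z) (snd z)))"
      unfolding fibre(1)[OF h] ..
    also have "\<dots> = real (card {(a, b) \<in> SA h \<times> SB h. Q h a b})"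
      by (rule card_pairs_sum[symmetric]) (simp add: finite_SA finite_SB)
    finally show "(\<Sum>z\<in>{z \<in> \<Omega> \<times> \<Omega>. f z = h}. of_bool (Q (f z) (fst z) (snd z)))
        = real (card {(a, b) \<in> SA h \<times> SB h. Q h a b})" .
  qed
  also have "\<dots> \<le> (\<Sum>h\<in>f ` (\<Omega> \<times> \<Omega>). \<Sum>(a, b)\<in>SA h \<times> SB h. R h a b)"
    by (intro sum_mono assms fibre)
  also have "\<dots> = (\<Sum>h\<in>f ` (\<Omega> \<times> \<Omega>). \<Sum>z\<in>{z \<in> \<Omega> \<times> \<Omega>. f z = h}. R (f z) (fst z) (snd z))"
  proof (rule sum.cong[OF refl])
    fix h assume h: "h \<in> f ` (\<Omega> \<times> \<Omega>)"
    have "(\<Sum>(a, b)\<in>SA h \<times> SB h. R h a b) = (\<Sum>z\<in>{z \<in> \<Omega> \<times> \<Omega>. f z = h}. R h (fst z) (snd z))"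
      unfolding fibre(1)[OF h] by (simp add: case_prod_beta)
    then show "(\<Sum>(a, b)\<in>SA h \<times> SB h. R h a b)
        = (\<Sum>z\<in>{z \<in> \<Omega> \<times> \<Omega>. f z = h}. R (f z) (fst z) (snd z))" by simp
  qed
  also have "\<dots> = (\<Sum>z\<in>\<Omega> \<times> \<Omega>. R (f z) (fst z) (snd z))"
    by (rule sum.image_gen[OF fin, symmetric])
  finally show ?thesis by (simp add: f_def case_prod_beta)
qed

definition HA where "HA h v = heavy \<kappa> (SA h) (\<lambda>a. a (length h) v)"
definition HB where "HB h v = heavy \<kappa> (SB h) (\<lambda>b. b (length h) v)"

lemma step_A:
  assumes j: "j < L"
  shows "real (card {(a, b) \<in> \<Omega> \<times> \<Omega>. a j (pt (hist j a b)) \<notin> HA (hist j a b) (pt (hist j a b))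
      \<and> b j (pt (hist j a b)) \<notin> HB (hist j a b) (pt (hist j a b))
      \<and> q (hist j a b) a (pt (hist (Suc j) a b))})
    \<le> (\<Sum>(a, b)\<in>\<Omega> \<times> \<Omega>. card {v \<in> P. q (hist j a b) a v} / card P + ext_error \<kappa>)"
proof -
  have "real (card {(a, b) \<in> \<Omega> \<times> \<Omega>. a j (pt (hist j a b)) \<notin> HA (hist j a b) (pt (hist j a b))
      \<and> b j (pt (hist j a b)) \<notin> HB (hist j a b) (pt (hist j a b))
      \<and> q (hist j a b) a (g (a j (pt (hist j a b))) (b j (pt (hist j a b))))})
    \<le> (\<Sum>(a, b)\<in>\<Omega> \<times> \<Omega>. card {v \<in> P. q (hist j a b) a v} / card P + ext_error \<kappa>)"
  proof (rule card_hist_le)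
    fix h :: "(('m \<times> ('r \<Rightarrow> 'x)) \<times> ('m \<times> ('r \<Rightarrow> 'x))) list"
    assume h: "length h = j" and ne: "SA h \<times> SB h \<noteq> {}"
    have pt: "pt h \<in> P"
      by (rule pt_rectangle[OF ne]) (use h j in simp)
    show "real (card {(a, b) \<in> SA h \<times> SB h. a j (pt h) \<notin> HA h (pt h) \<and> b j (pt h) \<notin> HB h (pt h)
        \<and> q h a (g (a j (pt h)) (b j (pt h)))})
      \<le> (\<Sum>(a, b)\<in>SA h \<times> SB h. card {v \<in> P. q h a v} / card P + ext_error \<kappa>)"
      unfolding HA_def HB_def h
      by (rule rectangle_step)
        (use finite_SA finite_SB SA_in_X[OF _ j pt] SB_in_X[OF _ j pt] \<kappa> in auto)
  qed
  then show ?thesis by (simp add: length_hist)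
qed

lemma step_B:
  assumes j: "j < L"
  shows "real (card {(a, b) \<in> \<Omega> \<times> \<Omega>. a j (pt (hist j a b)) \<notin> HA (hist j a b) (pt (hist j a b))
      \<and> b j (pt (hist j a b)) \<notin> HB (hist j a b) (pt (hist j a b))
      \<and> q (hist j a b) b (pt (hist (Suc j) a b))})
    \<le> (\<Sum>(a, b)\<in>\<Omega> \<times> \<Omega>. card {v \<in> P. q (hist j a b) b v} / card P + ext_error \<kappa>)"
proof -
  have "real (card {(a, b) \<in> \<Omega> \<times> \<Omega>. a j (pt (hist j a b)) \<notin> HA (hist j a b) (pt (hist j a b))
      \<and> b j (pt (hist j a b)) \<notin> HB (hist j a b) (pt (hist j a b))
      \<and> q (hist j a b) b (g (b j (pt (hist j a b))) (a j (pt (hist j a b))))})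
    \<le> (\<Sum>(a, b)\<in>\<Omega> \<times> \<Omega>. card {v \<in> P. q (hist j a b) b v} / card P + ext_error \<kappa>)"
  proof (rule card_hist_le)
    fix h :: "(('m \<times> ('r \<Rightarrow> 'x)) \<times> ('m \<times> ('r \<Rightarrow> 'x))) list"
    assume h: "length h = j" and ne: "SA h \<times> SB h \<noteq> {}"
    have pt: "pt h \<in> P"
      by (rule pt_rectangle[OF ne]) (use h j in simp)
    have "real (card {(b, a) \<in> SB h \<times> SA h. b j (pt h) \<notin> HB h (pt h) \<and> a j (pt h) \<notin> HA h (pt h)
        \<and> q h b (g (b j (pt h)) (a j (pt h)))})
      \<le> (\<Sum>(b, a)\<in>SB h \<times> SA h. card {v \<in> P. q h b v} / card P + ext_error \<kappa>)"
      unfolding HA_def HB_def h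
      by (rule rectangle_step)
        (use finite_SA finite_SB SA_in_X[OF _ j pt] SB_in_X[OF _ j pt] \<kappa> in auto)
    moreover have "(\<Sum>(b, a)\<in>SB h \<times> SA h. card {v \<in> P. q h b v} / card P + ext_error \<kappa>)
      = (\<Sum>(a, b)\<in>SA h \<times> SB h. card {v \<in> P. q h b v} / card P + ext_error \<kappa>)"
      by (subst (1 2) sum.cartesian_product[symmetric], rule sum.swap)
    ultimately show "real (card {(a, b) \<in> SA h \<times> SB h. a j (pt h) \<notin> HA h (pt h) \<and> b j (pt h) \<notin> HB h (pt h)
        \<and> q h b (g (b j (pt h)) (a j (pt h)))})
      \<le> (\<Sum>(a, b)\<in>SA h \<times> SB h. card {v \<in> P. q h b v} / card P + ext_error \<kappa>)"
      by (subst card_pairs_swap) (simp only: conj_left_commute)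
  qed
  then show ?thesis by (simp add: length_hist g_commute)
qed

section \<open>Counting heavy pointers by transcripts\<close>

lemma with_levels_upd:
  assumes "length \<tau> \<le> j"
  shows "with_levels \<tau> (a(j := l)) b = with_levels \<tau> a b" "with_levels \<tau> a (b(j := l)) = with_levels \<tau> a b"
  using assms by (induction \<tau>) auto

lemma length_with_levels: "length (with_levels \<tau> a b) = length \<tau>"
  by (induction \<tau>) auto

lemma hist_with_levels:
  assumes "a \<in> \<Omega>" "b \<in> \<Omega>"
  shows "\<exists>\<tau>. set \<tau> \<subseteq> Msg \<times> Msg \<and> length \<tau> = j \<and> hist j a b = with_levels \<tau> a b"
proof (induction j)
  case (Suc j)
  then obtain \<tau> where \<tau>: "set \<tau> \<subseteq> Msg \<times> Msg" "length \<tau> = j" "hist j a b = with_levels \<tau> a b"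
    by blast
  then show ?case using assms fA_in fB_in
    by (intro exI[of _ "(fA (hist j a b) a, fB (hist j a b) b) # \<tau>"]) auto
qed simp

lemma card_HA: "j < L \<Longrightarrow> length h = j \<Longrightarrow> v \<in> P \<Longrightarrow> card (HA h v) * \<kappa> \<le> card X"
  and card_HB: "j < L \<Longrightarrow> length h = j \<Longrightarrow> v \<in> P \<Longrightarrow> card (HB h v) * \<kappa> \<le> card X"
  unfolding HA_def HB_def using finite_SA finite_SB SA_in_X SB_in_X \<kappa>
  by (auto intro!: card_heavy)

lemma HA_subset: "HA h v \<subseteq> X" and HB_subset: "HB h v \<subseteq> X"
  unfolding HA_def HB_def by (rule heavy_subset)+

definition transcripts :: "nat \<Rightarrow> ('m \<times> 'm) list set" where
  "transcripts j = {\<tau>. set \<tau> \<subseteq> Msg \<times> Msg \<and> length \<tau> = j}"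

lemma finite_transcripts: "finite (transcripts j)"
  and card_transcripts: "card (transcripts j) = card Msg ^ (2 * j)"
  unfolding transcripts_def using finite_Msg
  by (auto intro: finite_lists_length_eq
      simp: card_lists_length_eq card_cartesian_product power_mult power2_eq_square)

text \<open>The heavy sets depend on messages, and these depend in turn on level \<open>j\<close>
  itself. Once the transcript \<open>\<tau>\<close> is frozen, the heavy sets are determined by the
  levels below \<open>j\<close>, hence independent of level \<open>j\<close>, and
  \<open>card_rows_hitting\<close> applies. The union bound over all transcripts then returns to the
  actual history.\<close>

lemma many_heavy_A:
  assumes j: "j < L"
  shows "card {(a, b) \<in> \<Omega> \<times> \<Omega>. r \<le> card {v \<in> P. a j v \<in> HA (hist j a b) v}} * \<kappa> ^ r
    \<le> card Msg ^ (2 * j) * 2 ^ card P * real (card (\<Omega> \<times> \<Omega>))"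
proof -
  let ?M = "\<lambda>\<tau>. {(a, b) \<in> \<Omega> \<times> \<Omega>. r \<le> card {v \<in> P. a j v \<in> HA (with_levels \<tau> a b) v}}"
  have "{(a, b) \<in> \<Omega> \<times> \<Omega>. r \<le> card {v \<in> P. a j v \<in> HA (hist j a b) v}} \<subseteq> (\<Union>\<tau>\<in>transcripts j. ?M \<tau>)"
    using hist_with_levels unfolding transcripts_def by auto metis
  then have "card {(a, b) \<in> \<Omega> \<times> \<Omega>. r \<le> card {v \<in> P. a j v \<in> HA (hist j a b) v}}
      \<le> card (\<Union>\<tau>\<in>transcripts j. ?M \<tau>)"
    by (rule card_mono[rotated]) (intro finite_UN_I finite_transcripts finite_pairs)
  also have "\<dots> \<le> (\<Sum>\<tau>\<in>transcripts j. card (?M \<tau>))" by (rule card_UN_le[OF finite_transcripts])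
  finally have "card {(a, b) \<in> \<Omega> \<times> \<Omega>. r \<le> card {v \<in> P. a j v \<in> HA (hist j a b) v}} * \<kappa> ^ r
      \<le> (\<Sum>\<tau>\<in>transcripts j. card (?M \<tau>)) * \<kappa> ^ r"
    using \<kappa> by (intro mult_right_mono of_nat_mono) auto
  also have "\<dots> = (\<Sum>\<tau>\<in>transcripts j. card (?M \<tau>) * \<kappa> ^ r)" by (simp add: sum_distrib_right)
  also have "\<dots> \<le> (\<Sum>\<tau>\<in>transcripts j. 2 ^ card P * real (card \<Omega>) * card \<Omega>)"
  proof (intro sum_mono)
    fix \<tau> assume "\<tau> \<in> transcripts j"
    then have \<tau>: "length \<tau> = j" by (simp add: transcripts_def)
    show "card (?M \<tau>) * \<kappa> ^ r \<le> 2 ^ card P * real (card \<Omega>) * card \<Omega>"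
    proof (rule card_pairs_le_snd[OF finite_inputs finite_inputs])
      fix b
      show "card {a \<in> \<Omega>. r \<le> card {v \<in> P. a j v \<in> HA (with_levels \<tau> a b) v}} * \<kappa> ^ r
        \<le> 2 ^ card P * real (card \<Omega>)"
        by (rule card_inputs_split[OF j])
          (use \<tau> HA_subset card_HA[OF j] \<kappa> in
            \<open>auto simp: with_levels_upd length_with_levels intro!: card_rows_hitting\<close>)
    qed
  qed
  also have "\<dots> = card Msg ^ (2 * j) * 2 ^ card P * real (card (\<Omega> \<times> \<Omega>))"
    by (simp add: card_transcripts card_cartesian_product)
  finally show ?thesis .
qed

lemma many_heavy_B:
  assumes j: "j < L"
  shows "card {(a, b) \<in> \<Omega> \<times> \<Omega>. r \<le> card {v \<in> P. b j v \<in> HB (hist j a b) v}} * \<kappa> ^ r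
    \<le> card Msg ^ (2 * j) * 2 ^ card P * real (card (\<Omega> \<times> \<Omega>))"
proof -
  let ?M = "\<lambda>\<tau>. {(a, b) \<in> \<Omega> \<times> \<Omega>. r \<le> card {v \<in> P. b j v \<in> HB (with_levels \<tau> a b) v}}"
  have "{(a, b) \<in> \<Omega> \<times> \<Omega>. r \<le> card {v \<in> P. b j v \<in> HB (hist j a b) v}} \<subseteq> (\<Union>\<tau>\<in>transcripts j. ?M \<tau>)"
    using hist_with_levels unfolding transcripts_def by auto metis
  then have "card {(a, b) \<in> \<Omega> \<times> \<Omega>. r \<le> card {v \<in> P. b j v \<in> HB (hist j a b) v}}
      \<le> card (\<Union>\<tau>\<in>transcripts j. ?M \<tau>)"
    by (rule card_mono[rotated]) (intro finite_UN_I finite_transcripts finite_pairs)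
  also have "\<dots> \<le> (\<Sum>\<tau>\<in>transcripts j. card (?M \<tau>))" by (rule card_UN_le[OF finite_transcripts])
  finally have "card {(a, b) \<in> \<Omega> \<times> \<Omega>. r \<le> card {v \<in> P. b j v \<in> HB (hist j a b) v}} * \<kappa> ^ r
      \<le> (\<Sum>\<tau>\<in>transcripts j. card (?M \<tau>)) * \<kappa> ^ r"
    using \<kappa> by (intro mult_right_mono of_nat_mono) auto
  also have "\<dots> = (\<Sum>\<tau>\<in>transcripts j. card (?M \<tau>) * \<kappa> ^ r)" by (simp add: sum_distrib_right)
  also have "\<dots> \<le> (\<Sum>\<tau>\<in>transcripts j. 2 ^ card P * real (card \<Omega>) * card \<Omega>)"
  proof (intro sum_mono)
    fix \<tau> assume "\<tau> \<in> transcripts j"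
    then have \<tau>: "length \<tau> = j" by (simp add: transcripts_def)
    have "card {(b, a) \<in> \<Omega> \<times> \<Omega>. r \<le> card {v \<in> P. b j v \<in> HB (with_levels \<tau> a b) v}} * \<kappa> ^ r
        \<le> 2 ^ card P * real (card \<Omega>) * card \<Omega>"
    proof (rule card_pairs_le_snd[OF finite_inputs finite_inputs])
      fix a
      show "card {b \<in> \<Omega>. r \<le> card {v \<in> P. b j v \<in> HB (with_levels \<tau> a b) v}} * \<kappa> ^ r
        \<le> 2 ^ card P * real (card \<Omega>)"
        by (rule card_inputs_split[OF j])
          (use \<tau> HB_subset card_HB[OF j] \<kappa> in
            \<open>auto simp: with_levels_upd length_with_levels intro!: card_rows_hitting\<close>)
    qed
    then show "card (?M \<tau>) * \<kappa> ^ r \<le> 2 ^ card P * real (card \<Omega>) * card \<Omega>"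
      by (subst card_pairs_swap)
  qed
  also have "\<dots> = card Msg ^ (2 * j) * 2 ^ card P * real (card (\<Omega> \<times> \<Omega>))"
    by (simp add: card_transcripts card_cartesian_product)
  finally show ?thesis .
qed

text \<open>Up to \<open>r\<close> heavy pointers account for the first term; having more is so rare
  that the trivial bound one on the fraction suffices. The threshold \<open>r\<close> is left open
  until the parameters are balanced.\<close>

lemma sum_heavy_A:
  assumes j: "j < L"
  shows "(\<Sum>(a, b)\<in>\<Omega> \<times> \<Omega>. card {v \<in> P. a j v \<in> HA (hist j a b) v} / card P)
    \<le> (r / card P + card Msg ^ (2 * j) * 2 ^ card P / \<kappa> ^ r) * real (card (\<Omega> \<times> \<Omega>))"
proof -
  let ?c = "\<lambda>a b. card {v \<in> P. a j v \<in> HA (hist j a b) v}"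
  have fin: "finite (\<Omega> \<times> \<Omega>)" using finite_inputs by simp
  have "(\<Sum>(a, b)\<in>\<Omega> \<times> \<Omega>. ?c a b / card P)
      \<le> (\<Sum>z\<in>\<Omega> \<times> \<Omega>. r / card P + of_bool (r \<le> ?c (fst z) (snd z)))"
    unfolding case_prod_beta
  proof (intro sum_mono)
    fix z
    have "?c (fst z) (snd z) \<le> card P" using finite_P by (intro card_mono) auto
    then show "?c (fst z) (snd z) / card P \<le> r / card P + of_bool (r \<le> ?c (fst z) (snd z))"
      using card_P_pos by (auto simp: field_simps)
  qed
  also have "\<dots> = r / card P * card (\<Omega> \<times> \<Omega>) + card {(a, b) \<in> \<Omega> \<times> \<Omega>. r \<le> ?c a b}"
    unfolding card_pairs_sum[OF fin] by (simp add: sum.distrib)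
  also have "real (card {(a, b) \<in> \<Omega> \<times> \<Omega>. r \<le> ?c a b})
      \<le> card Msg ^ (2 * j) * 2 ^ card P / \<kappa> ^ r * real (card (\<Omega> \<times> \<Omega>))"
    using many_heavy_A[OF j, of r] \<kappa> by (simp add: pos_le_divide_eq field_simps)
  finally show ?thesis by (simp add: distrib_right)
qed

lemma sum_heavy_B:
  assumes j: "j < L"
  shows "(\<Sum>(a, b)\<in>\<Omega> \<times> \<Omega>. card {v \<in> P. b j v \<in> HB (hist j a b) v} / card P)
    \<le> (r / card P + card Msg ^ (2 * j) * 2 ^ card P / \<kappa> ^ r) * real (card (\<Omega> \<times> \<Omega>))"
proof -
  let ?c = "\<lambda>a b. card {v \<in> P. b j v \<in> HB (hist j a b) v}"
  have fin: "finite (\<Omega> \<times> \<Omega>)" using finite_inputs by simp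
  have "(\<Sum>(a, b)\<in>\<Omega> \<times> \<Omega>. ?c a b / card P)
      \<le> (\<Sum>z\<in>\<Omega> \<times> \<Omega>. r / card P + of_bool (r \<le> ?c (fst z) (snd z)))"
    unfolding case_prod_beta
  proof (intro sum_mono)
    fix z
    have "?c (fst z) (snd z) \<le> card P" using finite_P by (intro card_mono) auto
    then show "?c (fst z) (snd z) / card P \<le> r / card P + of_bool (r \<le> ?c (fst z) (snd z))"
      using card_P_pos by (auto simp: field_simps)
  qed
  also have "\<dots> = r / card P * card (\<Omega> \<times> \<Omega>) + card {(a, b) \<in> \<Omega> \<times> \<Omega>. r \<le> ?c a b}"
    unfolding card_pairs_sum[OF fin] by (simp add: sum.distrib)
  also have "real (card {(a, b) \<in> \<Omega> \<times> \<Omega>. r \<le> ?c a b})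
      \<le> card Msg ^ (2 * j) * 2 ^ card P / \<kappa> ^ r * real (card (\<Omega> \<times> \<Omega>))"
    using many_heavy_B[OF j, of r] \<kappa> by (simp add: pos_le_divide_eq field_simps)
  finally show ?thesis by (simp add: distrib_right)
qed

section \<open>Accumulation of errors along the chase\<close>

definition bad where
  "bad j = {(a, b) \<in> \<Omega> \<times> \<Omega>. a j (pt (hist j a b)) \<in> HA (hist j a b) (pt (hist j a b))
    \<or> b j (pt (hist j a b)) \<in> HB (hist j a b) (pt (hist j a b))}"

lemma finite_bad: "finite (bad j)"
  unfolding bad_def by (rule finite_pairs)

lemma card_rows_at: "card {l \<in> rows. l u0 = x} * real (card X) \<le> 1 * real (card rows)"
proof -
  have "{l \<in> rows. l u0 = x} \<subseteq> PiE P (\<lambda>v. if v = u0 then {x} else X)"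
    by (auto simp: PiE_def Pi_def)
  then have "card {l \<in> rows. l u0 = x} \<le> card (PiE P (\<lambda>v. if v = u0 then {x} else X))"
    by (rule card_mono[rotated]) (auto intro!: finite_PiE finite_P simp: finite_X)
  also have "\<dots> = (\<Prod>v\<in>P. if v = u0 then 1 else card X)"
    by (simp add: card_PiE[OF finite_P] if_distrib cong: if_cong)
  also have "\<dots> = card X ^ (card P - 1)"
    using u0 finite_P by (subst prod.remove[OF finite_P u0]) (simp add: prod.If_cases Int_def card_Diff_singleton)
  finally have "card {l \<in> rows. l u0 = x} * card X \<le> card X ^ (card P - 1) * card X" by simp
  also have "\<dots> = card rows"
    using card_P_pos by (simp add: card_PiE[OF finite_P] flip: power_Suc2)
  finally show ?thesis by (simp flip: of_nat_mult)
qed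

text \<open>Before the first message the row at \<open>u0\<close> is exactly uniform, so with
  \<open>\<kappa> \<ge> 1\<close> none of its values is heavy.\<close>

lemma bad_0:
  assumes "L > 0"
  shows "bad 0 = {}"
proof -
  have "heavy \<kappa> \<Omega> (\<lambda>a. a 0 u0) = {}"
  proof -
    have "card {a \<in> \<Omega>. a 0 u0 = x} * real (card X) \<le> \<kappa> * card \<Omega>" for x
    proof -
      have "card {a \<in> \<Omega>. a 0 u0 = x} * real (card X) \<le> 1 * real (card \<Omega>)"
        by (rule card_inputs_split[OF assms]) (use card_rows_at in auto)
      also have "\<dots> \<le> \<kappa> * card \<Omega>" using \<kappa> by (intro mult_right_mono) auto
      finally show ?thesis .
    qed
    then show ?thesis by (auto simp: heavy_def not_less)
  qed
  then show ?thesis by (simp add: bad_def HA_def HB_def)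
qed

lemma bad_Suc:
  assumes j: "Suc j < L"
  shows "real (card (bad (Suc j))) \<le> real (card (bad j))
    + 2 * (r / card P + card Msg ^ (2 * L) * 2 ^ card P / \<kappa> ^ r + ext_error \<kappa>) * real (card (\<Omega> \<times> \<Omega>))"
proof -
  define lightA where "lightA a b \<longleftrightarrow> a j (pt (hist j a b)) \<notin> HA (hist j a b) (pt (hist j a b))" for a b
  define lightB where "lightB a b \<longleftrightarrow> b j (pt (hist j a b)) \<notin> HB (hist j a b) (pt (hist j a b))" for a b
  \<comment> \<open>Heaviness in the next round, with Alice's new history entry recomputed from
    \<open>a\<close>. Bob's new entry has no influence on \<open>SA\<close>, so this is a test of
    the old history, \<open>a\<close> and the next pointer, as \<open>step_A\<close>
    demands.\<close>
  define qA where "qA h a v \<longleftrightarrow> a (Suc (length h)) v \<in> heavy \<kappa>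
    {a' \<in> SA h. (fA h a', a' (length h)) = (fA h a, a (length h))} (\<lambda>a'. a' (Suc (length h)) v)" for h a v
  define qB where "qB h b v \<longleftrightarrow> b (Suc (length h)) v \<in> heavy \<kappa>
    {b' \<in> SB h. (fB h b', b' (length h)) = (fB h b, b (length h))} (\<lambda>b'. b' (Suc (length h)) v)" for h b v
  have qA: "qA (hist j a b) a v \<longleftrightarrow> a (Suc j) v \<in> HA (hist (Suc j) a b) v"
    and qB: "qB (hist j a b) b v \<longleftrightarrow> b (Suc j) v \<in> HB (hist (Suc j) a b) v" for a b v
    by (simp_all add: qA_def qB_def HA_def HB_def length_hist)
  let ?A = "{(a, b) \<in> \<Omega> \<times> \<Omega>. lightA a b \<and> lightB a b \<and> qA (hist j a b) a (pt (hist (Suc j) a b))}"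
  let ?B = "{(a, b) \<in> \<Omega> \<times> \<Omega>. lightA a b \<and> lightB a b \<and> qB (hist j a b) b (pt (hist (Suc j) a b))}"
  define E where "E = r / card P + card Msg ^ (2 * L) * 2 ^ card P / \<kappa> ^ r"
  have E: "r / card P + card Msg ^ (2 * Suc j) * 2 ^ card P / \<kappa> ^ r \<le> E"
  proof -
    have "card Msg \<ge> 1"
      using fA_in inputs_nonempty finite_Msg by (metis One_nat_def Suc_leI all_not_in_conv card_gt_0_iff)
    then have "card Msg ^ (2 * Suc j) \<le> card Msg ^ (2 * L)"
      using j by (intro power_increasing) auto
    then have "card Msg ^ (2 * Suc j) * 2 ^ card P \<le> card Msg ^ (2 * L) * 2 ^ card P" by simp
    then have "real (card Msg ^ (2 * Suc j) * 2 ^ card P) / \<kappa> ^ r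
        \<le> real (card Msg ^ (2 * L) * 2 ^ card P) / \<kappa> ^ r"
      using \<kappa> by (intro divide_right_mono of_nat_mono) auto
    then show ?thesis by (simp add: E_def)
  qed
  have "bad (Suc j) \<subseteq> bad j \<union> (?A \<union> ?B)"
    unfolding bad_def qA qB by (auto simp: lightA_def lightB_def simp del: hist.simps)
  then have "card (bad (Suc j)) \<le> card (bad j \<union> (?A \<union> ?B))"
    by (rule card_mono[rotated]) (intro finite_UnI finite_bad finite_pairs)
  also have "\<dots> \<le> card (bad j) + (card ?A + card ?B)"
    by (rule order_trans[OF card_Un_le add_left_mono[OF card_Un_le]])
  finally have "real (card (bad (Suc j))) \<le> card (bad j) + (real (card ?A) + real (card ?B))" by simp
  moreover have "real (card ?A) \<le> (E + ext_error \<kappa>) * card (\<Omega> \<times> \<Omega>)"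
  proof -
    have "real (card ?A)
        \<le> (\<Sum>(a, b)\<in>\<Omega> \<times> \<Omega>. card {v \<in> P. qA (hist j a b) a v} / card P + ext_error \<kappa>)"
      unfolding lightA_def lightB_def using j by (intro step_A) simp
    also have "\<dots> = (\<Sum>(a, b)\<in>\<Omega> \<times> \<Omega>. card {v \<in> P. qA (hist j a b) a v} / card P)
        + ext_error \<kappa> * card (\<Omega> \<times> \<Omega>)"
      by (simp add: case_prod_beta sum.distrib)
    also have "(\<Sum>(a, b)\<in>\<Omega> \<times> \<Omega>. card {v \<in> P. qA (hist j a b) a v} / card P)
        \<le> (r / card P + card Msg ^ (2 * Suc j) * 2 ^ card P / \<kappa> ^ r) * real (card (\<Omega> \<times> \<Omega>))"
      unfolding qA by (rule sum_heavy_A[OF j])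
    also have "\<dots> \<le> E * real (card (\<Omega> \<times> \<Omega>))" by (intro mult_right_mono E) simp
    finally show ?thesis by (simp add: distrib_right)
  qed
  moreover have "real (card ?B) \<le> (E + ext_error \<kappa>) * card (\<Omega> \<times> \<Omega>)"
  proof -
    have "real (card ?B)
        \<le> (\<Sum>(a, b)\<in>\<Omega> \<times> \<Omega>. card {v \<in> P. qB (hist j a b) b v} / card P + ext_error \<kappa>)"
      unfolding lightA_def lightB_def using j by (intro step_B) simp
    also have "\<dots> = (\<Sum>(a, b)\<in>\<Omega> \<times> \<Omega>. card {v \<in> P. qB (hist j a b) b v} / card P)
        + ext_error \<kappa> * card (\<Omega> \<times> \<Omega>)"
      by (simp add: case_prod_beta sum.distrib)
    also have "(\<Sum>(a, b)\<in>\<Omega> \<times> \<Omega>. card {v \<in> P. qB (hist j a b) b v} / card P)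
        \<le> (r / card P + card Msg ^ (2 * Suc j) * 2 ^ card P / \<kappa> ^ r) * real (card (\<Omega> \<times> \<Omega>))"
      unfolding qB by (rule sum_heavy_B[OF j])
    also have "\<dots> \<le> E * real (card (\<Omega> \<times> \<Omega>))" by (intro mult_right_mono E) simp
    finally show ?thesis by (simp add: distrib_right)
  qed
  ultimately show ?thesis by (simp add: E_def algebra_simps)
qed

lemma card_bad:
  assumes "j < L"
  shows "real (card (bad j)) \<le>
    j * (2 * (r / card P + card Msg ^ (2 * L) * 2 ^ card P / \<kappa> ^ r + ext_error \<kappa>) * real (card (\<Omega> \<times> \<Omega>)))"
  using assms
proof (induction j)
  case (Suc j)
  let ?c = "2 * (r / card P + card Msg ^ (2 * L) * 2 ^ card P / \<kappa> ^ r + ext_error \<kappa>)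
    * real (card (\<Omega> \<times> \<Omega>))"
  have "real (card (bad j)) \<le> j * ?c" using Suc by simp
  then show ?case
    using bad_Suc[OF Suc.prems, of r] unfolding of_nat_Suc distrib_right mult_1 by linarith
qed (simp add: bad_0)

text \<open>Naming the last pointer is one more test of the same kind as heaviness, and at most one
  pointer passes it; hence the terms \<open>1 / card P\<close>, one for each player.\<close>

theorem success_bound:
  assumes L: "L = Suc j"
  shows "real (card {(a, b) \<in> \<Omega> \<times> \<Omega>. OA (hist j a b) a = Some (pt (hist L a b))
      \<or> OB (hist j a b) b = Some (pt (hist L a b))})
    \<le> (2 * j * (r / card P + card Msg ^ (2 * L) * 2 ^ card P / \<kappa> ^ r + ext_error \<kappa>)
      + 2 * (1 / card P + ext_error \<kappa>)) * real (card (\<Omega> \<times> \<Omega>))"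
proof -
  define lightA where "lightA a b \<longleftrightarrow> a j (pt (hist j a b)) \<notin> HA (hist j a b) (pt (hist j a b))" for a b
  define lightB where "lightB a b \<longleftrightarrow> b j (pt (hist j a b)) \<notin> HB (hist j a b) (pt (hist j a b))" for a b
  let ?S = "{(a, b) \<in> \<Omega> \<times> \<Omega>. OA (hist j a b) a = Some (pt (hist L a b))
      \<or> OB (hist j a b) b = Some (pt (hist L a b))}"
  let ?A = "{(a, b) \<in> \<Omega> \<times> \<Omega>. lightA a b \<and> lightB a b \<and> OA (hist j a b) a = Some (pt (hist L a b))}"
  let ?B = "{(a, b) \<in> \<Omega> \<times> \<Omega>. lightA a b \<and> lightB a b \<and> OB (hist j a b) b = Some (pt (hist L a b))}"
  have "?S \<subseteq> bad j \<union> (?A \<union> ?B)"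
    unfolding bad_def by (auto simp: lightA_def lightB_def simp del: hist.simps)
  then have "card ?S \<le> card (bad j \<union> (?A \<union> ?B))"
    by (rule card_mono[rotated]) (intro finite_UnI finite_bad finite_pairs)
  also have "\<dots> \<le> card (bad j) + (card ?A + card ?B)"
    by (rule order_trans[OF card_Un_le add_left_mono[OF card_Un_le]])
  finally have "real (card ?S) \<le> card (bad j) + (real (card ?A) + real (card ?B))" by simp
  moreover have le1: "card {v \<in> P. o' = Some v} \<le> 1" for o'
    by (rule order_trans[OF card_mono[of "{the o'}"]]) auto
  have avg: "(\<Sum>(a, b)\<in>\<Omega> \<times> \<Omega>. card {v \<in> P. f a b = Some v} / card P + ext_error \<kappa>)
      \<le> (1 / card P + ext_error \<kappa>) * card (\<Omega> \<times> \<Omega>)" for f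
  proof -
    have "(\<Sum>(a, b)\<in>\<Omega> \<times> \<Omega>. card {v \<in> P. f a b = Some v} / card P + ext_error \<kappa>)
        \<le> (\<Sum>(a, b)\<in>\<Omega> \<times> \<Omega>. 1 / card P + ext_error \<kappa>)"
      unfolding case_prod_beta using le1 by (intro sum_mono add_right_mono divide_right_mono) auto
    then show ?thesis by (simp add: case_prod_beta mult.commute)
  qed
  moreover have "real (card ?A) \<le> (1 / card P + ext_error \<kappa>) * card (\<Omega> \<times> \<Omega>)"
    unfolding lightA_def lightB_def
    by (rule order_trans[OF step_A[of j "\<lambda>h x v. OA h x = Some v", folded L] avg]) (simp add: L)
  moreover have "real (card ?B) \<le> (1 / card P + ext_error \<kappa>) * card (\<Omega> \<times> \<Omega>)"
    unfolding lightA_def lightB_def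
    by (rule order_trans[OF step_B[of j "\<lambda>h x v. OB h x = Some v", folded L] avg]) (simp add: L)
  ultimately show ?thesis using card_bad[of j r] by (simp add: L algebra_simps)
qed

end

section \<open>The gadget: syndromes of a code\<close>

lemma sum_Pow_prod:
  fixes w :: "'a \<Rightarrow> int"
  assumes "finite A"
  shows "(\<Sum>x\<in>Pow A. \<Prod>z\<in>x. w z) = (\<Prod>z\<in>A. 1 + w z)"
  using prod_add[OF assms, of w "\<lambda>_. 1"] by (simp add: add.commute)

lemma prod_minus_one: "(\<Prod>z\<in>A. if Q z then - 1 else 1) = (- 1 :: int) ^ card {z \<in> A. Q z}"
  if "finite A"
  using that by (simp add: prod.If_cases Int_def)

lemma flip_bit_less: "flip_bit r i < 2 ^ c" if "i < 2 ^ c" "r < c" for i :: nat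
proof -
  have "take_bit c i = i" using that by (simp add: take_bit_nat_eq_self_iff)
  then have "take_bit c (flip_bit r i) = flip_bit r i"
    by (intro bit_eqI) (metis bit_flip_bit_iff bit_take_bit_iff that(2))
  then show ?thesis by (simp add: take_bit_nat_eq_self_iff)
qed

text \<open>Flipping one bit that belongs to \<open>S\<close> exchanges the odd numbers with the
  even ones. This is the constant weight of the words of the simplex code.\<close>

lemma card_odd_bits:
  assumes "S \<subseteq> {..<c}" "S \<noteq> {}"
  shows "2 * card {i. i < (2::nat) ^ c \<and> odd (card {r \<in> S. bit i r})} = 2 ^ c"
proof -
  obtain r0 where r0: "r0 \<in> S" "r0 < c" using assms by auto
  have fin: "finite S" using assms finite_subset by blast
  let ?O = "{i. i < (2::nat) ^ c \<and> odd (card {r \<in> S. bit i r})}"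
  let ?E = "{i. i < (2::nat) ^ c \<and> even (card {r \<in> S. bit i r})}"
  have flip: "odd (card {r \<in> S. bit (flip_bit r0 i) r}) \<longleftrightarrow> even (card {r \<in> S. bit i r})" for i :: nat
  proof -
    let ?R = "{r \<in> S - {r0}. bit i r}"
    have S: "finite ?R" "r0 \<notin> ?R" using fin by auto
    have 1: "{r \<in> S. bit i r} = (if bit i r0 then insert r0 ?R else ?R)" using r0 by auto
    have 2: "{r \<in> S. bit (flip_bit r0 i) r} = (if bit i r0 then ?R else insert r0 ?R)"
      using r0 by (auto simp: bit_flip_bit_iff)
    show ?thesis unfolding 1 2 using S by auto
  qed
  have inv: "flip_bit r0 (flip_bit r0 i) = i" for i :: nat
    by (rule bit_eqI) (auto simp: bit_flip_bit_iff)
  have "bij_betw (flip_bit r0) ?O ?E"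
  proof (rule bij_betwI[of _ _ _ "flip_bit r0"])
    show "flip_bit r0 \<in> ?O \<rightarrow> ?E" using flip r0 flip_bit_less by blast
    show "flip_bit r0 \<in> ?E \<rightarrow> ?O" using flip r0 flip_bit_less by blast
  qed (simp_all only: inv)
  then have "card ?O = card ?E" by (rule bij_betw_same_card)
  moreover have "{..<(2::nat) ^ c} = ?O \<union> ?E" by auto
  then have "card {..<(2::nat) ^ c} = card ?O + card ?E"
    using card_Un_disjoint[of ?O ?E] by fastforce
  ultimately show ?thesis by simp
qed

text \<open>The supports of the basis vectors of a linear code of dimension \<open>2 * c\<close>, length \<open>2 * 2 ^ c\<close>
  and minimum distance \<open>2 ^ c div 2\<close>, namely the direct sum of two simplex codes.\<close>

definition code :: "nat \<Rightarrow> nat \<Rightarrow> nat set" where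
  "code c r = (if r < c then {i. i < 2 ^ c \<and> bit i r}
    else {i. 2 ^ c \<le> i \<and> i < 2 * 2 ^ c \<and> bit (i - 2 ^ c) (r - c)})"

text \<open>A nonzero word has a nonzero component in one of the two simplex codes, and that
  component alone has weight \<open>2 ^ c div 2\<close>.\<close>

lemma code_distance:
  assumes "S \<subseteq> {..<2 * c}" "S \<noteq> {}"
  shows "2 ^ c \<le> 2 * card {i. i < 2 * 2 ^ c \<and> odd (card {r \<in> S. i \<in> code c r})}"
proof (cases "\<exists>r\<in>S. r < c")
  case True
  let ?S' = "{r \<in> S. r < c}"
  have "{r \<in> S. i \<in> code c r} = {r \<in> ?S'. bit i r}" if "i < 2 ^ c" for i
    using that by (auto simp: code_def)
  then have "{i. i < 2 ^ c \<and> odd (card {r \<in> ?S'. bit i r})}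
      \<subseteq> {i. i < 2 * 2 ^ c \<and> odd (card {r \<in> S. i \<in> code c r})}"
    by auto
  then have "card {i. i < (2::nat) ^ c \<and> odd (card {r \<in> ?S'. bit i r})}
      \<le> card {i. i < 2 * 2 ^ c \<and> odd (card {r \<in> S. i \<in> code c r})}"
    by (rule card_mono[rotated]) simp
  moreover have "?S' \<subseteq> {..<c}" "?S' \<noteq> {}" using True by auto
  ultimately show ?thesis using card_odd_bits[of ?S' c] by linarith
next
  case False
  let ?S' = "(\<lambda>r. r - c) ` S"
  have inj: "inj_on (\<lambda>r. r - c) R" if "R \<subseteq> S" for R
  proof (rule inj_onI)
    fix r r' assume "r \<in> R" "r' \<in> R" "r - c = r' - c"
    moreover from this have "c \<le> r" "c \<le> r'" using False that not_less by blast+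
    ultimately show "r = r'" by linarith
  qed
  have "card {r \<in> S. i + 2 ^ c \<in> code c r} = card {r \<in> ?S'. bit i r}" if "i < 2 ^ c" for i
  proof -
    have "{r \<in> ?S'. bit i r} = (\<lambda>r. r - c) ` {r \<in> S. i + 2 ^ c \<in> code c r}"
      using that False by (auto simp: code_def)
    then show ?thesis by (simp add: card_image inj)
  qed
  then have "(\<lambda>i. i + 2 ^ c) ` {i. i < 2 ^ c \<and> odd (card {r \<in> ?S'. bit i r})}
      \<subseteq> {i. i < 2 * 2 ^ c \<and> odd (card {r \<in> S. i \<in> code c r})}"
    by auto
  then have "card ((\<lambda>i. i + 2 ^ c) ` {i. i < (2::nat) ^ c \<and> odd (card {r \<in> ?S'. bit i r})})
      \<le> card {i. i < 2 * 2 ^ c \<and> odd (card {r \<in> S. i \<in> code c r})}"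
    by (rule card_mono[rotated]) simp
  moreover have "card ((\<lambda>i. i + 2 ^ c) ` {i. i < (2::nat) ^ c \<and> odd (card {r \<in> ?S'. bit i r})})
      = card {i. i < (2::nat) ^ c \<and> odd (card {r \<in> ?S'. bit i r})}"
    by (intro card_image) (auto simp: inj_on_def)
  moreover have "?S' \<subseteq> {..<c}" "?S' \<noteq> {}" using assms False by (auto simp: not_less)
  ultimately show ?thesis using card_odd_bits[of ?S' c] by simp
qed

text \<open>Coordinate \<open>i\<close> of the code is repeated once for each second component. With
  \<open>K = (2 ^ c)\<^sup>2\<close> pointers, this scales the length to \<open>2 * K\<close> and
  the distance to about \<open>K / 2\<close> while keeping the dimension
  \<open>2 * c\<close>.\<close>

definition cells :: "nat \<Rightarrow> (nat \<times> nat) set" where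
  "cells c = {..<2 * 2 ^ c} \<times> {..<2 ^ c}"

definition pointers :: "nat \<Rightarrow> nat set set" where
  "pointers c = Pow {..<2 * c}"

definition syndrome :: "nat \<Rightarrow> (nat \<times> nat) set \<Rightarrow> nat set" where
  "syndrome c x = {r. r < 2 * c \<and> odd (card {z \<in> x. fst z \<in> code c r})}"

lemma finite_cells: "finite (cells c)" and card_cells: "card (cells c) = 2 * (2 ^ c)\<^sup>2"
  by (simp_all add: cells_def card_cartesian_product power2_eq_square)

lemma card_pointers: "card (pointers c) = (2 ^ c)\<^sup>2"
  by (simp add: pointers_def card_Pow power_even_eq)

lemma odd_card_sym_diff:
  assumes "finite A" "finite B"
  shows "odd (card ((A - B) \<union> (B - A))) \<longleftrightarrow> odd (card A) \<noteq> odd (card B)"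
proof -
  have "(A - B) \<union> (A \<inter> B) = A" "(B - A) \<union> (A \<inter> B) = B" by blast+
  moreover have "card ((A - B) \<union> (A \<inter> B)) = card (A - B) + card (A \<inter> B)"
    "card ((B - A) \<union> (A \<inter> B)) = card (B - A) + card (A \<inter> B)"
    "card ((A - B) \<union> (B - A)) = card (A - B) + card (B - A)"
    using assms by (intro card_Un_disjoint; blast)+
  ultimately have "card A = card (A - B) + card (A \<inter> B)" "card B = card (B - A) + card (A \<inter> B)"
    "card ((A - B) \<union> (B - A)) = card (A - B) + card (B - A)" by simp_all
  then show ?thesis by presburger
qed

text \<open>Linearity over the field with two elements, where the difference of two vectors is the
  symmetric difference of sets.\<close>

lemma syndrome_collision_iff:
  assumes "finite x"
  shows "syndrome c (x \<inter> y) = syndrome c (x \<inter> y') \<longleftrightarrow>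
    syndrome c (x \<inter> ((y - y') \<union> (y' - y))) = {}"
proof -
  have "odd (card {z \<in> x \<inter> ((y - y') \<union> (y' - y)). fst z \<in> code c r}) \<longleftrightarrow>
    odd (card {z \<in> x \<inter> y. fst z \<in> code c r}) \<noteq> odd (card {z \<in> x \<inter> y'. fst z \<in> code c r})" for r
  proof -
    have eq: "{z \<in> x \<inter> ((y - y') \<union> (y' - y)). fst z \<in> code c r} =
        ({z \<in> x \<inter> y. fst z \<in> code c r} - {z \<in> x \<inter> y'. fst z \<in> code c r})
        \<union> ({z \<in> x \<inter> y'. fst z \<in> code c r} - {z \<in> x \<inter> y. fst z \<in> code c r})"
      by auto
    show ?thesis unfolding eq by (rule odd_card_sym_diff) (use assms in auto)
  qed
  then show ?thesis unfolding syndrome_def by (simp only: set_eq_iff mem_Collect_eq empty_iff) blast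
qed

text \<open>By characters: the indicator of the kernel is, up to scaling, a product of factors one
  plus a character. After expansion, a nonempty \<open>S\<close> contributes zero because its
  codeword does not vanish on \<open>D\<close>, and only the trivial character remains.\<close>

lemma card_syndrome_kernel:
  assumes D: "\<And>S. S \<subseteq> {..<2 * c} \<Longrightarrow> S \<noteq> {} \<Longrightarrow> \<exists>z\<in>D \<inter> cells c. odd (card {r \<in> S. fst z \<in> code c r})"
  shows "card (pointers c) * card {x \<in> Pow (cells c). syndrome c (x \<inter> D) = {}} = card (Pow (cells c))"
proof -
  define s :: "(nat \<times> nat) \<Rightarrow> nat \<Rightarrow> int" where
    "s z r = (if z \<in> D \<and> fst z \<in> code c r then - 1 else 1)" for z r
  have fin: "finite x" if "x \<in> Pow (cells c)" for x using that finite_cells finite_subset by auto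
  have sx: "(\<Prod>z\<in>x. s z r) = (- 1) ^ card {z \<in> x \<inter> D. fst z \<in> code c r}" if "finite x" for x r
  proof -
    have "{z \<in> x. z \<in> D \<and> fst z \<in> code c r} = {z \<in> x \<inter> D. fst z \<in> code c r}" by auto
    then show ?thesis unfolding s_def using prod_minus_one[OF that] by simp
  qed
  have ind: "(\<Prod>r<2 * c. 1 + (\<Prod>z\<in>x. s z r)) = 2 ^ (2 * c) * of_bool (syndrome c (x \<inter> D) = {})"
    if x: "x \<in> Pow (cells c)" for x
  proof (cases "syndrome c (x \<inter> D) = {}")
    case True
    then have "(\<Prod>z\<in>x. s z r) = 1" if "r < 2 * c" for r
      using that unfolding sx[OF fin[OF x]] syndrome_def by (auto simp: minus_one_power_iff)
    then show ?thesis using True by (simp add: prod_constant)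
  next
    case False
    then obtain r where "r < 2 * c" "odd (card {z \<in> x \<inter> D. fst z \<in> code c r})"
      by (auto simp: syndrome_def)
    then have "r \<in> {..<2 * c}" "1 + (\<Prod>z\<in>x. s z r) = 0" unfolding sx[OF fin[OF x]] by auto
    then have "(\<Prod>r<2 * c. 1 + (\<Prod>z\<in>x. s z r)) = 0" by (intro prod_zero) auto
    then show ?thesis using False by simp
  qed
  have chars: "(\<Prod>z\<in>cells c. 1 + (\<Prod>r\<in>S. s z r)) = (if S = {} then 2 ^ card (cells c) else 0)"
    if S: "S \<in> Pow {..<2 * c}" for S
  proof (cases "S = {}")
    case False
    with D S obtain z where z: "z \<in> D" "z \<in> cells c" "odd (card {r \<in> S. fst z \<in> code c r})" by blast
    have "finite S" using S finite_subset by auto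
    then have "(\<Prod>r\<in>S. s z r) = (- 1) ^ card {r \<in> S. fst z \<in> code c r}"
      using z unfolding s_def by (simp add: prod_minus_one)
    then have "1 + (\<Prod>r\<in>S. s z r) = 0" using z by simp
    then have "(\<Prod>z\<in>cells c. 1 + (\<Prod>r\<in>S. s z r)) = 0"
      using z finite_cells by (intro prod_zero) auto
    then show ?thesis using False by simp
  qed (simp add: prod_constant)
  have "2 ^ (2 * c) * int (card {x \<in> Pow (cells c). syndrome c (x \<inter> D) = {}})
      = (\<Sum>x\<in>Pow (cells c). 2 ^ (2 * c) * of_bool (syndrome c (x \<inter> D) = {}))"
    using finite_cells by (simp add: of_bool_def sum.If_cases Int_def flip: sum_distrib_left)
  also have "\<dots> = (\<Sum>x\<in>Pow (cells c). \<Prod>r<2 * c. 1 + (\<Prod>z\<in>x. s z r))"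
    by (intro sum.cong refl ind[symmetric])
  also have "\<dots> = (\<Sum>x\<in>Pow (cells c). \<Sum>S\<in>Pow {..<2 * c}. \<Prod>r\<in>S. \<Prod>z\<in>x. s z r)"
    by (simp add: sum_Pow_prod)
  also have "\<dots> = (\<Sum>S\<in>Pow {..<2 * c}. \<Sum>x\<in>Pow (cells c). \<Prod>z\<in>x. \<Prod>r\<in>S. s z r)"
    by (subst sum.swap, intro sum.cong refl prod.swap)
  also have "\<dots> = (\<Sum>S\<in>Pow {..<2 * c}. if S = {} then 2 ^ card (cells c) else 0)"
    by (intro sum.cong refl) (simp only: sum_Pow_prod[OF finite_cells] chars)
  also have "\<dots> = 2 ^ card (cells c)"
    by (simp add: sum.delta)
  finally have "int (2 ^ (2 * c) * card {x \<in> Pow (cells c). syndrome c (x \<inter> D) = {}}) = int (2 ^ card (cells c))"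
    by simp
  then show ?thesis
    unfolding of_nat_eq_iff by (simp add: pointers_def card_Pow finite_cells)
qed

lemma card_even_cells:
  assumes "S \<subseteq> {..<2 * c}" "S \<noteq> {}"
  shows "2 * card {z \<in> cells c. even (card {r \<in> S. fst z \<in> code c r})} \<le> 3 * (2 ^ c)\<^sup>2"
proof -
  let ?O = "{i. i < 2 * 2 ^ c \<and> odd (card {r \<in> S. i \<in> code c r})}"
  let ?E = "{i. i < 2 * 2 ^ c \<and> even (card {r \<in> S. i \<in> code c r})}"
  have "{..<2 * 2 ^ c :: nat} = ?O \<union> ?E" by auto
  then have "card {..<2 * 2 ^ c :: nat} = card ?O + card ?E"
    using card_Un_disjoint[of ?O ?E] by fastforce
  then have "2 * card ?E \<le> 3 * 2 ^ c" using code_distance[OF assms] by simp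
  moreover have "{z \<in> cells c. even (card {r \<in> S. fst z \<in> code c r})} = ?E \<times> {..<2 ^ c}"
    by (auto simp: cells_def)
  ultimately show ?thesis by (simp add: card_cartesian_product power2_eq_square)
qed

text \<open>If \<open>y'\<close> is exceptional, one of the fewer than \<open>2 ^ (2 * c)\<close>
  nonzero codewords vanishes on the symmetric difference of \<open>y\<close> and \<open>y'\<close>.
  Such a word has at most \<open>3 / 2 * K\<close> zeros among the \<open>2 * K\<close> cells, and
  \<open>y'\<close> is determined by the difference; the product of both counts is
  \<open>\<zeta>\<close>.\<close>

lemma gadget_syndrome:
  "gadget (pointers c) (Pow (cells c)) (\<lambda>x y. syndrome c (x \<inter> y)) (2 powr (2 * real c + 3 / 2 * (2 ^ c)\<^sup>2))"
proof
  show "finite (pointers c)" "pointers c \<noteq> {}" by (auto simp: pointers_def)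
  show "finite (Pow (cells c))" "Pow (cells c) \<noteq> {}" using finite_cells by auto
  show "syndrome c (x \<inter> y) \<in> pointers c" for x y by (auto simp: syndrome_def pointers_def)
  show "syndrome c (x \<inter> y) = syndrome c (y \<inter> x)" for x y by (simp add: Int_commute)
  fix y assume y: "y \<in> Pow (cells c)"
  let ?D = "\<lambda>y'. (y - y') \<union> (y' - y)"
  let ?Bad = "{y' \<in> Pow (cells c). card (Pow (cells c)) < card (pointers c) *
      card {x \<in> Pow (cells c). syndrome c (x \<inter> y) = syndrome c (x \<inter> y')}}"
  let ?N = "\<lambda>S. {y' \<in> Pow (cells c). ?D y' \<subseteq> {z \<in> cells c. even (card {r \<in> S. fst z \<in> code c r})}}"
  let ?T = "Pow {..<2 * c} - {{}}"
  have "?Bad \<subseteq> (\<Union>S\<in>?T. ?N S)"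
  proof
    fix y' assume y': "y' \<in> ?Bad"
    show "y' \<in> (\<Union>S\<in>?T. ?N S)"
    proof (rule ccontr)
      assume no: "y' \<notin> (\<Union>S\<in>?T. ?N S)"
      have sub: "?D y' \<subseteq> cells c" using y y' by auto
      have "\<exists>z\<in>?D y' \<inter> cells c. odd (card {r \<in> S. fst z \<in> code c r})"
        if "S \<subseteq> {..<2 * c}" "S \<noteq> {}" for S
      proof -
        have "\<not> ?D y' \<subseteq> {z \<in> cells c. even (card {r \<in> S. fst z \<in> code c r})}"
          using no y' that by auto
        then show ?thesis using sub by blast
      qed
      from card_syndrome_kernel[OF this]
      have "card (pointers c) * card {x \<in> Pow (cells c). syndrome c (x \<inter> ?D y') = {}}
        = card (Pow (cells c))" .
      moreover have "{x \<in> Pow (cells c). syndrome c (x \<inter> ?D y') = {}}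
          = {x \<in> Pow (cells c). syndrome c (x \<inter> y) = syndrome c (x \<inter> y')}"
        using syndrome_collision_iff[OF finite_subset[OF _ finite_cells]] by blast
      ultimately show False using y' by simp
    qed
  qed
  then have "card ?Bad \<le> card (\<Union>S\<in>?T. ?N S)"
    by (rule card_mono[rotated]) (auto simp: finite_cells)
  also have "\<dots> \<le> (\<Sum>S\<in>?T. card (?N S))" by (rule card_UN_le) simp
  finally have "real (card ?Bad) \<le> (\<Sum>S\<in>?T. real (card (?N S)))"
    unfolding of_nat_sum[symmetric] of_nat_le_iff .
  also have "\<dots> \<le> (\<Sum>S\<in>?T. 2 powr (3 / 2 * (2 ^ c)\<^sup>2))"
  proof (intro sum_mono)
    fix S assume S: "S \<in> ?T"
    let ?E = "{z \<in> cells c. even (card {r \<in> S. fst z \<in> code c r})}"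
    have "card (?N S) = card (?D ` ?N S)"
    proof (intro card_image[symmetric] inj_onI)
      fix u v assume "?D u = ?D v"
      then show "u = v" by blast
    qed
    also have "\<dots> \<le> card (Pow ?E)" using finite_cells by (intro card_mono) auto
    also have "\<dots> = 2 ^ card ?E" using finite_cells by (simp add: card_Pow)
    finally have "real (card (?N S)) \<le> real (2 ^ card ?E)" by (rule of_nat_mono)
    also have "\<dots> = 2 powr card ?E" by (simp add: powr_realpow)
    also have "\<dots> \<le> 2 powr (3 / 2 * (2 ^ c)\<^sup>2)"
    proof (intro powr_mono)
      have "real (2 * card ?E) \<le> real (3 * (2 ^ c)\<^sup>2)"
        using card_even_cells[of S c] S by (intro of_nat_mono) auto
      then show "real (card ?E) \<le> 3 / 2 * (2 ^ c)\<^sup>2" by simp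
    qed simp
    finally show "real (card (?N S)) \<le> 2 powr (3 / 2 * (2 ^ c)\<^sup>2)" .
  qed
  also have "\<dots> = card ?T * 2 powr (3 / 2 * (2 ^ c)\<^sup>2)" by simp
  also have "\<dots> \<le> card (Pow {..<2 * c}) * 2 powr (3 / 2 * (2 ^ c)\<^sup>2)"
    by (intro mult_right_mono of_nat_mono card_mono) auto
  also have "\<dots> = 2 powr (2 * real c + 3 / 2 * (2 ^ c)\<^sup>2)"
    using powr_realpow[of 2 "2 * c"] by (simp add: card_Pow powr_add)
  finally show "real (card ?Bad) \<le> 2 powr (2 * real c + 3 / 2 * (2 ^ c)\<^sup>2)" .
qed

section \<open>Greedy independent sets as NOR circuits\<close>

text \<open>The choice of a vertex is settled by the smaller ones, so the recursive condition has
  only one solution. This replaces reasoning about the fold.\<close>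

lemma lfmis_eqI:
  assumes sub: "I \<subseteq> {..<n}"
    and eq: "\<And>v. v < n \<Longrightarrow> v \<in> I \<longleftrightarrow> (\<forall>u\<in>I. u < v \<longrightarrow> {u, v} \<notin> E)"
  shows "lfmis n E = I"
proof -
  let ?f = "\<lambda>v I. if \<exists>u\<in>I. {u, v} \<in> E then I else insert v I"
  have "fold ?f [0..<k] {} = I \<inter> {..<k}" if "k \<le> n" for k
    using that
  proof (induction k)
    case (Suc k)
    then have "fold ?f [0..<Suc k] {} = ?f k (I \<inter> {..<k})" by simp
    also have "\<dots> = I \<inter> {..<Suc k}"
    proof (cases "k \<in> I")
      case True
      then have "\<not> (\<exists>u\<in>I \<inter> {..<k}. {u, k} \<in> E)" using eq[of k] Suc.prems by auto
      then show ?thesis using True by (auto simp: less_Suc_eq)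
    next
      case False
      then have "\<exists>u\<in>I \<inter> {..<k}. {u, k} \<in> E" using eq[of k] Suc.prems by auto
      then have "?f k (I \<inter> {..<k}) = I \<inter> {..<k}" by simp
      also have "\<dots> = I \<inter> {..<Suc k}" using False by (auto simp: less_Suc_eq)
      finally show ?thesis .
    qed
    finally show ?case .
  qed simp
  from this[of n] show ?thesis using sub by (auto simp: lfmis_def)
qed

text \<open>A topological sorting: gates become numbers below \<open>n\<close> in such a way that
  the greedy order evaluates every gate after its predecessors.\<close>

lemma ranked_numbering:
  fixes \<rho> :: "'v \<Rightarrow> nat"
  assumes "finite V"
  shows "\<exists>\<nu>::'v \<Rightarrow> nat. inj_on \<nu> V \<and> \<nu> ` V \<subseteq> {..<card V} \<and>
    (\<forall>u\<in>V. \<forall>v\<in>V. \<rho> u < \<rho> v \<longrightarrow> \<nu> u < \<nu> v)"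
  using assms
proof (induction V rule: finite_ranking_induct[where f = \<rho>])
  case (insert x S)
  show ?case
  proof (cases "x \<in> S")
    case True
    then show ?thesis using insert.IH by (simp add: insert_absorb)
  next
    case False
    from insert.IH obtain \<nu> :: "'v \<Rightarrow> nat" where \<nu>: "inj_on \<nu> S" "\<nu> ` S \<subseteq> {..<card S}"
      "\<forall>u\<in>S. \<forall>v\<in>S. \<rho> u < \<rho> v \<longrightarrow> \<nu> u < \<nu> v" by blast
    let ?\<nu> = "\<nu>(x := card S)"
    have S: "?\<nu> u = \<nu> u" "\<nu> u < card S" if "u \<in> S" for u using that False \<nu>(2) by auto
    have "inj_on ?\<nu> (insert x S)"
    proof (rule inj_onI)
      fix u v assume "u \<in> insert x S" "v \<in> insert x S" "?\<nu> u = ?\<nu> v"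
      then show "u = v" using S \<nu>(1) False by (auto dest: inj_onD) (metis less_irrefl)+
    qed
    moreover have "?\<nu> ` insert x S \<subseteq> {..<card (insert x S)}"
      using S insert.hyps(1) False by (auto simp: less_Suc_eq)
    moreover have "\<forall>u\<in>insert x S. \<forall>v\<in>insert x S. \<rho> u < \<rho> v \<longrightarrow> ?\<nu> u < ?\<nu> v"
    proof (intro ballI impI)
      fix u v assume uv: "u \<in> insert x S" "v \<in> insert x S" "\<rho> u < \<rho> v"
      then have "u \<in> S" using insert.hyps(2) by (metis insertE leD less_irrefl)
      then show "?\<nu> u < ?\<nu> v" using uv S \<nu>(3) by (cases "v = x") auto
    qed
    ultimately show ?thesis by blast
  qed
qed simp

definition wires :: "('v \<Rightarrow> nat) \<Rightarrow> ('v \<Rightarrow> 'v set) \<Rightarrow> 'v set \<Rightarrow> nat set set" where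
  "wires \<nu> pre W = (\<Union>v\<in>W. (\<lambda>u. {\<nu> u, \<nu> v}) ` pre v)"

text \<open>The greedy algorithm evaluates a circuit of NOR gates: a vertex is selected iff none of its
  smaller neighbours is.\<close>

lemma lfmis_circuit:
  fixes \<rho> :: "'v \<Rightarrow> nat"
  assumes inj: "inj_on \<nu> V" and ran: "\<nu> ` V \<subseteq> {..<n}"
    and mono: "\<And>u v. u \<in> V \<Longrightarrow> v \<in> V \<Longrightarrow> \<rho> u < \<rho> v \<Longrightarrow> \<nu> u < \<nu> v"
    and pre: "\<And>u v. v \<in> V \<Longrightarrow> u \<in> pre v \<Longrightarrow> u \<in> V \<and> \<rho> u < \<rho> v"
    and lab: "\<And>v. v \<in> V \<Longrightarrow> lab v \<longleftrightarrow> (\<forall>u\<in>pre v. \<not> lab u)"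
  shows "lfmis n (wires \<nu> pre V) = \<nu> ` {v \<in> V. lab v} \<union> ({..<n} - \<nu> ` V)"
proof (rule lfmis_eqI)
  \<comment> \<open>Numbers that encode no gate are isolated vertices, so the greedy algorithm
    always takes them.\<close>
  let ?I = "\<nu> ` {v \<in> V. lab v} \<union> ({..<n} - \<nu> ` V)"
  show "?I \<subseteq> {..<n}" using ran by auto
  have edge: "{\<nu> u, \<nu> v} \<in> wires \<nu> pre V \<longleftrightarrow> u \<in> pre v" if "u \<in> V" "v \<in> V" "\<nu> u < \<nu> v" for u v
  proof
    assume "{\<nu> u, \<nu> v} \<in> wires \<nu> pre V"
    then obtain u' v' where *: "v' \<in> V" "u' \<in> pre v'" "{\<nu> u, \<nu> v} = {\<nu> u', \<nu> v'}"
      by (auto simp: wires_def)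
    from pre[OF *(1,2)] have u': "u' \<in> V" "\<nu> u' < \<nu> v'" using * mono by auto
    then have "\<nu> u = \<nu> u'" "\<nu> v = \<nu> v'" using *(3) that(3) by (auto simp: doubleton_eq_iff)
    then show "u \<in> pre v" using inj that * u' by (metis inj_onD)
  qed (use that in \<open>auto simp: wires_def\<close>)
  fix x assume x: "x < n"
  show "x \<in> ?I \<longleftrightarrow> (\<forall>u\<in>?I. u < x \<longrightarrow> {u, x} \<notin> wires \<nu> pre V)"
  proof (cases "x \<in> \<nu> ` V")
    case False
    have "{u, x} \<notin> wires \<nu> pre V" for u
    proof
      assume "{u, x} \<in> wires \<nu> pre V"
      then obtain u' v' where "v' \<in> V" "u' \<in> pre v'" "{u, x} = {\<nu> u', \<nu> v'}"
        by (auto simp: wires_def)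
      then have "x \<in> \<nu> ` V" using pre by (auto simp: doubleton_eq_iff)
      then show False using False by simp
    qed
    then show ?thesis using x False by auto
  next
    case True
    then obtain v where v: "v \<in> V" "x = \<nu> v" by auto
    have "x \<in> ?I \<longleftrightarrow> lab v" using v inj by (auto dest: inj_onD)
    also have "\<dots> \<longleftrightarrow> (\<forall>u\<in>pre v. \<not> lab u)" by (rule lab[OF v(1)])
    also have "\<dots> \<longleftrightarrow> (\<forall>u\<in>?I. u < x \<longrightarrow> {u, x} \<notin> wires \<nu> pre V)"
    proof
      assume no: "\<forall>u\<in>pre v. \<not> lab u"
      show "\<forall>u\<in>?I. u < x \<longrightarrow> {u, x} \<notin> wires \<nu> pre V"
      proof (intro ballI impI)
        fix w assume w: "w \<in> ?I" "w < x"
        show "{w, x} \<notin> wires \<nu> pre V"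
        proof
          assume e: "{w, x} \<in> wires \<nu> pre V"
          then obtain u' v' where "v' \<in> V" "u' \<in> pre v'" "{w, x} = {\<nu> u', \<nu> v'}"
            by (auto simp: wires_def)
          then have "w \<in> \<nu> ` V" using pre by (auto simp: doubleton_eq_iff)
          with w obtain u where "u \<in> V" "lab u" "w = \<nu> u" by auto
          with edge[of u v] e v w no show False by auto
        qed
      qed
    next
      assume all: "\<forall>u\<in>?I. u < x \<longrightarrow> {u, x} \<notin> wires \<nu> pre V"
      show "\<forall>u\<in>pre v. \<not> lab u"
      proof (intro ballI notI)
        fix u assume u: "u \<in> pre v" "lab u"
        then have "u \<in> V" "\<nu> u < \<nu> v" using pre v mono by auto
        with all u v edge show False by auto
      qed
    qed
    finally show ?thesis .
  qed
qed

text \<open>The larger endpoint of an edge is the gate that it feeds, so disjoint sets of gates own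
  disjoint edges, even when wired by different inputs.\<close>

lemma wires_disjoint:
  fixes \<rho> :: "'v \<Rightarrow> nat"
  assumes inj: "inj_on \<nu> V"
    and mono: "\<And>u v. u \<in> V \<Longrightarrow> v \<in> V \<Longrightarrow> \<rho> u < \<rho> v \<Longrightarrow> \<nu> u < \<nu> v"
    and pre: "\<And>u v. v \<in> V \<Longrightarrow> u \<in> pre v \<Longrightarrow> u \<in> V \<and> \<rho> u < \<rho> v"
    and pre': "\<And>u v. v \<in> V \<Longrightarrow> u \<in> pre' v \<Longrightarrow> u \<in> V \<and> \<rho> u < \<rho> v"
    and W: "W \<subseteq> V" "W' \<subseteq> V" "W \<inter> W' = {}"
  shows "wires \<nu> pre W \<inter> wires \<nu> pre' W' = {}"
proof (rule equals0I)
  fix e assume "e \<in> wires \<nu> pre W \<inter> wires \<nu> pre' W'"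
  then obtain u v u' v' where *: "v \<in> W" "u \<in> pre v" "e = {\<nu> u, \<nu> v}"
    "v' \<in> W'" "u' \<in> pre' v'" "e = {\<nu> u', \<nu> v'}" by (auto simp: wires_def)
  have "\<nu> u < \<nu> v" "\<nu> u' < \<nu> v'" using * pre[of v u] pre'[of v' u'] mono W by blast+
  then have "\<nu> v = \<nu> v'" using * by (auto simp: doubleton_eq_iff)
  then have "v = v'" using inj * W by (metis inj_onD subsetD)
  then show False using * W by blast
qed

lemma wires_subset:
  fixes \<rho> :: "'v \<Rightarrow> nat"
  assumes ran: "\<nu> ` V \<subseteq> {..<n}"
    and mono: "\<And>u v. u \<in> V \<Longrightarrow> v \<in> V \<Longrightarrow> \<rho> u < \<rho> v \<Longrightarrow> \<nu> u < \<nu> v"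
    and pre: "\<And>u v. v \<in> V \<Longrightarrow> u \<in> pre v \<Longrightarrow> u \<in> V \<and> \<rho> u < \<rho> v"
    and W: "W \<subseteq> V"
  shows "wires \<nu> pre W \<subseteq> vertex_pairs n"
proof
  fix e assume "e \<in> wires \<nu> pre W"
  then obtain u v where *: "v \<in> V" "u \<in> pre v" "e = {\<nu> u, \<nu> v}" using W by (auto simp: wires_def)
  then have "\<nu> u < \<nu> v" "u \<in> V" using pre mono by blast+
  then show "e \<in> vertex_pairs n" using * ran by (auto simp: vertex_pairs_def)
qed

section \<open>A NOR circuit for the chase\<close>

datatype gate = One | Inp bool nat nat nat | And nat nat nat | Par bool nat nat nat nat
  | Neg nat nat | Dec nat "nat set"

type_synonym level_inputs = "nat \<Rightarrow> nat set \<Rightarrow> (nat \<times> nat) set"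

text \<open>The pointers visited by the chase. Block \<open>j\<close> of the circuit computes the \<open>j\<close>-th one.\<close>

primrec chase :: "nat \<Rightarrow> level_inputs \<Rightarrow> level_inputs \<Rightarrow> nat \<Rightarrow> nat set" where
  "chase c a b 0 = {}"
| "chase c a b (Suc j) = syndrome c (a j (chase c a b j) \<inter> b j (chase c a b j))"

text \<open>The case \<open>0\<close> is chosen so that the starting pointer, too, is the syndrome
  of the intersection at its block.\<close>

definition meet :: "nat \<Rightarrow> level_inputs \<Rightarrow> level_inputs \<Rightarrow> nat \<Rightarrow> (nat \<times> nat) set" where
  "meet c a b j = (case j of 0 \<Rightarrow> {} | Suc i \<Rightarrow> a i (chase c a b i) \<inter> b i (chase c a b i))"

text \<open>\<open>Par d j i k 0\<close> is the parity of the first \<open>k\<close> inputs of a chain of exclusive-or gates, and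
  \<open>Par d j i k t\<close> for \<open>t = 1, \<dots>, 4\<close> are the auxiliary gates that absorb the next input. A chain with
  \<open>d = False\<close> sums the row \<open>i\<close> of the intersection; one with \<open>d = True\<close> sums the results for the
  rows in the support \<open>code c i\<close>.\<close>

definition feed :: "nat \<Rightarrow> bool \<Rightarrow> nat \<Rightarrow> nat \<Rightarrow> nat \<Rightarrow> gate set" where
  "feed c d j i k = (if d then (if k \<in> code c i then {Par False j k (2 ^ c) 0} else {}) else {And j i k})"

text \<open>Each input bit is one edge, from the decoder gate of a pointer to the input gate of a
  cell. Just one decoder of a block is on, so \<open>Inp\<close> reads, negated, the bit of the row
  at the current pointer. In block 0 the input gates have no predecessors and are on, which yields
  an empty intersection. \<open>Par\<close> with \<open>t = 4\<close> is the usual equality from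
  four NOR gates, and the next gate with \<open>t = 0\<close> negates it.\<close>

fun pre :: "nat \<Rightarrow> level_inputs \<Rightarrow> level_inputs \<Rightarrow> gate \<Rightarrow> gate set" where
  "pre c a b One = {}"
| "pre c a b (Inp d j i k) = (case j of 0 \<Rightarrow> {}
    | Suc j' \<Rightarrow> Dec j' ` {S \<in> pointers c. (i, k) \<in> (if d then b else a) j' S})"
| "pre c a b (And j i k) = {Inp False j i k, Inp True j i k}"
| "pre c a b (Par d j i k t) =
    (if t = 0 then (case k of 0 \<Rightarrow> {One} | Suc k' \<Rightarrow> {Par d j i k' 4})
     else if t = 1 then insert (Par d j i k 0) (feed c d j i k)
     else if t = 2 then {Par d j i k 0, Par d j i k 1}
     else if t = 3 then insert (Par d j i k 1) (feed c d j i k)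
     else {Par d j i k 2, Par d j i k 3})"
| "pre c a b (Neg j r) = {Par True j r (2 * 2 ^ c) 0}"
| "pre c a b (Dec j S) = (\<lambda>r. Par True j r (2 * 2 ^ c) 0) ` ({..<2 * c} - S) \<union> Neg j ` S"

text \<open>Only for \<open>t = 0\<close> may \<open>k\<close> equal the length of the chain, since
  that gate carries the final parity.\<close>

fun gates :: "nat \<Rightarrow> nat \<Rightarrow> gate \<Rightarrow> bool" where
  "gates c L One \<longleftrightarrow> True"
| "gates c L (Inp d j i k) \<longleftrightarrow> j \<le> L \<and> i < 2 * 2 ^ c \<and> k < 2 ^ c"
| "gates c L (And j i k) \<longleftrightarrow> j \<le> L \<and> i < 2 * 2 ^ c \<and> k < 2 ^ c"
| "gates c L (Par d j i k t) \<longleftrightarrow> j \<le> L \<and> t < 5 \<and> i < (if d then 2 * c else 2 * 2 ^ c) \<and>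
    (let len = (if d then 2 * 2 ^ c else 2 ^ c) in if t = 0 then k \<le> len else k < len)"
| "gates c L (Neg j r) \<longleftrightarrow> j \<le> L \<and> r < 2 * c"
| "gates c L (Dec j S) \<longleftrightarrow> j \<le> L \<and> S \<in> pointers c"

text \<open>A witness of acyclicity. Five layers for each of \<open>2 ^ c\<close> and then
  \<open>2 * 2 ^ c\<close> parity steps give \<open>15 * 2 ^ c\<close>; the constants make room for
  the remaining gates of a block.\<close>

fun depth :: "nat \<Rightarrow> gate \<Rightarrow> nat" where
  "depth c One = 0"
| "depth c (Inp d j i k) = j * (15 * 2 ^ c + 20) + 1"
| "depth c (And j i k) = j * (15 * 2 ^ c + 20) + 2"
| "depth c (Par d j i k t) = j * (15 * 2 ^ c + 20) + (if d then 5 * 2 ^ c + 8 else 3) + 5 * k + t"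
| "depth c (Neg j r) = j * (15 * 2 ^ c + 20) + 15 * 2 ^ c + 9"
| "depth c (Dec j S) = j * (15 * 2 ^ c + 20) + 15 * 2 ^ c + 10"

definition parity :: "(nat \<Rightarrow> bool) \<Rightarrow> nat \<Rightarrow> bool" where
  "parity f k \<longleftrightarrow> odd (card {i. i < k \<and> f i})"

definition fed :: "nat \<Rightarrow> level_inputs \<Rightarrow> level_inputs \<Rightarrow> bool \<Rightarrow> nat \<Rightarrow> nat \<Rightarrow> nat \<Rightarrow> bool" where
  "fed c a b d j i k \<longleftrightarrow> (if d then k \<in> code c i \<and> parity (\<lambda>k'. (k, k') \<in> meet c a b j) (2 ^ c)
     else (i, k) \<in> meet c a b j)"

fun lab :: "nat \<Rightarrow> level_inputs \<Rightarrow> level_inputs \<Rightarrow> gate \<Rightarrow> bool" where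
  "lab c a b One \<longleftrightarrow> True"
| "lab c a b (Inp d j i k) \<longleftrightarrow>
    (case j of 0 \<Rightarrow> True | Suc j' \<Rightarrow> (i, k) \<notin> (if d then b else a) j' (chase c a b j'))"
| "lab c a b (And j i k) \<longleftrightarrow> (i, k) \<in> meet c a b j"
| "lab c a b (Par d j i k t) \<longleftrightarrow>
    (let s = parity (fed c a b d j i) k; x = fed c a b d j i k in
     if t = 0 then s else if t = 1 then \<not> s \<and> \<not> x else if t = 2 then \<not> s \<and> x
     else if t = 3 then s \<and> \<not> x else s = x)"
| "lab c a b (Neg j r) \<longleftrightarrow> r \<notin> chase c a b j"
| "lab c a b (Dec j S) \<longleftrightarrow> S = chase c a b j"

lemma parity_0: "\<not> parity f 0" by (simp add: parity_def)

lemma parity_Suc: "parity f (Suc k) \<longleftrightarrow> parity f k \<noteq> f k"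
proof -
  have "{i. i < Suc k \<and> f i} = (if f k then insert k {i. i < k \<and> f i} else {i. i < k \<and> f i})"
    by (auto simp: less_Suc_eq)
  then show ?thesis by (simp add: parity_def)
qed

lemma chase_in: "chase c a b j \<in> pointers c"
  by (cases j) (auto simp: pointers_def syndrome_def)

lemma chase_meet: "chase c a b j = syndrome c (meet c a b j)"
  by (cases j) (auto simp: meet_def syndrome_def)

lemma pre_gates: "gates c L v \<Longrightarrow> u \<in> pre c a b v \<Longrightarrow> gates c L u \<and> depth c u < depth c v"
proof (induction c a b v rule: pre.induct)
  case (2 c a b d j i k)
  then show ?case by (cases j) auto
next
  case (4 c a b d j i k t)
  have "t < 5" using 4 by simp
  then consider "t = 0" | "t = 1" | "t = 2" | "t = 3" | "t = 4" by linarith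
  then show ?case
  proof cases
    case 1
    then show ?thesis using 4 by (cases k) (auto simp: Let_def split: if_splits)
  qed (use 4 in \<open>auto simp: Let_def feed_def code_def split: if_splits\<close>)
qed (auto simp: pointers_def Let_def)

text \<open>Membership in a codeword depends only on the row of a cell, so a syndrome bit is a
  parity of row parities, and all \<open>2 * c\<close> bits share the row parities.\<close>

lemma parity_syndrome:
  assumes sub: "z \<subseteq> cells c" and r: "r < 2 * c"
  shows "parity (\<lambda>i. i \<in> code c r \<and> parity (\<lambda>k. (i, k) \<in> z) (2 ^ c)) (2 * 2 ^ c) \<longleftrightarrow> r \<in> syndrome c z"
proof -
  let ?I = "{i. i < 2 * 2 ^ c \<and> i \<in> code c r}"
  have "{x \<in> z. fst x \<in> code c r} = (SIGMA i:?I. {k. k < 2 ^ c \<and> (i, k) \<in> z})"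
    using sub by (auto simp: cells_def)
  then have "card {x \<in> z. fst x \<in> code c r} = (\<Sum>i\<in>?I. card {k. k < 2 ^ c \<and> (i, k) \<in> z})"
    by (simp add: card_SigmaI)
  then have "odd (card {x \<in> z. fst x \<in> code c r}) \<longleftrightarrow>
      odd (card {i \<in> ?I. odd (card {k. k < 2 ^ c \<and> (i, k) \<in> z})})"
    by (simp add: even_sum_iff)
  then show ?thesis using r by (simp add: syndrome_def parity_def conj_assoc)
qed

lemma lab_pre:
  assumes v: "gates c L v"
    and a: "\<And>j S. j < L \<Longrightarrow> S \<in> pointers c \<Longrightarrow> a j S \<subseteq> cells c"
  shows "lab c a b v \<longleftrightarrow> (\<forall>u\<in>pre c a b v. \<not> lab c a b u)"
proof -
  have meet: "meet c a b j \<subseteq> cells c" if "j \<le> L" for j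
  proof (cases j)
    case (Suc i)
    then have "a i (chase c a b i) \<subseteq> cells c" using that by (intro a chase_in) simp
    then show ?thesis by (auto simp: meet_def Suc)
  qed (simp add: meet_def)
  have final: "lab c a b (Par True j r (2 * 2 ^ c) 0) \<longleftrightarrow> r \<in> chase c a b j" if "j \<le> L" "r < 2 * c" for j r
    using parity_syndrome[OF meet[OF that(1)] that(2)] unfolding chase_meet by (simp add: fed_def[abs_def])
  show ?thesis
  proof (cases v)
    case One
    then show ?thesis by simp
  next
    case (Inp d j i k)
    then show ?thesis using chase_in[of c a b "j - 1"] by (cases j) auto
  next
    case (And j i k)
    then show ?thesis by (cases j) (auto simp: meet_def)
  next
    case (Par d j i k t)
    have feed: "(\<forall>u\<in>feed c d j i k. \<not> lab c a b u) \<longleftrightarrow> \<not> fed c a b d j i k"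
      by (auto simp: feed_def fed_def[abs_def])
    have "t < 5" using v Par by simp
    then consider "t = 0" | "t = 1" | "t = 2" | "t = 3" | "t = 4" by linarith
    then show ?thesis
    proof cases
      case 1
      then show ?thesis using Par by (cases k) (auto simp: parity_0 parity_Suc)
    qed (use Par feed in \<open>auto simp: Let_def\<close>)
  next
    case (Neg j r)
    then show ?thesis using v final by (simp del: lab.simps(4))
  next
    case (Dec j S)
    then have "S \<subseteq> {..<2 * c}" "j \<le> L" using v by (auto simp: pointers_def)
    moreover have "chase c a b j \<subseteq> {..<2 * c}" using chase_in by (auto simp: pointers_def)
    moreover have "(\<forall>u\<in>pre c a b v. \<not> lab c a b u) \<longleftrightarrow>
        (\<forall>r\<in>{..<2 * c} - S. \<not> lab c a b (Par True j r (2 * 2 ^ c) 0)) \<and> (\<forall>r\<in>S. \<not> lab c a b (Neg j r))"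
      by (simp add: Dec ball_Un del: lab.simps(4))
    moreover have "\<dots> \<longleftrightarrow> (\<forall>r\<in>{..<2 * c} - S. r \<notin> chase c a b j) \<and> (\<forall>r\<in>S. r \<in> chase c a b j)"
      using final[OF \<open>j \<le> L\<close>] by (simp del: lab.simps(4))
    ultimately show ?thesis unfolding Dec lab.simps by blast
  qed
qed

text \<open>The quadratic terms come from the cells, the chains along the rows and the decoders. The
  chains for the syndrome bits number \<open>2 * c\<close> of length \<open>2 * 2 ^ c\<close>, which
  is absorbed by \<open>c \<le> 2 ^ c\<close>.\<close>

lemma card_gates: "finite {v. gates c L v} \<and> card {v. gates c L v} \<le> 1 + (L + 1) * 60 * (2 ^ c)\<^sup>2"
proof -
  define q :: nat where "q = 2 ^ c"
  define A1 where "A1 = (\<lambda>(d, j, i, k). Inp d j i k) ` (UNIV \<times> {..L} \<times> {..<2 * q} \<times> {..<q})"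
  define A2 where "A2 = (\<lambda>(j, i, k). And j i k) ` ({..L} \<times> {..<2 * q} \<times> {..<q})"
  define A3 where "A3 = (\<lambda>(j, i, k, t). Par False j i k t) ` ({..L} \<times> {..<2 * q} \<times> {..q} \<times> {..<5})"
  define A4 where "A4 = (\<lambda>(j, i, k, t). Par True j i k t) ` ({..L} \<times> {..<2 * c} \<times> {..2 * q} \<times> {..<5})"
  define A5 where "A5 = (\<lambda>(j, r). Neg j r) ` ({..L} \<times> {..<2 * c})"
  define A6 where "A6 = (\<lambda>(j, S). Dec j S) ` ({..L} \<times> pointers c)"
  have sub: "{v. gates c L v} \<subseteq> {One} \<union> (A1 \<union> (A2 \<union> (A3 \<union> (A4 \<union> (A5 \<union> A6)))))"
  proof
    fix v assume "v \<in> {v. gates c L v}"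
    then show "v \<in> {One} \<union> (A1 \<union> (A2 \<union> (A3 \<union> (A4 \<union> (A5 \<union> A6)))))"
      by (cases v) (auto simp: A1_def A2_def A3_def A4_def A5_def A6_def q_def image_iff Let_def
          split: if_splits)
  qed
  have fp: "finite (pointers c)" by (simp add: pointers_def)
  have fin: "finite A1" "finite A2" "finite A3" "finite A4" "finite A5" "finite A6"
    unfolding A1_def A2_def A3_def A4_def A5_def A6_def using fp by auto
  have c1: "card A1 \<le> 2 * ((L + 1) * (2 * q * q))"
    unfolding A1_def by (rule order_trans[OF card_image_le]) (auto simp: card_cartesian_product)
  have c2: "card A2 \<le> (L + 1) * (2 * q * q)"
    unfolding A2_def by (rule order_trans[OF card_image_le]) (auto simp: card_cartesian_product)
  have c3: "card A3 \<le> (L + 1) * (2 * q * ((q + 1) * 5))"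
    unfolding A3_def by (rule order_trans[OF card_image_le]) (auto simp: card_cartesian_product)
  have c4: "card A4 \<le> (L + 1) * (2 * c * ((2 * q + 1) * 5))"
    unfolding A4_def by (rule order_trans[OF card_image_le]) (auto simp: card_cartesian_product)
  have c5: "card A5 \<le> (L + 1) * (2 * c)"
    unfolding A5_def by (rule order_trans[OF card_image_le]) (auto simp: card_cartesian_product)
  have c6: "card A6 \<le> (L + 1) * q\<^sup>2"
    unfolding A6_def using fp
    by (intro order_trans[OF card_image_le]) (auto simp: card_cartesian_product card_pointers q_def)
  have "card {v. gates c L v} \<le> card ({One} \<union> (A1 \<union> (A2 \<union> (A3 \<union> (A4 \<union> (A5 \<union> A6))))))"
    by (rule card_mono[OF _ sub]) (simp add: fin)
  also have "\<dots> \<le> 1 + (card A1 + (card A2 + (card A3 + (card A4 + (card A5 + card A6)))))"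
    using card_Un_le[of "{One}" "A1 \<union> (A2 \<union> (A3 \<union> (A4 \<union> (A5 \<union> A6))))"]
      card_Un_le[of A1 "A2 \<union> (A3 \<union> (A4 \<union> (A5 \<union> A6)))"]
      card_Un_le[of A2 "A3 \<union> (A4 \<union> (A5 \<union> A6))"] card_Un_le[of A3 "A4 \<union> (A5 \<union> A6)"]
      card_Un_le[of A4 "A5 \<union> A6"] card_Un_le[of A5 A6] by simp
  also have "\<dots> \<le> 1 + (L + 1) * (2 * (2 * q * q) + 2 * q * q + 2 * q * ((q + 1) * 5)
      + 2 * c * ((2 * q + 1) * 5) + 2 * c + q\<^sup>2)"
    using c1 c2 c3 c4 c5 c6 unfolding distrib_left by linarith
  also have "\<dots> \<le> 1 + (L + 1) * (60 * q\<^sup>2)"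
  proof -
    have "c \<le> q" "1 \<le> q" using less_exp[of c] by (auto simp: q_def)
    then have "c * q \<le> q * q" "c * 1 \<le> q * q" "q * 1 \<le> q * q" by (intro mult_mono; simp)+
    then have "2 * (2 * q * q) + 2 * q * q + 2 * q * ((q + 1) * 5)
      + 2 * c * ((2 * q + 1) * 5) + 2 * c + q\<^sup>2 \<le> 60 * q\<^sup>2"
    proof -
      have "2 * (2 * q * q) + 2 * q * q + 2 * q * ((q + 1) * 5) + 2 * c * ((2 * q + 1) * 5) + 2 * c + q\<^sup>2
          = 17 * (q * q) + 10 * q + 20 * (c * q) + 12 * c"
        by (simp add: algebra_simps power2_eq_square)
      then show ?thesis
        using \<open>c * q \<le> q * q\<close> \<open>c * 1 \<le> q * q\<close> \<open>q * 1 \<le> q * q\<close>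
        unfolding power2_eq_square mult_1_right by linarith
    qed
    then show ?thesis by (intro add_left_mono mult_left_mono) auto
  qed
  finally show ?thesis using finite_subset[OF sub] fin by (simp add: q_def algebra_simps)
qed

text \<open>\<open>EA a\<close> and \<open>EB b\<close> are the wires into the input gates of the
  two players, all other wires are public, and \<open>dec\<close> yields the vertices of the last
  decoder. Disjointness makes the concatenation of the players' edge lists a legal stream.\<close>

theorem chase_graph:
  assumes n: "1 + (L + 1) * 60 * (2 ^ c)\<^sup>2 \<le> n"
  obtains E0 :: "nat set set" and EA EB :: "level_inputs \<Rightarrow> nat set set" and dec :: "nat set \<Rightarrow> nat"
  where "\<And>a b. E0 \<union> EA a \<union> EB b \<subseteq> vertex_pairs n"
    and "\<And>a. E0 \<inter> EA a = {}" "\<And>a b. (E0 \<union> EA a) \<inter> EB b = {}"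
    and "\<And>a b S. (\<And>j S. j < L \<Longrightarrow> S \<in> pointers c \<Longrightarrow> a j S \<subseteq> cells c) \<Longrightarrow> S \<in> pointers c \<Longrightarrow>
      dec S \<in> lfmis n (E0 \<union> EA a \<union> EB b) \<longleftrightarrow> S = chase c a b L"
proof -
  define V where "V = {v. gates c L v}"
  have V: "finite V" "card V \<le> n" using card_gates[of c L] n by (auto simp: V_def)
  obtain \<nu> :: "gate \<Rightarrow> nat" where inj: "inj_on \<nu> V" and ran: "\<nu> ` V \<subseteq> {..<card V}"
    and mono: "\<forall>u\<in>V. \<forall>v\<in>V. depth c u < depth c v \<longrightarrow> \<nu> u < \<nu> v"
    using ranked_numbering[OF V(1), of "depth c"] by blast
  have ran: "\<nu> ` V \<subseteq> {..<n}" using ran V(2) by force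
  have mono: "\<nu> u < \<nu> v" if "u \<in> V" "v \<in> V" "depth c u < depth c v" for u v
    using mono that by blast
  have pre: "u \<in> V \<and> depth c u < depth c v" if "v \<in> V" "u \<in> pre c a b v" for a b u v
    using that pre_gates unfolding V_def by blast
  define VA where "VA = {v \<in> V. \<exists>j i k. v = Inp False j i k}"
  define VB where "VB = {v \<in> V. \<exists>j i k. v = Inp True j i k}"
  define V0 where "V0 = V - VA - VB"
  \<comment> \<open>Placeholder inputs make each edge set a function of what its owner knows; the
    gates wired with them do not consult the input replaced.\<close>
  let ?o = "\<lambda>(_::nat) (_::nat set). {} :: (nat \<times> nat) set"
  define E0 where "E0 = wires \<nu> (pre c ?o ?o) V0"
  define EA where "EA a = wires \<nu> (pre c a ?o) VA" for a
  define EB where "EB b = wires \<nu> (pre c ?o b) VB" for b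
  have sub: "V0 \<subseteq> V" "VA \<subseteq> V" "VB \<subseteq> V" by (auto simp: V0_def VA_def VB_def)
  have E: "E0 \<union> EA a \<union> EB b = wires \<nu> (pre c a b) V" for a b
  proof -
    have 0: "pre c ?o ?o v = pre c a b v" if "v \<in> V0" for v
      using that by (cases v) (auto simp: V0_def VA_def VB_def)
    have A: "pre c a ?o v = pre c a b v" if "v \<in> VA" for v
      using that by (auto simp: VA_def cong: nat.case_cong)
    have B: "pre c ?o b v = pre c a b v" if "v \<in> VB" for v
      using that by (auto simp: VB_def cong: nat.case_cong)
    have "V = V0 \<union> VA \<union> VB" by (auto simp: V0_def VA_def VB_def)
    then show ?thesis unfolding E0_def EA_def EB_def wires_def using 0 A B by simp
  qed
  show thesis
  proof
    show "E0 \<union> EA a \<union> EB b \<subseteq> vertex_pairs n" for a b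
      unfolding E by (rule wires_subset[OF ran mono pre]) auto
    show "E0 \<inter> EA a = {}" for a
      unfolding E0_def EA_def
      by (rule wires_disjoint[OF inj mono pre pre sub(1,2)]) (auto simp: V0_def)
    have "E0 \<inter> EB b = {}" for b
      unfolding E0_def EB_def
      by (rule wires_disjoint[OF inj mono pre pre sub(1,3)]) (auto simp: V0_def)
    moreover have "EA a \<inter> EB b = {}" for a b
      unfolding EA_def EB_def
      by (rule wires_disjoint[OF inj mono pre pre sub(2,3)]) (auto simp: VA_def VB_def)
    ultimately show "(E0 \<union> EA a) \<inter> EB b = {}" for a b by blast
    fix a b :: level_inputs and S
    assume a: "\<And>j S. j < L \<Longrightarrow> S \<in> pointers c \<Longrightarrow> a j S \<subseteq> cells c" and S: "S \<in> pointers c"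
    have lf: "lfmis n (E0 \<union> EA a \<union> EB b) = \<nu> ` {v \<in> V. lab c a b v} \<union> ({..<n} - \<nu> ` V)"
      unfolding E
    proof (rule lfmis_circuit[OF inj ran mono pre])
      show "lab c a b v \<longleftrightarrow> (\<forall>u\<in>pre c a b v. \<not> lab c a b u)" if "v \<in> V" for v
        using that lab_pre a unfolding V_def by blast
    qed
    have D: "Dec L S \<in> V" using S by (simp add: V_def)
    have "\<nu> (Dec L S) \<in> lfmis n (E0 \<union> EA a \<union> EB b) \<longleftrightarrow> lab c a b (Dec L S)"
      unfolding lf using D inj by (auto dest: inj_onD)
    then show "\<nu> (Dec L S) \<in> lfmis n (E0 \<union> EA a \<union> EB b) \<longleftrightarrow> S = chase c a b L" by simp
  qed
qed

section \<open>Derandomisation of streaming algorithms\<close>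

text \<open>A key names a step of the run: the pass and the edge read, or \<open>None\<close> at the
  end of the pass. An algorithm thus is a table of distributions indexed by key and memory
  contents.\<close>

type_synonym key = "nat \<times> nat set option"

definition act :: "stream_alg \<Rightarrow> key \<Rightarrow> bool list \<Rightarrow> (bool list \<times> nat set) pmf" where
  "act a k = (case snd k of None \<Rightarrow> on_end a (fst k) | Some e \<Rightarrow> on_edge a (fst k) e)"

primrec run :: "(key \<Rightarrow> bool list \<Rightarrow> (bool list \<times> nat set) pmf) \<Rightarrow> key list
    \<Rightarrow> bool list \<times> nat set \<Rightarrow> (bool list \<times> nat set) pmf" where
  "run F [] c = return_pmf c"
| "run F (k # ks) c = bind_pmf (apply_action (F k) c) (run F ks)"

definition pass_keys :: "nat \<Rightarrow> nat set list \<Rightarrow> key list" where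
  "pass_keys i es = map (\<lambda>e. (i, Some e)) es @ [(i, None)]"

definition keys :: "nat \<Rightarrow> nat set list \<Rightarrow> key list" where
  "keys p es = concat (map (\<lambda>i. pass_keys i es) [0..<p])"

lemma run_append: "run F (ks @ ks') c = bind_pmf (run F ks c) (run F ks')"
  by (induction ks arbitrary: c)
    (auto simp: bind_return_pmf bind_assoc_pmf intro!: bind_pmf_cong)

lemma read_edges_run: "read_edges a i es c = run (act a) (map (\<lambda>e. (i, Some e)) es) c"
  by (induction es arbitrary: c) (auto simp: act_def intro!: bind_pmf_cong)

lemma run_single: "run F [k] c = apply_action (F k) c"
proof -
  have "run F [] = return_pmf" by (rule ext) simp
  then show ?thesis by (simp add: bind_return_pmf')
qed

lemma run_passes_run: "run_passes a es p = run (act a) (keys p es) (init a, {})"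
proof (induction p)
  case (Suc p)
  have "keys (Suc p) es = keys p es @ map (\<lambda>e. (p, Some e)) es @ [(p, None)]"
    by (simp add: keys_def pass_keys_def)
  moreover have "run (act a) [(p, None)] = apply_action (on_end a p)"
    by (rule ext) (simp only: run_single, simp add: act_def)
  moreover have "read_edges a p es = run (act a) (map (\<lambda>e. (p, Some e)) es)"
    by (rule ext) (rule read_edges_run)
  moreover have "run (act a) (map (\<lambda>e. (p, Some e)) es @ [(p, None)])
      = (\<lambda>c. bind_pmf (run (act a) (map (\<lambda>e. (p, Some e)) es) c) (run (act a) [(p, None)]))"
    by (rule ext) (rule run_append)
  ultimately show ?case
    by (simp only: run_append run_passes.simps Suc bind_assoc_pmf)
qed (simp add: keys_def)

lemma distinct_keys: "distinct es \<Longrightarrow> distinct (keys p es)"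
proof (induction p)
  case (Suc p)
  have "k \<in> set (keys p es) \<Longrightarrow> fst k < p" for k by (auto simp: keys_def pass_keys_def)
  then show ?case using Suc
    by (auto simp: keys_def pass_keys_def distinct_map inj_on_def)
qed (simp add: keys_def)

lemma run_cong: "(\<And>k. k \<in> set ks \<Longrightarrow> F k = G k) \<Longrightarrow> run F ks c = run G ks c"
proof (induction ks arbitrary: c)
  case (Cons k ks)
  have "run F ks = run G ks" by (rule ext) (use Cons in simp)
  then show ?case using Cons.prems by simp
qed simp

text \<open>A key that does not recur is used for at most one sample, and it makes no difference
  whether that sample is drawn on demand or before the run.\<close>

lemma run_upd:
  assumes "distinct ks"
  shows "run (F(k := (F k)(m := \<mu>))) ks c
    = bind_pmf \<mu> (\<lambda>x. run (F(k := (F k)(m := return_pmf x))) ks c)"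
  using assms
proof (induction ks arbitrary: c)
  case (Cons k' ks)
  show ?case
  proof (cases "k' = k")
    case True
    have rest: "run (F(k := f)) ks = run F ks" for f
      by (rule ext, rule run_cong) (use Cons.prems True in auto)
    show ?thesis
    proof (cases "fst c = m")
      case True
      show ?thesis unfolding \<open>k' = k\<close> run.simps rest fun_upd_same
        by (simp add: True apply_action_def bind_map_pmf bind_return_pmf)
    next
      case False
      then show ?thesis unfolding \<open>k' = k\<close> run.simps rest fun_upd_same
        by (simp add: apply_action_def)
    qed
  next
    case False
    have "run (F(k := (F k)(m := \<mu>))) ks = (\<lambda>c. bind_pmf \<mu> (\<lambda>x. run (F(k := (F k)(m := return_pmf x))) ks c))"
    proof (rule ext)
      fix c show "run (F(k := (F k)(m := \<mu>))) ks c
          = bind_pmf \<mu> (\<lambda>x. run (F(k := (F k)(m := return_pmf x))) ks c)"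
        by (rule Cons.IH) (use Cons.prems in simp)
    qed
    then show ?thesis unfolding run.simps fun_upd_other[OF False] by (simp only: bind_commute_pmf[of \<mu>])
  qed
qed simp

lemma exists_ge_expectation:
  fixes f :: "'a \<Rightarrow> real"
  assumes "\<And>x. \<bar>f x\<bar> \<le> B"
  shows "\<exists>x\<in>set_pmf \<mu>. measure_pmf.expectation \<mu> f \<le> f x"
proof (rule ccontr)
  assume "\<not> ?thesis"
  then have "AE x in measure_pmf \<mu>. f x < measure_pmf.expectation \<mu> f"
    by (auto simp: AE_measure_pmf_iff not_le)
  moreover have "integrable (measure_pmf \<mu>) f"
    by (rule measure_pmf.integrable_const_bound[where B = B]) (use assms in auto)
  ultimately show False using measure_pmf.expectation_less by blast
qed

lemma sum_pmf_bind:
  assumes "finite \<Omega>"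
  shows "(\<Sum>\<omega>\<in>\<Omega>. pmf (bind_pmf \<mu> (f \<omega>)) (t \<omega>)) = measure_pmf.expectation \<mu> (\<lambda>x. \<Sum>\<omega>\<in>\<Omega>. pmf (f \<omega> x) (t \<omega>))"
proof -
  have "integrable (measure_pmf \<mu>) (\<lambda>x. pmf (f \<omega> x) (t \<omega>))" for \<omega>
    by (rule measure_pmf.integrable_const_bound[where B = 1]) (auto simp: pmf_le_1)
  then show ?thesis by (simp add: pmf_bind)
qed

lemma sum_pmf_bind_le:
  assumes "finite \<Omega>"
  shows "\<exists>x\<in>set_pmf \<mu>. (\<Sum>\<omega>\<in>\<Omega>. pmf (bind_pmf \<mu> (f \<omega>)) (t \<omega>)) \<le> (\<Sum>\<omega>\<in>\<Omega>. pmf (f \<omega> x) (t \<omega>))"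
  unfolding sum_pmf_bind[OF assms]
proof (rule exists_ge_expectation[where B = "card \<Omega>"])
  fix x
  have "\<bar>\<Sum>\<omega>\<in>\<Omega>. pmf (f \<omega> x) (t \<omega>)\<bar> = (\<Sum>\<omega>\<in>\<Omega>. pmf (f \<omega> x) (t \<omega>))" by (simp add: sum_nonneg)
  also have "\<dots> \<le> (\<Sum>\<omega>\<in>\<Omega>. 1)" by (intro sum_mono pmf_le_1)
  finally show "\<bar>\<Sum>\<omega>\<in>\<Omega>. pmf (f \<omega> x) (t \<omega>)\<bar> \<le> card \<Omega>" by simp
qed

text \<open>Every table entry is consulted at most once in a run, so the success probability is affine in
  each entry and the entries can be fixed one by one without decreasing it.\<close>

lemma derandomise_entries:
  fixes ks :: "'w \<Rightarrow> key list"
  assumes fin: "finite \<Omega>" and ks: "\<And>\<omega>. \<omega> \<in> \<Omega> \<Longrightarrow> distinct (ks \<omega>)" and "finite Z"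
  shows "\<exists>D. (\<forall>k m. (k, m) \<in> Z \<longrightarrow> D k m \<in> set_pmf (F k m)) \<and>
    (\<Sum>\<omega>\<in>\<Omega>. pmf (map_pmf snd (run F (ks \<omega>) c)) (t \<omega>))
    \<le> (\<Sum>\<omega>\<in>\<Omega>. pmf (map_pmf snd (run (\<lambda>k m. if (k, m) \<in> Z then return_pmf (D k m) else F k m) (ks \<omega>) c)) (t \<omega>))"
  using \<open>finite Z\<close>
proof (induction Z rule: finite_induct)
  case (insert z Z)
  let ?G = "\<lambda>Z D k m. if (k, m) \<in> Z then return_pmf (D k m) else F k m"
  obtain D where D: "\<And>k m. (k, m) \<in> Z \<Longrightarrow> D k m \<in> set_pmf (F k m)"
    "(\<Sum>\<omega>\<in>\<Omega>. pmf (map_pmf snd (run F (ks \<omega>) c)) (t \<omega>))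
      \<le> (\<Sum>\<omega>\<in>\<Omega>. pmf (map_pmf snd (run (?G Z D) (ks \<omega>) c)) (t \<omega>))"
    using insert.IH by blast
  obtain k m where z: "z = (k, m)" by fastforce
  let ?H = "\<lambda>x. (?G Z D)(k := (?G Z D k)(m := return_pmf x))"
  \<comment> \<open>The entry at \<open>z\<close> is still random, so writing it as an update by
    itself makes \<open>run_upd\<close> applicable.\<close>
  have eq: "?G Z D = (?G Z D)(k := (?G Z D k)(m := F k m))"
    using insert.hyps(2) by (auto simp: fun_eq_iff z)
  have "run (?G Z D) (ks \<omega>) c = bind_pmf (F k m) (\<lambda>x. run (?H x) (ks \<omega>) c)" if "\<omega> \<in> \<Omega>" for \<omega>
    by (rule trans[OF arg_cong[where f = "\<lambda>F. run F (ks \<omega>) c", OF eq] run_upd[OF ks[OF that]]])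
  then have "(\<Sum>\<omega>\<in>\<Omega>. pmf (map_pmf snd (run (?G Z D) (ks \<omega>) c)) (t \<omega>))
      = (\<Sum>\<omega>\<in>\<Omega>. pmf (bind_pmf (F k m) (\<lambda>x. map_pmf snd (run (?H x) (ks \<omega>) c))) (t \<omega>))"
    by (intro sum.cong refl) (simp only: map_bind_pmf)
  moreover obtain x where x: "x \<in> set_pmf (F k m)"
    "(\<Sum>\<omega>\<in>\<Omega>. pmf (bind_pmf (F k m) (\<lambda>x. map_pmf snd (run (?H x) (ks \<omega>) c))) (t \<omega>))
      \<le> (\<Sum>\<omega>\<in>\<Omega>. pmf (map_pmf snd (run (?H x) (ks \<omega>) c)) (t \<omega>))"
    using sum_pmf_bind_le[OF fin, of "F k m" "\<lambda>\<omega> x. map_pmf snd (run (?H x) (ks \<omega>) c)" t] by blast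
  moreover have "?H x = ?G (insert z Z) (D(k := (D k)(m := x)))"
    by (auto simp: fun_eq_iff z)
  ultimately have "(\<Sum>\<omega>\<in>\<Omega>. pmf (map_pmf snd (run F (ks \<omega>) c)) (t \<omega>))
      \<le> (\<Sum>\<omega>\<in>\<Omega>. pmf (map_pmf snd (run (?G (insert z Z) (D(k := (D k)(m := x)))) (ks \<omega>) c)) (t \<omega>))"
    using D(2) by simp
  moreover have "(D(k := (D k)(m := x))) k' m' \<in> set_pmf (F k' m')" if "(k', m') \<in> insert z Z" for k' m'
    using that x(1) by (auto simp: z intro: D(1))
  ultimately show ?case by blast
qed auto

primrec run_det :: "(key \<Rightarrow> bool list \<Rightarrow> bool list \<times> nat set) \<Rightarrow> key list
    \<Rightarrow> bool list \<times> nat set \<Rightarrow> bool list \<times> nat set" where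
  "run_det D [] c = c"
| "run_det D (k # ks) c = run_det D ks (fst (D k (fst c)), snd c \<union> snd (D k (fst c)))"

definition all_keys :: "nat \<Rightarrow> nat \<Rightarrow> key set" where
  "all_keys n p = {..<p} \<times> insert None (Some ` vertex_pairs n)"

definition preserves_length :: "nat \<Rightarrow> nat \<Rightarrow> nat \<Rightarrow> (key \<Rightarrow> bool list \<Rightarrow> bool list \<times> nat set) \<Rightarrow> bool" where
  "preserves_length n p s D \<longleftrightarrow> (\<forall>k\<in>all_keys n p. \<forall>m. length m = s \<longrightarrow> length (fst (D k m)) = s)"

lemma run_return:
  assumes "preserves_length n p s D" "set ks \<subseteq> all_keys n p" "length (fst c) = s"
    and "\<And>k m. k \<in> all_keys n p \<Longrightarrow> length m = s \<Longrightarrow> F k m = return_pmf (D k m)"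
  shows "run F ks c = return_pmf (run_det D ks c)"
  using assms(2,3)
proof (induction ks arbitrary: c)
  case (Cons k ks)
  then have k: "k \<in> all_keys n p" by simp
  have "length (fst (D k (fst c))) = s" using assms(1) k Cons.prems by (auto simp: preserves_length_def)
  then show ?case using Cons k assms(4)
    by (simp add: apply_action_def bind_return_pmf case_prod_beta)
qed simp

lemma finite_vertex_pairs: "finite (vertex_pairs n)"
  by (rule finite_subset[of _ "Pow {..<n}"]) (auto simp: vertex_pairs_def)

lemma keys_subset: "set es \<subseteq> vertex_pairs n \<Longrightarrow> set (keys p es) \<subseteq> all_keys n p"
  by (auto simp: keys_def pass_keys_def all_keys_def)

text \<open>Yao's principle: averaged over the inputs in \<open>\<Omega>\<close>, some value of the
  shared random string, and then of each table entry, does at least as well as the mixture. With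
  \<open>s\<close> bits of memory only finitely many entries need to be fixed.\<close>

theorem deterministic_algorithm:
  fixes es :: "'w \<Rightarrow> nat set list"
  assumes alg: "streaming_algorithm n p s A" and out: "outputs_lfmis n p \<delta> A"
    and fin: "finite \<Omega>" and es: "\<And>\<omega>. \<omega> \<in> \<Omega> \<Longrightarrow> distinct (es \<omega>) \<and> set (es \<omega>) \<subseteq> vertex_pairs n"
  shows "\<exists>m0 D. length m0 = s \<and> preserves_length n p s D \<and>
    \<delta> * card \<Omega> \<le> card {\<omega> \<in> \<Omega>. snd (run_det D (keys p (es \<omega>)) (m0, {})) = lfmis n (set (es \<omega>))}"
proof -
  let ?t = "\<lambda>\<omega>. lfmis n (set (es \<omega>))"
  have "\<delta> * card \<Omega> = (\<Sum>\<omega>\<in>\<Omega>. \<delta>)" by simp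
  also have "\<dots> \<le> (\<Sum>\<omega>\<in>\<Omega>. pmf (bind_pmf A (\<lambda>a. map_pmf snd (run_passes a (es \<omega>) p))) (?t \<omega>))"
  proof (intro sum_mono)
    fix \<omega> assume "\<omega> \<in> \<Omega>"
    then show "\<delta> \<le> pmf (bind_pmf A (\<lambda>a. map_pmf snd (run_passes a (es \<omega>) p))) (?t \<omega>)"
      using out es by (auto simp: outputs_lfmis_def edge_stream_def output_dist_def measure_pmf_single map_bind_pmf)
  qed
  finally obtain a where a: "a \<in> set_pmf A"
    "\<delta> * card \<Omega> \<le> (\<Sum>\<omega>\<in>\<Omega>. pmf (map_pmf snd (run_passes a (es \<omega>) p)) (?t \<omega>))"
    using sum_pmf_bind_le[OF fin, of A "\<lambda>\<omega> a. map_pmf snd (run_passes a (es \<omega>) p)" ?t] by force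
  have a_space: "uses_space n p s a" using alg a(1) by (simp add: streaming_algorithm_def)
  define Z where "Z = all_keys n p \<times> {m :: bool list. length m = s}"
  have "finite {m :: bool list. length m = s}"
    using finite_lists_length_eq[of "UNIV :: bool set" s] by simp
  then have finZ: "finite Z" by (simp add: Z_def all_keys_def finite_vertex_pairs)
  obtain D where D: "\<And>k m. (k, m) \<in> Z \<Longrightarrow> D k m \<in> set_pmf (act a k m)"
    "(\<Sum>\<omega>\<in>\<Omega>. pmf (map_pmf snd (run (act a) (keys p (es \<omega>)) (init a, {}))) (?t \<omega>))
      \<le> (\<Sum>\<omega>\<in>\<Omega>. pmf (map_pmf snd (run (\<lambda>k m. if (k, m) \<in> Z then return_pmf (D k m) else act a k m)
          (keys p (es \<omega>)) (init a, {}))) (?t \<omega>))"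
    using derandomise_entries[OF fin _ finZ, of "\<lambda>\<omega>. keys p (es \<omega>)" "act a" "(init a, {})" ?t]
      es distinct_keys by blast
  have len: "preserves_length n p s D"
    unfolding preserves_length_def
  proof (intro ballI allI impI)
    fix k and m :: "bool list" assume k: "k \<in> all_keys n p" and m: "length m = s"
    then have "D k m \<in> set_pmf (act a k m)" by (intro D) (simp add: Z_def)
    then show "length (fst (D k m)) = s"
      using a_space k m unfolding uses_space_def all_keys_def act_def
      by (cases k; cases "D k m") (force split: option.splits)
  qed
  have init: "length (init a) = s" using a_space by (simp add: uses_space_def)
  note a(2)
  also have "(\<Sum>\<omega>\<in>\<Omega>. pmf (map_pmf snd (run_passes a (es \<omega>) p)) (?t \<omega>))
      \<le> (\<Sum>\<omega>\<in>\<Omega>. pmf (return_pmf (snd (run_det D (keys p (es \<omega>)) (init a, {})))) (?t \<omega>))"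
    unfolding run_passes_run
  proof (rule order_trans[OF D(2)], intro sum_mono)
    fix \<omega> assume "\<omega> \<in> \<Omega>"
    then have "run (\<lambda>k m. if (k, m) \<in> Z then return_pmf (D k m) else act a k m) (keys p (es \<omega>)) (init a, {})
        = return_pmf (run_det D (keys p (es \<omega>)) (init a, {}))"
      using keys_subset es init by (intro run_return[OF len]) (auto simp: Z_def)
    then show "pmf (map_pmf snd (run (\<lambda>k m. if (k, m) \<in> Z then return_pmf (D k m) else act a k m)
          (keys p (es \<omega>)) (init a, {}))) (?t \<omega>)
        \<le> pmf (return_pmf (snd (run_det D (keys p (es \<omega>)) (init a, {})))) (?t \<omega>)" by simp
  qed
  also have "\<dots> = (\<Sum>\<omega>\<in>\<Omega>. of_bool (snd (run_det D (keys p (es \<omega>)) (init a, {})) = ?t \<omega>))"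
    by (intro sum.cong refl) (auto simp: indicator_def)
  also have "\<dots> = card {\<omega> \<in> \<Omega>. snd (run_det D (keys p (es \<omega>)) (init a, {})) = ?t \<omega>}"
    using fin by (simp add: of_bool_def sum.If_cases Int_def)
  finally show ?thesis using len init by blast
qed

section \<open>From streaming algorithms to protocols\<close>

lemma lfmis_star:
  assumes "k < n"
  shows "lfmis n ((\<lambda>i. {0, i}) ` {1..k}) = {0} \<union> {k<..<n}"
proof (rule lfmis_eqI)
  show "{0} \<union> {k<..<n} \<subseteq> {..<n}" using assms by auto
  fix v assume "v < n"
  then show "v \<in> {0} \<union> {k<..<n} \<longleftrightarrow>
      (\<forall>u\<in>{0} \<union> {k<..<n}. u < v \<longrightarrow> {u, v} \<notin> (\<lambda>i. {0, i}) ` {1..k})"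
    by (cases "v = 0") (auto simp: doubleton_eq_iff image_iff)
qed

lemma run_det_no_memory:
  assumes "preserves_length n p 0 D" "set ks \<subseteq> all_keys n p"
  shows "run_det D ks ([], W) = ([], W \<union> (\<Union>k\<in>set ks. snd (D k [])))"
  using assms(2)
proof (induction ks arbitrary: W)
  case (Cons k ks)
  then have "fst (D k []) = []" using assms(1) by (simp add: preserves_length_def)
  then show ?case using Cons by auto
qed simp

text \<open>Without memory the output is monotone in the edge set, whereas growing a star removes
  vertices; so along a chain of stars at most one output is correct.\<close>

lemma no_memory:
  assumes alg: "streaming_algorithm n p 0 A" and out: "outputs_lfmis n p \<delta> A"
  shows "\<delta> * n \<le> 1"
proof -
  define es :: "nat \<Rightarrow> nat set list" where "es k = map (\<lambda>i. {0, i}) [1..<Suc k]" for k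
  have set_es: "set (es k) = (\<lambda>i. {0, i}) ` {1..k}" for k
    by (simp only: es_def set_map set_upt atLeastLessThanSuc_atLeastAtMost)
  have es: "distinct (es k) \<and> set (es k) \<subseteq> vertex_pairs n" if "k \<in> {..<n}" for k
  proof
    show "distinct (es k)"
      unfolding es_def distinct_map by (auto simp: inj_on_def doubleton_eq_iff)
    show "set (es k) \<subseteq> vertex_pairs n"
      unfolding set_es using that by (auto simp: vertex_pairs_def)
  qed
  obtain m0 D where D: "length m0 = 0" "preserves_length n p 0 D"
    "\<delta> * card {..<n} \<le> card {k \<in> {..<n}. snd (run_det D (keys p (es k)) (m0, {})) = lfmis n (set (es k))}"
    using deterministic_algorithm[OF alg out, of "{..<n}" es] es by auto
  let ?C = "{k \<in> {..<n}. snd (run_det D (keys p (es k)) (m0, {})) = lfmis n (set (es k))}"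
  have no: False if "k \<in> ?C" "l \<in> ?C" "k < l" for k l
  proof -
    have out: "snd (run_det D (keys p (es i)) (m0, {})) = (\<Union>k\<in>set (keys p (es i)). snd (D k []))"
      if "i < n" for i
      using run_det_no_memory[OF D(2) keys_subset, of "es i" "{}"] es[of i] that D(1) by simp
    have "set (keys p (es k)) \<subseteq> set (keys p (es l))"
      using \<open>k < l\<close> by (auto simp: keys_def pass_keys_def set_es)
    then have "lfmis n (set (es k)) \<subseteq> lfmis n (set (es l))"
      using that out[of k] out[of l] by auto
    moreover have "l \<in> lfmis n (set (es k))" "l \<notin> lfmis n (set (es l))"
      using that lfmis_star[of k n] lfmis_star[of l n] unfolding set_es by auto
    ultimately show False by blast
  qed
  have "card ?C \<le> 1"
  proof (rule card_le_Suc0_iff_eq[THEN iffD2, folded One_nat_def])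
    show "\<forall>k\<in>?C. \<forall>l\<in>?C. k = l"
    proof (intro ballI)
      fix k l assume kl: "k \<in> ?C" "l \<in> ?C"
      show "k = l" using no[OF kl] no[OF kl(2,1)] nat_neq_iff by blast
    qed
  qed simp
  then show ?thesis using D(3) by simp
qed

section \<open>One pass as two messages\<close>

definition mem_after :: "(key \<Rightarrow> bool list \<Rightarrow> bool list \<times> nat set) \<Rightarrow> key list \<Rightarrow> bool list \<Rightarrow> bool list" where
  "mem_after D ks m = fst (run_det D ks (m, {}))"

definition emitted :: "(key \<Rightarrow> bool list \<Rightarrow> bool list \<times> nat set) \<Rightarrow> key list \<Rightarrow> bool list \<Rightarrow> nat set" where
  "emitted D ks m = snd (run_det D ks (m, {}))"

lemma run_det_append: "run_det D (ks @ ks') c = run_det D ks' (run_det D ks c)"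
  by (induction ks arbitrary: c) auto

lemma run_det_emit: "run_det D ks (m, W) = (fst (run_det D ks (m, {})), W \<union> snd (run_det D ks (m, {})))"
proof (induction ks arbitrary: m W)
  case (Cons k ks)
  show ?case
    unfolding run_det.simps fst_conv snd_conv
    by (subst (1 2 3) Cons) (simp add: Un_assoc)
qed simp

lemma run_det_eq: "run_det D ks (m, W) = (mem_after D ks m, W \<union> emitted D ks m)"
  unfolding mem_after_def emitted_def by (rule run_det_emit)

lemma length_mem_after:
  assumes "preserves_length n p s D" "set ks \<subseteq> all_keys n p" "length m = s"
  shows "length (mem_after D ks m) = s"
  using assms(2,3)
proof (induction ks arbitrary: m)
  case (Cons k ks)
  then have "length (fst (D k m)) = s" using assms(1) unfolding preserves_length_def by simp
  moreover have "set ks \<subseteq> all_keys n p" using Cons.prems by simp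
  ultimately have "length (mem_after D ks (fst (D k m))) = s" by (rule Cons.IH[rotated])
  then show ?case
    using arg_cong[OF run_det_emit[of D ks "fst (D k m)" "snd (D k m)"], of fst]
    by (simp add: mem_after_def)
qed (simp add: mem_after_def)

type_synonym level = "nat set \<Rightarrow> (nat \<times> nat) set"
type_synonym history = "((bool list \<times> level) \<times> (bool list \<times> level)) list"

text \<open>Alice holds the first part of the stream and Bob the second; the messages are the memory
  contents at the two boundaries. In an even round only Alice's message matters, in an odd round
  only Bob's. Clipping ensures the right message length even on impossible histories.\<close>

locale stream_protocol =
  fixes D :: "key \<Rightarrow> bool list \<Rightarrow> bool list \<times> nat set" and m0 :: "bool list" and n p s :: nat
    and la lb :: "level_inputs \<Rightarrow> nat set list"
  assumes D: "preserves_length n p s D" and m0: "length m0 = s"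
    and la: "set (la a) \<subseteq> vertex_pairs n" and lb: "set (lb b) \<subseteq> vertex_pairs n"
begin

definition keysA where "keysA i a = map (\<lambda>e. (i, Some e)) (la a)"
definition keysB where "keysB i b = map (\<lambda>e. (i, Some e)) (lb b) @ [(i, None)]"

definition clip :: "bool list \<Rightarrow> bool list" where
  "clip m = (if length m = s then m else replicate s False)"

primrec current :: "history \<Rightarrow> bool list" where
  "current [] = m0"
| "current (e # h) = (if even (length h) then fst (fst e) else fst (snd e))"

definition msgA :: "history \<Rightarrow> level_inputs \<Rightarrow> bool list" where
  "msgA h a = clip (mem_after D (keysA (length h div 2) a) (current h))"

definition msgB :: "history \<Rightarrow> level_inputs \<Rightarrow> bool list" where
  "msgB h b = clip (mem_after D (keysB (length h div 2) b) (current h))"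

text \<open>The tape is not communicated. Each player reconstructs the own share of the output from
  the memory contents in the history and the own edges.\<close>

primrec emitA :: "history \<Rightarrow> level_inputs \<Rightarrow> nat set" where
  "emitA [] a = {}"
| "emitA (e # h) a = emitA h a
    \<union> (if even (length h) then emitted D (keysA (length h div 2) a) (current h) else {})"

primrec emitB :: "history \<Rightarrow> level_inputs \<Rightarrow> nat set" where
  "emitB [] b = {}"
| "emitB (e # h) b = emitB h b
    \<union> (if even (length h) then {} else emitted D (keysB (length h div 2) b) (current h))"

lemma keys_split: "keys (Suc i) (la a @ lb b) = keys i (la a @ lb b) @ keysA i a @ keysB i b"
  by (simp add: keys_def pass_keys_def keysA_def keysB_def)

lemma keysAB_subset: "i < p \<Longrightarrow> set (keysA i a) \<subseteq> all_keys n p" "i < p \<Longrightarrow> set (keysB i b) \<subseteq> all_keys n p"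
  using la[of a] lb[of b] by (auto simp: keysA_def keysB_def all_keys_def subset_iff)

lemma length_msg: "length (msgA h a) = s" "length (msgB h a) = s"
  by (simp_all add: msgA_def msgB_def clip_def)

text \<open>On genuine histories the memory keeps its length, so clipping has no effect. The
  recursion of \<open>hist\<close> is assumed here because the protocol can be instantiated only
  after its messages are defined.\<close>

lemma run_det_history:
  fixes hist :: "nat \<Rightarrow> level_inputs \<Rightarrow> level_inputs \<Rightarrow> history"
  assumes h0: "hist 0 a b = []"
    and hS: "\<And>j. hist (Suc j) a b = ((msgA (hist j a b) a, a j), (msgB (hist j a b) b, b j)) # hist j a b"
  shows "i \<le> p \<Longrightarrow> run_det D (keys i (la a @ lb b)) (m0, {})
      = (current (hist (2 * i) a b), emitA (hist (2 * i) a b) a \<union> emitB (hist (2 * i) a b) b)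
    \<and> length (current (hist (2 * i) a b)) = s"
proof (induction i)
  case 0
  then show ?case by (simp add: keys_def h0 m0)
next
  case (Suc i)
  have len: "length (hist j a b) = j" for j by (induction j) (simp_all add: h0 hS)
  let ?h = "hist (2 * i) a b"
  let ?h' = "hist (Suc (2 * i)) a b"
  from Suc have i: "i < p" and cur: "length (current ?h) = s"
    and IH: "run_det D (keys i (la a @ lb b)) (m0, {}) = (current ?h, emitA ?h a \<union> emitB ?h b)"
    by auto
  have cur': "current ?h' = mem_after D (keysA i a) (current ?h)"
    using length_mem_after[OF D keysAB_subset(1)[OF i] cur]
    by (simp add: hS[of "2 * i"] len msgA_def clip_def)
  have lcur': "length (current ?h') = s"
    unfolding cur' by (rule length_mem_after[OF D keysAB_subset(1)[OF i] cur])
  have cur'': "current (hist (2 * Suc i) a b) = mem_after D (keysB i b) (current ?h')"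
    using length_mem_after[OF D keysAB_subset(2)[OF i] lcur']
    by (simp add: hS[of "Suc (2 * i)"] len msgB_def clip_def)
  have lcur'': "length (current (hist (2 * Suc i) a b)) = s"
    unfolding cur'' by (rule length_mem_after[OF D keysAB_subset(2)[OF i] lcur'])
  have eA: "emitA (hist (2 * Suc i) a b) a = emitA ?h a \<union> emitted D (keysA i a) (current ?h)"
    by (simp add: hS[of "Suc (2 * i)"] hS[of "2 * i"] len)
  have eB: "emitB (hist (2 * Suc i) a b) b = emitB ?h b \<union> emitted D (keysB i b) (current ?h')"
    by (simp add: hS[of "Suc (2 * i)"] len) (simp add: hS[of "2 * i"] len)
  have run: "run_det D (keys (Suc i) (la a @ lb b)) (m0, {})
      = (mem_after D (keysB i b) (current ?h'),
         emitA ?h a \<union> emitB ?h b \<union> emitted D (keysA i a) (current ?h) \<union> emitted D (keysB i b) (current ?h'))"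
    unfolding keys_split run_det_append IH by (simp add: run_det_eq cur')
  show ?case
  proof (rule conjI)
    show "run_det D (keys (Suc i) (la a @ lb b)) (m0, {}) = (current (hist (2 * Suc i) a b),
        emitA (hist (2 * Suc i) a b) a \<union> emitB (hist (2 * Suc i) a b) b)"
      unfolding cur'' eA eB run by (simp only: Un_ac)
  qed (rule lcur'')
qed

end

definition list_of :: "'a set \<Rightarrow> 'a list" where
  "list_of S = (SOME xs. set xs = S \<and> distinct xs)"

lemma list_of: "finite S \<Longrightarrow> set (list_of S) = S \<and> distinct (list_of S)"
  unfolding list_of_def by (rule someI_ex[OF finite_distinct_list])

text \<open>The \<open>p\<close> passes yield \<open>2 * p\<close> rounds, each of which gives away
  one level; the additional level in \<open>L\<close> keeps the last pointer undetermined.\<close>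

lemma streaming_error_graph:
  fixes \<kappa> \<delta> :: real and E0 :: "nat set set" and EA EB :: "level_inputs \<Rightarrow> nat set set"
  assumes \<kappa>: "\<kappa> \<ge> 1" and L: "L = Suc (2 * p)"
    and alg: "streaming_algorithm n p s A" and out: "outputs_lfmis n p \<delta> A"
    and G: "\<And>a b. E0 \<union> EA a \<union> EB b \<subseteq> vertex_pairs n"
      "\<And>a. E0 \<inter> EA a = {}" "\<And>a b. (E0 \<union> EA a) \<inter> EB b = {}"
      "\<And>a b S. (\<And>j S. j < L \<Longrightarrow> S \<in> pointers c \<Longrightarrow> a j S \<subseteq> cells c) \<Longrightarrow> S \<in> pointers c \<Longrightarrow>
        dec S \<in> lfmis n (E0 \<union> EA a \<union> EB b) \<longleftrightarrow> S = chase c a b L"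
  defines "K \<equiv> real ((2 ^ c)\<^sup>2)"
  defines "\<epsilon> \<equiv> \<kappa> * sqrt (K * 2 powr (2 * real c + 3 / 2 * K) / 2 powr (2 * K))"
  shows "\<delta> \<le> 4 * p * (r / K + (2 ^ s) ^ (4 * p + 2) * 2 powr K / \<kappa> ^ r + \<epsilon>) + 2 * (1 / K + \<epsilon>)"
proof -
  define la where "la a = list_of (E0 \<union> EA a)" for a
  define lb where "lb b = list_of (EB b)" for b
  have fin: "finite (E0 \<union> EA a)" "finite (EB b)" for a b
    using G(1)[of a b] finite_subset[OF _ finite_vertex_pairs] by blast+
  have la: "set (la a) = E0 \<union> EA a" "distinct (la a)" for a
    unfolding la_def using list_of[OF fin(1)] by blast+
  have lb: "set (lb b) = EB b" "distinct (lb b)" for b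
    unfolding lb_def using list_of[OF fin(2)] by blast+
  interpret gadget "pointers c" "Pow (cells c)" "\<lambda>x y. syndrome c (x \<inter> y)" "2 powr (2 * real c + 3 / 2 * (2 ^ c)\<^sup>2)"
    by (rule gadget_syndrome)
  let ?I = "inputs L"
  have fin_I: "finite (?I \<times> ?I)" using finite_inputs by simp
  let ?es = "\<lambda>(a, b). la a @ lb b"
  have es: "distinct (?es \<omega>) \<and> set (?es \<omega>) \<subseteq> vertex_pairs n" for \<omega>
    using la lb G by (cases \<omega>) auto
  obtain m0 D where D: "length m0 = s" "preserves_length n p s D"
    "\<delta> * card (?I \<times> ?I) \<le> card {\<omega> \<in> ?I \<times> ?I.
      snd (run_det D (keys p (?es \<omega>)) (m0, {})) = lfmis n (set (?es \<omega>))}"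
    using deterministic_algorithm[OF alg out fin_I, of ?es] es by blast
  interpret S: stream_protocol D m0 n p s la lb
    using D la lb G(1) by unfold_locales auto
  let ?Msg = "{m :: bool list. length m = s}"
  have Msg: "finite ?Msg" "card ?Msg = 2 ^ s"
    using finite_lists_length_eq[of "UNIV :: bool set" s] card_lists_length_eq[of "UNIV :: bool set" s]
    by simp_all
  interpret protocol "pointers c" "Pow (cells c)" "\<lambda>x y. syndrome c (x \<inter> y)"
    "2 powr (2 * real c + 3 / 2 * (2 ^ c)\<^sup>2)" "{}" L \<kappa> ?Msg S.msgA S.msgB
    by unfold_locales (use \<kappa> Msg S.length_msg in \<open>auto simp: pointers_def\<close>)
  \<comment> \<open>On a correct run, a share of the output contains no decoder vertex other than
    that of the true last pointer. So the arbitrary choice is in fact unique whenever there is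
    one.\<close>
  define guess where "guess W = (if \<exists>S\<in>pointers c. dec S \<in> W
      then Some (SOME S. S \<in> pointers c \<and> dec S \<in> W) else None)" for W
  have pt: "pt (hist j a b) = chase c a b j" for j a b
    by (induction j) (simp_all add: length_hist)
  have dec: "dec S \<in> lfmis n (E0 \<union> EA a \<union> EB b) \<longleftrightarrow> S = chase c a b L"
    if "a \<in> ?I" "S \<in> pointers c" for a b S
  proof (rule G(4))
    show "a j R \<subseteq> cells c" if "j < L" "R \<in> pointers c" for j R
      using inputs_in[OF \<open>a \<in> ?I\<close> that] by simp
  qed (rule \<open>S \<in> pointers c\<close>)
  have guess: "guess W = Some (chase c a b L)"
    if aI: "a \<in> ?I" and W: "W \<subseteq> lfmis n (E0 \<union> EA a \<union> EB b)" and ch: "dec (chase c a b L) \<in> W" for a b W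
  proof -
    have uniq: "S = chase c a b L" if S: "S \<in> pointers c \<and> dec S \<in> W" for S
      using dec[OF aI, of S b] S W by blast
    have chW: "chase c a b L \<in> pointers c \<and> dec (chase c a b L) \<in> W" using ch chase_in by simp
    have "(SOME S. S \<in> pointers c \<and> dec S \<in> W) = chase c a b L"
      by (rule some_equality, rule chW, erule uniq)
    moreover have "\<exists>S\<in>pointers c. dec S \<in> W" using chW by blast
    ultimately show ?thesis unfolding guess_def by simp
  qed
  let ?ok = "{(a, b) \<in> ?I \<times> ?I. guess (S.emitA (hist (2 * p) a b) a) = Some (pt (hist L a b))
      \<or> guess (S.emitB (hist (2 * p) a b) b) = Some (pt (hist L a b))}"
  have "{\<omega> \<in> ?I \<times> ?I. snd (run_det D (keys p (?es \<omega>)) (m0, {})) = lfmis n (set (?es \<omega>))} \<subseteq> ?ok"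
  proof
    fix \<omega> assume "\<omega> \<in> {\<omega> \<in> ?I \<times> ?I. snd (run_det D (keys p (?es \<omega>)) (m0, {})) = lfmis n (set (?es \<omega>))}"
    then have w: "\<omega> \<in> ?I \<times> ?I" "snd (run_det D (keys p (?es \<omega>)) (m0, {})) = lfmis n (set (?es \<omega>))"
      by blast+
    obtain a b where \<omega>: "\<omega> = (a, b)" by (cases \<omega>)
    have a: "a \<in> ?I" and b: "b \<in> ?I" using w(1) \<omega> by simp_all
    have *: "snd (run_det D (keys p (la a @ lb b)) (m0, {})) = lfmis n (set (la a @ lb b))"
      using w(2) unfolding \<omega> case_prod_conv .
    let ?A = "S.emitA (hist (2 * p) a b) a" and ?B = "S.emitB (hist (2 * p) a b) b"
    have AB: "?A \<union> ?B = lfmis n (E0 \<union> EA a \<union> EB b)"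
      using S.run_det_history[of hist a b p, OF hist.simps order_refl] * by (simp add: la lb)
    have "dec (chase c a b L) \<in> ?A \<union> ?B" unfolding AB using dec[OF a chase_in] by simp
    moreover have subA: "?A \<subseteq> lfmis n (E0 \<union> EA a \<union> EB b)" and subB: "?B \<subseteq> lfmis n (E0 \<union> EA a \<union> EB b)"
      unfolding AB[symmetric] by (rule Un_upper1, rule Un_upper2)
    ultimately have "guess ?A = Some (pt (hist L a b)) \<or> guess ?B = Some (pt (hist L a b))"
      using guess[OF a subA] guess[OF a subB] unfolding pt by blast
    then show "\<omega> \<in> ?ok" using \<omega> a b by simp
  qed
  then have "card {\<omega> \<in> ?I \<times> ?I. snd (run_det D (keys p (?es \<omega>)) (m0, {})) = lfmis n (set (?es \<omega>))}
      \<le> card ?ok"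
    by (rule card_mono[OF finite_pairs])
  then have "\<delta> * card (?I \<times> ?I) \<le> card ?ok" using D(3) by linarith
  also have "\<dots> \<le> (2 * (2 * p) * (r / card (pointers c) + card ?Msg ^ (2 * L) * 2 ^ card (pointers c) / \<kappa> ^ r
        + ext_error \<kappa>) + 2 * (1 / card (pointers c) + ext_error \<kappa>)) * real (card (?I \<times> ?I))"
    using success_bound[of "2 * p" "\<lambda>h a. guess (S.emitA h a)" "\<lambda>h b. guess (S.emitB h b)" r]
    by (simp add: L)
  finally have "\<delta> \<le> 2 * (2 * p) * (r / card (pointers c) + card ?Msg ^ (2 * L) * 2 ^ card (pointers c) / \<kappa> ^ r
        + ext_error \<kappa>) + 2 * (1 / card (pointers c) + ext_error \<kappa>)"
    using inputs_nonempty[of L] fin_I by (simp add: mult_le_cancel_right card_gt_0_iff)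
  moreover have pow: "real (2 ^ m) = 2 powr real m" for m :: nat by (simp add: powr_realpow)
  moreover have "ext_error \<kappa> = \<epsilon>"
    unfolding ext_error_def \<epsilon>_def K_def card_pointers card_Pow[OF finite_cells] card_cells pow by simp
  moreover have "real (card ?Msg ^ (2 * L) * 2 ^ card (pointers c)) = (2 ^ s) ^ (4 * p + 2) * 2 powr K"
    unfolding of_nat_mult K_def card_pointers pow Msg by (simp add: L)
  moreover have "real (card (pointers c)) = K" by (simp add: card_pointers K_def)
  ultimately show ?thesis by simp
qed

theorem streaming_error:
  fixes \<kappa> \<delta> :: real
  assumes n: "1 + (2 * p + 2) * 60 * (2 ^ c)\<^sup>2 \<le> n" and \<kappa>: "\<kappa> \<ge> 1"
    and alg: "streaming_algorithm n p s A" and out: "outputs_lfmis n p \<delta> A"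
  defines "K \<equiv> real ((2 ^ c)\<^sup>2)"
  defines "\<epsilon> \<equiv> \<kappa> * sqrt (K * 2 powr (2 * real c + 3 / 2 * K) / 2 powr (2 * K))"
  shows "\<delta> \<le> 4 * p * (r / K + (2 ^ s) ^ (4 * p + 2) * 2 powr K / \<kappa> ^ r + \<epsilon>) + 2 * (1 / K + \<epsilon>)"
proof (rule chase_graph)
  show "1 + (Suc (2 * p) + 1) * 60 * (2 ^ c)\<^sup>2 \<le> n" using n by simp
  fix E0 :: "nat set set" and EA EB :: "level_inputs \<Rightarrow> nat set set" and dec
  assume G: "\<And>a b. E0 \<union> EA a \<union> EB b \<subseteq> vertex_pairs n"
    "\<And>a. E0 \<inter> EA a = {}" "\<And>a b. (E0 \<union> EA a) \<inter> EB b = {}"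
    "\<And>a b S. (\<And>j S. j < Suc (2 * p) \<Longrightarrow> S \<in> pointers c \<Longrightarrow> a j S \<subseteq> cells c) \<Longrightarrow> S \<in> pointers c \<Longrightarrow>
      dec S \<in> lfmis n (E0 \<union> EA a \<union> EB b) \<longleftrightarrow> S = chase c a b (Suc (2 * p))"
  show ?thesis
    unfolding K_def \<epsilon>_def by (rule streaming_error_graph[OF \<kappa> refl alg out G])
qed

section \<open>Choice of parameters\<close>

lemma error_estimate:
  assumes n: "1 + (2 * p + 2) * 60 * (2 ^ c)\<^sup>2 \<le> n" and p: "p \<ge> 1"
    and alg: "streaming_algorithm n p s A" and out: "outputs_lfmis n p \<delta> A"
  defines "K \<equiv> real ((2 ^ c)\<^sup>2)"
  shows "\<delta> \<le> 192 * (real p)\<^sup>2 * s / K\<^sup>2 + 3200 * real p / K"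
proof -
  \<comment> \<open>The square root in \<open>\<epsilon>\<close> is
    \<open>K * 2 powr (- K / 4)\<close> and has to absorb \<open>\<kappa>\<close>, while
    \<open>\<kappa>\<close> must be exponential in \<open>K\<close> for \<open>\<kappa> ^ r\<close>
    to beat the transcripts. The exponent \<open>K / 8\<close> divides the margin evenly.\<close>
  define \<kappa> where "\<kappa> = 2 powr (K / 8)"
  define \<epsilon> where "\<epsilon> = \<kappa> * sqrt (K * 2 powr (2 * real c + 3 / 2 * K) / 2 powr (2 * K))"
  \<comment> \<open>As \<open>\<kappa> ^ r = 2 powr (K / 8 * r)\<close>, the part with
    \<open>48 = 8 * 6\<close> pays for the transcripts, of which there are at most
    \<open>2 ^ (6 * p * s)\<close>, and \<open>16 = 8 * 2\<close> pays for the factor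
    \<open>2 powr K\<close> and leaves \<open>2 powr (- K)\<close>.\<close>
  define r where "r = nat \<lceil>48 * real p * s / K\<rceil> + 16"
  have K1: "K \<ge> 1" by (simp add: K_def)
  have K: "K = 2 powr (2 * real c)"
    using powr_realpow[of 2 "2 * c"] by (simp add: K_def power_even_eq)
  have "\<kappa> \<ge> 1" using K1 by (simp add: \<kappa>_def ge_one_powr_ge_zero)
  have "2 powr (2 * real c + 3 / 2 * K) / 2 powr (2 * K) = K * 2 powr (- K / 2)"
    unfolding K[symmetric] powr_add powr_diff[symmetric] times_divide_eq_right[symmetric]
    by (simp add: field_simps)
  then have "K * 2 powr (2 * real c + 3 / 2 * K) / 2 powr (2 * K) = (K * 2 powr (- K / 4))\<^sup>2"
    by (simp add: power2_eq_square field_simps flip: powr_add)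
  then have \<epsilon>_eq: "\<epsilon> = K * 2 powr (- (K / 8))"
    using K1 unfolding \<epsilon>_def \<kappa>_def by (simp add: flip: powr_add)
  \<comment> \<open>The quadratic Taylor term with \<open>ln 2 \<ge> 1 / 2\<close> is at least
    \<open>(K / 16)\<^sup>2 / 2\<close>.\<close>
  have "K\<^sup>2 / 512 \<le> 2 powr (K / 8)"
  proof -
    have "1 / 2 \<le> ln (2::real)" using ln_le_minus_one[of "1 / 2 :: real"] by (simp add: ln_div)
    then have "K / 16 \<le> K / 8 * ln 2" using K1 by (simp add: field_simps)
    then have "(K / 16)\<^sup>2 \<le> (K / 8 * ln 2)\<^sup>2" using K1 by (intro power_mono) auto
    moreover have "1 + K / 8 * ln 2 + (K / 8 * ln 2)\<^sup>2 / 2 \<le> exp (K / 8 * ln 2)"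
      using K1 by (intro exp_lower_Taylor_quadratic) auto
    moreover have "0 \<le> K / 8 * ln 2" using K1 by simp
    moreover have "2 powr (K / 8) = exp (K / 8 * ln 2)" by (simp add: powr_def)
    ultimately show ?thesis by (simp add: power_divide)
  qed
  then have "K * K / 2 powr (K / 8) \<le> 512" by (simp add: field_simps power2_eq_square)
  then have "\<epsilon> \<le> 512 / K"
    unfolding \<epsilon>_eq powr_minus using K1 by (simp add: field_simps)
  have r: "48 * real p * s / K + 16 \<le> r" "r \<le> 48 * real p * s / K + 17"
    using K1 by (simp_all add: r_def of_nat_nat) linarith+
  have "(2 ^ s) ^ (4 * p + 2) * 2 powr K / \<kappa> ^ r = 2 powr (real (s * (4 * p + 2)) + K - K / 8 * r)"
    unfolding \<kappa>_def powr_diff powr_add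
    by (simp only: power_mult[symmetric] powr_realpow powr_power zero_less_numeral) (simp add: mult.commute)
  also have "\<dots> \<le> 2 powr (- K)"
  proof (intro powr_mono)
    have "K / 8 * (48 * real p * s / K + 16) \<le> K / 8 * r"
      using K1 r by (intro mult_left_mono) auto
    moreover have "K / 8 * (48 * real p * s / K + 16) = 6 * (real p * s) + 2 * K"
      using K1 by (simp add: field_simps)
    ultimately have "6 * (real p * s) + 2 * K \<le> K / 8 * r" by simp
    moreover have "real (s * (4 * p + 2)) \<le> 6 * (real p * s)"
    proof -
      have "s * (4 * p + 2) \<le> s * (6 * p)" using p by (intro mult_left_mono) auto
      then have "real (s * (4 * p + 2)) \<le> real (s * (6 * p))" by (rule of_nat_mono)
      then show ?thesis by simp
    qed
    ultimately show "real (s * (4 * p + 2)) + K - K / 8 * r \<le> - K" by linarith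
  qed simp
  also have "\<dots> \<le> 1 / K"
  proof -
    have "K \<le> 2 powr K"
    proof -
      have "K = real ((2 ^ c)\<^sup>2)" by (simp add: K_def)
      also have "\<dots> \<le> real (2 ^ ((2 ^ c)\<^sup>2))" by (intro of_nat_mono less_imp_le less_exp)
      also have "\<dots> = 2 powr K" using powr_realpow[of 2 "(2 ^ c)\<^sup>2"] by (simp add: K_def)
      finally show ?thesis .
    qed
    then show ?thesis using K1 by (simp add: powr_minus field_simps)
  qed
  finally have t2: "(2 ^ s) ^ (4 * p + 2) * 2 powr K / \<kappa> ^ r \<le> 1 / K" .
  have "\<delta> \<le> 4 * real p * (r / K + (2 ^ s) ^ (4 * p + 2) * 2 powr K / \<kappa> ^ r + \<epsilon>) + 2 * (1 / K + \<epsilon>)"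
    using streaming_error[OF n \<open>\<kappa> \<ge> 1\<close> alg out, of r]
    unfolding \<epsilon>_def K_def of_nat_mult of_nat_numeral .
  also have "\<dots> \<le> 4 * real p * ((48 * real p * s / K + 17) / K + 1 / K + 512 / K) + 2 * (1 / K + 512 / K)"
    using r t2 \<open>\<epsilon> \<le> 512 / K\<close> K1
    by (intro add_mono mult_left_mono divide_right_mono) auto
  also have "\<dots> = 192 * (real p)\<^sup>2 * s / K\<^sup>2 + (2120 * real p + 1026) / K"
    by (simp add: power2_eq_square add_divide_distrib distrib_left)
  also have "\<dots> \<le> 192 * (real p)\<^sup>2 * s / K\<^sup>2 + 3200 * real p / K"
    using K1 p by (intro add_left_mono divide_right_mono) auto
  finally show ?thesis .
qed

text \<open>Take the largest \<open>c\<close> that fits. The next one would multiply the size by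
  four, which turns 60 into 240.\<close>

lemma exists_block_size:
  fixes n p :: nat
  assumes "121 * (2 * p + 2) \<le> n"
  shows "\<exists>c. 1 + (2 * p + 2) * 60 * (2 ^ c)\<^sup>2 \<le> n \<and> n \<le> (2 * p + 2) * 240 * (2 ^ c)\<^sup>2"
proof -
  define f where "f c = 1 + (2 * p + 2) * 60 * (2 ^ c)\<^sup>2" for c :: nat
  have bd: "c \<le> n" if "f c \<le> n" for c
  proof -
    have "c < 2 ^ c" by (rule less_exp)
    also have "\<dots> \<le> (2 ^ c)\<^sup>2" by (simp add: power2_eq_square)
    also have "\<dots> \<le> f c"
    proof -
      have "1 * (2 ^ c)\<^sup>2 \<le> (2 * p + 2) * 60 * (2 ^ c :: nat)\<^sup>2" by (intro mult_right_mono) auto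
      then show ?thesis unfolding f_def by linarith
    qed
    finally show ?thesis using that by simp
  qed
  have "f 0 \<le> n" using assms by (simp add: f_def)
  define c where "c = (GREATEST c. f c \<le> n)"
  have "f c \<le> n" unfolding c_def by (rule GreatestI_nat[of _ 0 n]) (use \<open>f 0 \<le> n\<close> bd in auto)
  moreover have "\<not> f (Suc c) \<le> n"
  proof
    assume "f (Suc c) \<le> n"
    then have "Suc c \<le> (GREATEST c. f c \<le> n)" by (rule Greatest_le_nat) (rule bd)
    then show False unfolding c_def[symmetric] by simp
  qed
  moreover have "f (Suc c) = 1 + (2 * p + 2) * 240 * (2 ^ c)\<^sup>2"
    by (simp add: f_def power2_eq_square)
  ultimately have "1 + (2 * p + 2) * 60 * (2 ^ c)\<^sup>2 \<le> n" "n \<le> (2 * p + 2) * 240 * (2 ^ c)\<^sup>2"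
    unfolding f_def by linarith+
  then show ?thesis by blast
qed

theorem theorem6p2:
  fixes \<delta> :: real
  assumes "\<delta> > 0"
  shows "\<exists>c::real. c > 0 \<and> (\<exists>N::nat. \<forall>n\<ge>N. \<forall>p\<ge>1. \<forall>s A.
           streaming_algorithm n p s A \<and> outputs_lfmis n p \<delta> A \<longrightarrow>
           real s \<ge> c * (real n ^ 2 / real p ^ 5))"
proof -
  \<comment> \<open>With \<open>1 / K \<le> 960 * p / n\<close>, the additive error is at most
    \<open>3200 * 960 * p^2 / n\<close>, and \<open>6144000 = 2 * 3200 * 960\<close> keeps it below
    \<open>\<delta> / 2\<close>. Likewise \<open>353894400 = 2 * 192 * 960 ^ 2\<close>. The minimum
    with 1 covers large \<open>\<delta>\<close> and gives \<open>C \<le> 1\<close>.\<close>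
  define \<eta> where "\<eta> = min \<delta> 1 / 6144000"
  define C where "C = min \<delta> 1 / 353894400"
  define N where "N = nat \<lceil>1 / \<eta> ^ 5\<rceil> + nat \<lceil>1 / \<delta>\<rceil> + 1"
  have pos: "\<eta> > 0" "C > 0" "C \<le> 1" using assms by (auto simp: \<eta>_def C_def)
  have "real s \<ge> C * (real n ^ 2 / real p ^ 5)"
    if n: "n \<ge> N" and p: "p \<ge> 1" and alg: "streaming_algorithm n p s A" and out: "outputs_lfmis n p \<delta> A"
    for n p s A
  proof -
    have "1 / \<eta> ^ 5 < N" "1 / \<delta> < N" unfolding N_def by linarith+
    then have nN: "1 / \<eta> ^ 5 < n" "1 / \<delta> < n" using n by linarith+
    have n0: "n > 0" using n by (simp add: N_def)
    have "s \<noteq> 0"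
    proof
      assume "s = 0"
      then have "\<delta> * n \<le> 1" using no_memory alg out by blast
      then show False using nN(2) assms by (simp add: field_simps)
    qed
    then have s1: "real s \<ge> 1" by simp
    show ?thesis
    proof (cases "C * (real n ^ 2 / real p ^ 5) \<le> 1")
      case True
      then show ?thesis using s1 by linarith
    next
      case False
      then have "real p ^ 5 < C * real n ^ 2" using p by (simp add: field_simps)
      also have "\<dots> \<le> 1 * real n ^ 2" using pos by (intro mult_right_mono) auto
      finally have p5: "real p ^ 5 < real n ^ 2" by simp
      \<comment> \<open>Otherwise \<open>p ^ 10\<close> would be at least
        \<open>\<eta> ^ 5 * n ^ 5\<close>, but it is below \<open>n ^ 4\<close>; this is impossible
        for \<open>n > 1 / \<eta> ^ 5\<close> and explains the first summand of
        \<open>N\<close>.\<close>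
      have pn: "(real p)\<^sup>2 \<le> \<eta> * n"
      proof (rule ccontr)
        assume "\<not> ?thesis"
        then have "(\<eta> * n) ^ 5 \<le> ((real p)\<^sup>2) ^ 5" using pos by (intro power_mono) auto
        also have "\<dots> = (real p ^ 5)\<^sup>2" by (simp flip: power_mult)
        also have "\<dots> \<le> (real n ^ 2)\<^sup>2" using p5 by (intro power_mono) auto
        finally have "\<eta> ^ 5 * n * real n ^ 4 \<le> 1 * real n ^ 4"
          by (simp add: power_mult_distrib power_numeral_reduce mult_ac)
        then have "\<eta> ^ 5 * n \<le> 1" using n0 by (subst (asm) mult_le_cancel_right) simp
        then show False using nN(1) pos by (simp add: field_simps)
      qed
      have "121 * (2 * p + 2) \<le> n"
      proof -
        have "real p \<le> (real p)\<^sup>2" using p by (simp add: power2_eq_square)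
        also have "\<dots> \<le> \<eta> * n" by (rule pn)
        also have "\<dots> \<le> 1 / 6144000 * n" unfolding \<eta>_def by (intro mult_right_mono) auto
        finally have "6144000 * p \<le> n" by linarith
        moreover have "121 * (2 * p + 2) \<le> 484 * p" using p by simp
        ultimately show ?thesis by linarith
      qed
      then obtain c where c: "1 + (2 * p + 2) * 60 * (2 ^ c)\<^sup>2 \<le> n" "n \<le> (2 * p + 2) * 240 * (2 ^ c)\<^sup>2"
        using exists_block_size by blast
      define K where "K = real ((2 ^ c)\<^sup>2)"
      have K0: "K > 0" by (simp add: K_def)
      have "n \<le> (4 * p) * 240 * (2 ^ c)\<^sup>2"
        using p by (intro order_trans[OF c(2)] mult_right_mono) auto
      then have "real n \<le> real ((4 * p) * 240 * (2 ^ c)\<^sup>2)" by (rule of_nat_mono)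
      then have nK: "real n \<le> 960 * p * K" by (simp add: K_def)
      have invK: "1 / K \<le> 960 * p / n" using nK K0 n0 by (simp add: field_simps)
      have "\<delta> \<le> 192 * (real p)\<^sup>2 * s / K\<^sup>2 + 3200 * real p / K"
        unfolding K_def by (rule error_estimate[OF c(1) p alg out])
      also have "\<dots> = 192 * (real p)\<^sup>2 * s * (1 / K)\<^sup>2 + 3200 * p * (1 / K)"
        by (simp add: power_divide)
      also have "\<dots> \<le> 192 * (real p)\<^sup>2 * s * (960 * p / n)\<^sup>2 + 3200 * p * (960 * p / n)"
        using invK K0 by (intro add_mono mult_left_mono power_mono) auto
      also have "\<dots> = 176947200 * s * real p ^ 4 / real n ^ 2 + 3072000 * ((real p)\<^sup>2 / n)"
        by (simp add: power_divide power_mult_distrib power_numeral_reduce mult_ac)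
      also have "(real p)\<^sup>2 / n \<le> \<eta>" using pn n0 by (simp add: field_simps)
      also have "3072000 * \<eta> \<le> \<delta> / 2" by (simp add: \<eta>_def)
      finally have "\<delta> / 2 \<le> 176947200 * s * real p ^ 4 / real n ^ 2" by simp
      then have "\<delta> * real n ^ 2 \<le> 353894400 * s * real p ^ 4" using n0 by (simp add: field_simps)
      \<comment> \<open>The estimate so far is of order \<open>n^2 / p^4\<close>; a factor
        \<open>p\<close> is given away to reach the stated exponent.\<close>
      also have "\<dots> \<le> 353894400 * s * real p ^ 5"
        using p by (intro mult_left_mono power_increasing) auto
      finally have "\<delta> / 353894400 * (real n ^ 2 / real p ^ 5) \<le> s" using p by (simp add: field_simps)
      moreover have "C * (real n ^ 2 / real p ^ 5) \<le> \<delta> / 353894400 * (real n ^ 2 / real p ^ 5)"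
        unfolding C_def by (intro mult_right_mono) auto
      ultimately show ?thesis by linarith
    qed
  qed
  then show ?thesis using pos(2) by blast
qed

end
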